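(* The operators $\partial_E$ and $\partial_H$ on the graph complex $\mathcal G$ satisfy $$\partial_E^2=\partial_H^2=(\partial_E+\partial_H)^2=0.$$
   Context: Graphs. A graph is a finite 1-dimensional CW complex (not necessarily connected, multiple edges allowed) all of whose vertices have valence at least 3. A labelling of a graph is a numbering $1,2,\dots$ of its vertices together with an arrow on each edge. An orientation is an equivalence class of labellings: reversing the arrow on one edge, or switching the numbers of two vertices, changes the orientation to the opposite one. $\mathcal G$ is the vector space, over a fixed field of characteristic zero, of linear combinations of (isomorphism classes of) oriented graphs modulo $(X,or)=-(X,-or)$; it is graded by the number of vertices. A graph with a loop (an edge with equal endpoints) is zero in $\mathcal G$, so graphs may be assumed loopless. The orientation is suppressed from the notation. Collapse. For a (non-loop) edge $e$ of $X$, $X_e$ is obtained by collapsing $e$ to a point. Induced orientation: represent the orientation of $X$ by a labelling in which the initial vertex of $e$ is 1 and the terminal vertex is 2; in $X_e$ the vertex resulting from the collapse is numbered 1, the numbers of all other vertices are reduced by one, and arrows on uncontracted edges are unchanged. Half-edges. Each half-edge $h$ begins at a vertex $v(h)$, lies in an edge $e(h)$, and has a complementary half-edge $\bar h$ with $e(h)=h\cup\bar h$. For distinct half-edges $h,k$ with $k\ne\bar h$, $X\langle hk\rangle$ is obtained by cutting $e(h)$ and $e(k)$ at their midpoints and gluing $h$ to $k$ and $\bar h$ to $\bar k$; orientation: represent the orientation of $X$ so that $h$ is the initial half-edge of $e(h)$ and $k$ is the terminal half-edge of $e(k)$; in $X\langle hk\rangle$ the edge $h\cup k$ is directed from $h$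 to $k$ and the edge $\bar h\cup\bar k$ from $\bar k$ to $\bar h$, all else unchanged. If $v(h)\ne v(k)$, $X_{hk}:=(X\langle hk\rangle)_{h\cup k}$; if $v(h)=v(k)$, $X_{hk}:=0$. One has $X_{hk}=X_{kh}$. Operators (extended linearly): $\partial_E X=\sum_e X_e$, sum over all edges $e$ of $X$; $\partial_H X=\sum X_{hk}$, sum over all unordered pairs $\{h,k\}$ of distinct half-edges of $X$ with $k\neq\bar h$. *)

theory Defs
  imports "HOL-Library.Poly_Mapping" "HOL-Library.Disjoint_Sets" "HOL.Vector_Spaces"
begin

section \<open>Graphs\<close>

text \<open>
  A finite graph without vertices of valence less than 3 is encoded by its half-edges (named by
  natural numbers): a vertex is the set of the half-edges beginning there and an edge is the set of
  its two half-edges, so that the vertices and the edges are two partitions of the set of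
  half-edges. Loops and multiple edges are allowed, the graph need not be connected, and it may be
  empty. The valence of a vertex is its cardinality.
\<close>

record hgraph =
  verts :: "nat set set"
  edges :: "nat set set"

definition halves :: "hgraph \<Rightarrow> nat set" where
  "halves X = \<Union> (edges X)"

definition wf_graph :: "hgraph \<Rightarrow> bool" where
  "wf_graph X \<longleftrightarrow>
     finite (halves X) \<and> partition_on (halves X) (edges X) \<and> partition_on (halves X) (verts X) \<and>
     (\<forall>e\<in>edges X. card e = 2) \<and> (\<forall>v\<in>verts X. card v \<ge> 3)"

definition vertex_of :: "hgraph \<Rightarrow> nat \<Rightarrow> nat set" where
  "vertex_of X h = (THE v. v \<in> verts X \<and> h \<in> v)"

definition edge_of :: "hgraph \<Rightarrow> nat \<Rightarrow> nat set" where
  "edge_of X h = (THE e. e \<in> edges X \<and> h \<in> e)"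

definition compl_half :: "hgraph \<Rightarrow> nat \<Rightarrow> nat" where
  "compl_half X h = (THE k. k \<noteq> h \<and> k \<in> edge_of X h)"

definition is_loop :: "hgraph \<Rightarrow> nat set \<Rightarrow> bool" where
  "is_loop X e \<longleftrightarrow> (\<exists>v\<in>verts X. e \<subseteq> v)"


section \<open>Labellings and orientations\<close>

text \<open>
  The vertex with number \<open>i\<close> is the entry at position \<open>i - 1\<close> of the list \<open>numbering\<close>. The arrows
  are given by the set of the initial half-edges, one in each edge.
\<close>

record labelling =
  numbering :: "nat set list"
  initial :: "nat set"

definition is_labelling :: "hgraph \<Rightarrow> labelling \<Rightarrow> bool" where
  "is_labelling X L \<longleftrightarrow>
     distinct (numbering L) \<and> set (numbering L) = verts X \<and>
     initial L \<subseteq> halves X \<and> (\<forall>e\<in>edges X. card (initial L \<inter> e) = 1)"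

definition reverse_arrow :: "nat set \<Rightarrow> labelling \<Rightarrow> labelling" where
  "reverse_arrow e L = L\<lparr>initial := (initial L - e) \<union> (e - initial L)\<rparr>"

definition swap_numbers :: "nat \<Rightarrow> nat \<Rightarrow> labelling \<Rightarrow> labelling" where
  "swap_numbers i j L =
     L\<lparr>numbering := (numbering L)[i := numbering L ! j, j := numbering L ! i]\<rparr>"

definition elementary_change :: "hgraph \<Rightarrow> (labelling \<times> labelling) set" where
  "elementary_change X = {(L, L'). is_labelling X L \<and>
     ((\<exists>e\<in>edges X. L' = reverse_arrow e L) \<or>
      (\<exists>i j. i < j \<and> j < length (numbering L) \<and> L' = swap_numbers i j L))}"

text \<open>Two labellings define the same orientation iff an even number of changes connects them.\<close>

definition orientation_of :: "hgraph \<Rightarrow> labelling \<Rightarrow> labelling set" where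
  "orientation_of X L = (elementary_change X O elementary_change X)\<^sup>* `` {L}"

definition orientations :: "hgraph \<Rightarrow> labelling set set" where
  "orientations X = {orientation_of X L | L. is_labelling X L}"

definition opposite :: "hgraph \<Rightarrow> labelling set \<Rightarrow> labelling set" where
  "opposite X \<omega> = elementary_change X `` \<omega>"

typedef ograph = "{(X, \<omega>). wf_graph X \<and> \<omega> \<in> orientations X}"
proof
  let ?X = "\<lparr>verts = {}, edges = {}\<rparr> :: hgraph"
  have "wf_graph ?X"
    by (simp add: wf_graph_def halves_def partition_on_def)
  moreover have "is_labelling ?X \<lparr>numbering = [], initial = {}\<rparr>"
    by (simp add: is_labelling_def)
  ultimately show "(?X, orientation_of ?X \<lparr>numbering = [], initial = {}\<rparr>)
      \<in> {(X, \<omega>). wf_graph X \<and> \<omega> \<in> orientations X}"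
    by (auto simp: orientations_def)
qed

definition ugraph :: "ograph \<Rightarrow> hgraph" where
  "ugraph A = fst (Rep_ograph A)"

definition orient :: "ograph \<Rightarrow> labelling set" where
  "orient A = snd (Rep_ograph A)"

definition graph_iso :: "(nat \<Rightarrow> nat) \<Rightarrow> hgraph \<Rightarrow> hgraph \<Rightarrow> bool" where
  "graph_iso f X Y \<longleftrightarrow> bij_betw f (halves X) (halves Y) \<and>
     (image f) ` verts X = verts Y \<and> (image f) ` edges X = edges Y"

definition map_labelling :: "(nat \<Rightarrow> nat) \<Rightarrow> labelling \<Rightarrow> labelling" where
  "map_labelling f L = \<lparr>numbering = map (image f) (numbering L), initial = f ` initial L\<rparr>"

definition oriented_iso :: "ograph \<Rightarrow> ograph \<Rightarrow> bool" where
  "oriented_iso A B \<longleftrightarrow>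
     (\<exists>f. graph_iso f (ugraph A) (ugraph B) \<and> map_labelling f ` orient A = orient B)"


section \<open>The graph complex\<close>

text \<open>
  The quotient of the vector space freely spanned by all oriented graphs by the span of the
  differences of isomorphic oriented graphs and of the sums \<open>(X, \<omega>) + (X, -\<omega>)\<close>. (The empty graph
  has only one orientation, so that it contributes no relation of the second kind.)
\<close>

lift_definition free_scale :: "'k::field \<Rightarrow> ('a \<Rightarrow>\<^sub>0 'k) \<Rightarrow> ('a \<Rightarrow>\<^sub>0 'k)"
  is "\<lambda>c p a. c * p a"
  by (rule finite_subset) auto

global_interpretation free_space: vector_space "free_scale :: 'k::field \<Rightarrow> ('a \<Rightarrow>\<^sub>0 'k) \<Rightarrow> _"
  defines free_span = free_space.span
  by unfold_locales
    (auto intro!: poly_mapping_eqI simp: free_scale.rep_eq lookup_add algebra_simps)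

definition graph_relations :: "(ograph \<Rightarrow>\<^sub>0 'k::field) set" where
  "graph_relations =
     {Poly_Mapping.single A 1 - Poly_Mapping.single B 1 | A B. oriented_iso A B} \<union>
     {Poly_Mapping.single A 1 + Poly_Mapping.single B 1 | A B.
        ugraph B = ugraph A \<and> orient B = opposite (ugraph A) (orient A)}"

definition graph_equiv :: "(ograph \<Rightarrow>\<^sub>0 'k::field) \<Rightarrow> (ograph \<Rightarrow>\<^sub>0 'k) \<Rightarrow> bool" where
  "graph_equiv p q \<longleftrightarrow> p - q \<in> free_span graph_relations"

quotient_type (overloaded) 'k graph_complex = "ograph \<Rightarrow>\<^sub>0 ('k::field_char_0)" / graph_equiv
proof (rule equivpI)
  show "reflp (graph_equiv :: (ograph \<Rightarrow>\<^sub>0 'k) \<Rightarrow> _)"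
    by (simp add: reflp_def graph_equiv_def free_space.span_zero)
  show "symp (graph_equiv :: (ograph \<Rightarrow>\<^sub>0 'k) \<Rightarrow> _)"
  proof (rule sympI)
    fix p q :: "ograph \<Rightarrow>\<^sub>0 'k"
    assume "graph_equiv p q"
    then have "- (p - q) \<in> free_span graph_relations"
      unfolding graph_equiv_def by (rule free_space.span_neg)
    then show "graph_equiv q p"
      by (simp add: graph_equiv_def)
  qed
  show "transp (graph_equiv :: (ograph \<Rightarrow>\<^sub>0 'k) \<Rightarrow> _)"
  proof (rule transpI)
    fix p q r :: "ograph \<Rightarrow>\<^sub>0 'k"
    assume "graph_equiv p q" "graph_equiv q r"
    then have "(p - q) + (q - r) \<in> free_span graph_relations"
      unfolding graph_equiv_def by (rule free_space.span_add)
    then show "graph_equiv p r"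
      by (simp add: graph_equiv_def)
  qed
qed

lemma graph_equiv_refl: "graph_equiv p p"
  by (simp add: graph_equiv_def free_space.span_zero)

lemma graph_equiv_add:
  assumes "graph_equiv p p'" "graph_equiv q q'"
  shows "graph_equiv (p + q) (p' + q')"
proof -
  have "(p - p') + (q - q') \<in> free_span graph_relations"
    using assms unfolding graph_equiv_def by (rule free_space.span_add)
  then show ?thesis
    by (simp add: graph_equiv_def add_diff_eq diff_add_eq diff_diff_eq add.commute add.left_commute)
qed

lemma graph_equiv_scale:
  assumes "graph_equiv p p'"
  shows "graph_equiv (free_scale c p) (free_scale c p')"
proof -
  have "free_scale c (p - p') \<in> free_span graph_relations"
    using assms unfolding graph_equiv_def by (rule free_space.span_scale)
  then show ?thesis
    by (simp add: graph_equiv_def free_space.scale_right_diff_distrib)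
qed

lemma graph_equiv_uminus:
  assumes "graph_equiv p p'"
  shows "graph_equiv (- p) (- p')"
  using graph_equiv_scale[OF assms, of "- 1"] by simp

lemma graph_equiv_diff:
  assumes "graph_equiv p p'" "graph_equiv q q'"
  shows "graph_equiv (p - q) (p' - q')"
  using graph_equiv_add[OF assms(1) graph_equiv_uminus[OF assms(2)]] by simp

instantiation graph_complex :: (field_char_0) ab_group_add
begin

lift_definition zero_graph_complex :: "'a graph_complex" is 0 .

lift_definition plus_graph_complex :: "'a graph_complex \<Rightarrow> 'a graph_complex \<Rightarrow> 'a graph_complex"
  is "(+)" by (rule graph_equiv_add)

lift_definition uminus_graph_complex :: "'a graph_complex \<Rightarrow> 'a graph_complex"
  is uminus by (rule graph_equiv_uminus)

lift_definition minus_graph_complex :: "'a graph_complex \<Rightarrow> 'a graph_complex \<Rightarrow> 'a graph_complex"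
  is "(-)" by (rule graph_equiv_diff)

instance
proof
  fix a b c :: "'a graph_complex"
  show "a + b + c = a + (b + c)"
    by transfer (simp add: graph_equiv_refl add.assoc)
  show "a + b = b + a"
    by transfer (simp add: graph_equiv_refl add.commute)
  show "0 + a = a"
    by transfer (simp add: graph_equiv_refl)
  show "- a + a = 0"
    by transfer (simp add: graph_equiv_refl)
  show "a - b = a + - b"
    by transfer (simp add: graph_equiv_refl)
qed

end

lift_definition gc_scale :: "'k::field_char_0 \<Rightarrow> 'k graph_complex \<Rightarrow> 'k graph_complex"
  is free_scale by (rule graph_equiv_scale)

global_interpretation gc: vector_space "gc_scale :: 'k::field_char_0 \<Rightarrow> _"
proof
  fix a b :: 'k and x y :: "'k graph_complex"
  show "gc_scale a (x + y) = gc_scale a x + gc_scale a y"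
    by transfer (simp add: graph_equiv_refl free_space.scale_right_distrib)
  show "gc_scale (a + b) x = gc_scale a x + gc_scale b x"
    by transfer (simp add: graph_equiv_refl free_space.scale_left_distrib)
  show "gc_scale a (gc_scale b x) = gc_scale (a * b) x"
    by transfer (simp add: graph_equiv_refl)
  show "gc_scale 1 x = x"
    by transfer (simp add: graph_equiv_refl)
qed

lift_definition gc_class :: "ograph \<Rightarrow> 'k::field_char_0 graph_complex"
  is "\<lambda>A. Poly_Mapping.single A 1" .


section \<open>Collapsing an edge\<close>

definition collapse_graph :: "nat set \<Rightarrow> hgraph \<Rightarrow> hgraph" where
  "collapse_graph e X =
     \<lparr>verts = insert (\<Union> {v \<in> verts X. v \<inter> e \<noteq> {}} - e) {v \<in> verts X. v \<inter> e = {}},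
      edges = edges X - {e}\<rparr>"

definition runs_from_1_to_2 :: "nat set \<Rightarrow> labelling \<Rightarrow> bool" where
  "runs_from_1_to_2 e L \<longleftrightarrow> length (numbering L) \<ge> 2 \<and>
     (\<exists>h k. e = {h, k} \<and> h \<in> initial L \<and> k \<notin> initial L \<and>
        h \<in> numbering L ! 0 \<and> k \<in> numbering L ! 1)"

definition collapse_labelling :: "nat set \<Rightarrow> labelling \<Rightarrow> labelling" where
  "collapse_labelling e L =
     \<lparr>numbering = (numbering L ! 0 \<union> numbering L ! 1 - e) # drop 2 (numbering L),
      initial = initial L - e\<rparr>"

text \<open>The oriented graph \<open>X\<^sub>e\<close>, for an edge \<open>e\<close> of \<open>X\<close> that is not a loop.\<close>

definition collapse :: "nat set \<Rightarrow> ograph \<Rightarrow> ograph" where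
  "collapse e A =
     (let X = ugraph A; L = (SOME L. L \<in> orient A \<and> runs_from_1_to_2 e L)
      in Abs_ograph (collapse_graph e X,
           orientation_of (collapse_graph e X) (collapse_labelling e L)))"


section \<open>Cutting and regluing two edges\<close>

definition reglue_graph :: "nat \<Rightarrow> nat \<Rightarrow> hgraph \<Rightarrow> hgraph" where
  "reglue_graph h k X = X\<lparr>edges := (edges X - {edge_of X h, edge_of X k}) \<union>
     {{h, k}, {compl_half X h, compl_half X k}}\<rparr>"

text \<open>
  The oriented graph \<open>X\<langle>hk\<rangle>\<close>, which is only used for \<open>v(h) \<noteq> v(k)\<close>. In the chosen labelling \<open>h\<close> and
  the complement of \<open>k\<close> are the initial half-edges of \<open>e(h)\<close> and \<open>e(k)\<close>. They are also the initial
  half-edges of the two new edges with their prescribed directions, so that the labelling is, as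
  it stands, the required labelling of the new graph.
\<close>

definition reglue :: "nat \<Rightarrow> nat \<Rightarrow> ograph \<Rightarrow> ograph" where
  "reglue h k A =
     (let X = ugraph A; L = (SOME L. L \<in> orient A \<and> h \<in> initial L \<and> k \<notin> initial L)
      in Abs_ograph (reglue_graph h k X, orientation_of (reglue_graph h k X) L))"

definition contract_pair :: "nat \<Rightarrow> nat \<Rightarrow> ograph \<Rightarrow> 'k::field_char_0 graph_complex" where
  "contract_pair h k A =
     (if vertex_of (ugraph A) h \<noteq> vertex_of (ugraph A) k
      then gc_class (collapse {h, k} (reglue h k A)) else 0)"


section \<open>The two operators\<close>

text \<open>
  Both operators are the linear maps with the given values on oriented graphs. Loops contribute
  nothing to the edge operator; a graph with a loop is zero in the graph complex anyway. The
  half-edge operator sums over unordered pairs, each of which is listed with its smaller name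
  first; this choice is immaterial because \<open>X\<^bsub>hk\<^esub> = X\<^bsub>kh\<^esub>\<close>.
\<close>

definition boundary_E :: "'k::field_char_0 graph_complex \<Rightarrow> 'k graph_complex" where
  "boundary_E = (THE D. Vector_Spaces.linear gc_scale gc_scale D \<and>
     (\<forall>A. D (gc_class A) =
        (\<Sum>e | e \<in> edges (ugraph A) \<and> \<not> is_loop (ugraph A) e. gc_class (collapse e A))))"

definition boundary_H :: "'k::field_char_0 graph_complex \<Rightarrow> 'k graph_complex" where
  "boundary_H = (THE D. Vector_Spaces.linear gc_scale gc_scale D \<and>
     (\<forall>A. D (gc_class A) =
        (\<Sum>(h, k) | h \<in> halves (ugraph A) \<and> k \<in> halves (ugraph A) \<and> h < k \<and>
                   k \<noteq> compl_half (ugraph A) h. contract_pair h k A)))"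

end

(* A labelling gets an absolute sign: the inversion sign of its vertex numbering times one sign for
   each arrow. Elementary changes flip this sign and connect all labellings, so an orientation is a
   sign, and the oriented graphs X_e and X<hk> can be computed from any labelling adapted to e or to
   h and k. Adapting one labelling to two edges e and f at once gives (X_e)_f = -(X_f)_e; collapses
   commute with regluings, and regluings commute with each other. Hence all terms of the three
   squares cancel in pairs. In E H + H E the terms (X_hk)_f with f the new edge formed by the
   complements of h and k cancel among themselves, under exchange of h, k with their complements.
   The sum defining boundary_H is doubled to run over ordered pairs, which makes the cancelling
   involutions plain swaps; characteristic zero allows halving the result. *)
theory Submission
  imports Defs "HOL-Library.Nat_Bijection" "HOL-Library.Multiset"
begin

section \<open>Signs of labellings\<close>

text \<open>Counting changes modulo two does not by itself show that the two orientations of a graph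
  differ, nor that the labellings picked by \<open>SOME\<close> are immaterial. Half-edges are
  numbers, so every labelling gets a sign computed from their names. This sign is not natural:
  isomorphisms, collapses and regluings may all change it. What matters is a transition factor, the
  product of the sign of a labelling and the sign of the labelling induced from it; this factor is
  the same for all adapted labellings.

  The minus sign for two collapses comes from the numbering. A collapse merges the vertices 1 and 2
  into vertex 1, and comparing the two orders leaves exactly one exchange of numbers that is not
  compensated.

  Besides the signs, the index sets have to match. The second sum ranges over a graph that depends
  on the first step, since collapsing an edge turns the edges parallel to it into loops. The pairing
  works because admissibility of two successive steps is symmetric in them. Isomorphisms do not
  respect \<open>h < k\<close>, which is a second reason for passing to ordered pairs.\<close>

definition pair_sign :: "'a::linorder \<Rightarrow> 'a \<Rightarrow> int" where
  "pair_sign x y = (if x < y then 1 else - 1)"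

text \<open>For a list without repetitions this is (-1) to the number of inversions. Recursion on
  the head suits the collapse, which merges the first two entries of a numbering and keeps the
  rest.\<close>

fun list_sign :: "'a::linorder list \<Rightarrow> int" where
  "list_sign [] = 1"
| "list_sign (x # xs) = (\<Prod>y\<leftarrow>xs. pair_sign x y) * list_sign xs"

lemma pair_sign_swap: "x \<noteq> y \<Longrightarrow> pair_sign x y = - pair_sign y x"
  by (auto simp: pair_sign_def)

lemma list_sign_swap: "x \<noteq> y \<Longrightarrow> list_sign (x # y # xs) = - list_sign (y # x # xs)"
  using pair_sign_swap[of x y] by simp

text \<open>An entry of the common prefix contributes a product over the entries behind it, and this
  product depends only on their multiset.\<close>

lemma list_sign_append_minus:
  assumes "mset xs = mset ys" "list_sign xs = - list_sign ys"
  shows "list_sign (as @ xs) = - list_sign (as @ ys)"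
proof (induction as)
  case (Cons a as)
  have "mset (map (pair_sign a) xs) = mset (map (pair_sign a) ys)"
    using assms(1) by simp
  then have "prod_list (map (pair_sign a) xs) = prod_list (map (pair_sign a) ys)"
    by (metis prod_mset_prod_list)
  then show ?case using Cons by simp
qed (use assms in simp)

text \<open>The entry \<open>y\<close> passes the entries of \<open>bs\<close> one by one, with one
  sign change each.\<close>

lemma list_sign_move:
  "y \<notin> set bs \<Longrightarrow> list_sign (bs @ y # cs) = (- 1) ^ length bs * list_sign (y # bs @ cs)"
proof (induction bs)
  case (Cons b bs)
  have "list_sign (b # bs @ y # cs) = (- 1) ^ length bs * list_sign (b # y # bs @ cs)"
    using Cons by simp
  also have "\<dots> = (- 1) ^ length (b # bs) * list_sign (y # b # bs @ cs)"
    using list_sign_swap[of b y "bs @ cs"] Cons.prems by (auto simp del: list_sign.simps)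
  finally show ?case by simp
qed simp

text \<open>Pulling the rear entry forward across \<open>bs\<close> costs the same power of -1 on
  both sides; one adjacent exchange remains.\<close>

lemma list_sign_swap_distant:
  assumes "distinct (x # bs @ y # cs)"
  shows "list_sign (x # bs @ y # cs) = - list_sign (y # bs @ x # cs)"
proof -
  have "list_sign (x # bs @ y # cs) = (- 1) ^ length bs * list_sign (x # y # bs @ cs)"
    using list_sign_move[of y bs cs] assms by (simp add: mult_ac)
  also have "\<dots> = - ((- 1) ^ length bs * list_sign (y # x # bs @ cs))"
    using list_sign_swap[of x y "bs @ cs"] assms by (simp del: list_sign.simps)
  also have "\<dots> = - list_sign (y # bs @ x # cs)"
    using list_sign_move[of x bs cs] assms by (simp add: mult_ac)
  finally show ?thesis .
qed

text \<open>Turns the double \<open>list_update\<close> of \<open>swap_numbers\<close> into an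
  exchange of two entries in a decomposed list, the form in which the sign lemmas apply. It also
  drives the sorting in \<open>elementary_changes_numbering\<close>.\<close>

lemma list_split2:
  assumes "i < j" "j < length xs"
  obtains as bs cs where "xs = as @ xs ! i # bs @ xs ! j # cs" "length as = i"
    "xs[i := xs ! j, j := xs ! i] = as @ xs ! j # bs @ xs ! i # cs"
proof -
  let ?as = "take i xs" and ?r = "drop (Suc i) xs"
  let ?bs = "take (j - Suc i) ?r" and ?cs = "drop (Suc j) xs"
  have 1: "xs = ?as @ xs ! i # ?r"
    using assms by (simp add: id_take_nth_drop)
  have "?r = ?bs @ ?r ! (j - Suc i) # drop (Suc (j - Suc i)) ?r"
    using assms by (intro id_take_nth_drop) simp
  then have 2: "?r = ?bs @ xs ! j # ?cs"
    using assms by simp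
  have 3: "xs = ?as @ xs ! i # ?bs @ xs ! j # ?cs"
    using 1 2 by simp
  have l: "length ?as = i" "length ?bs = j - Suc i"
    using assms by auto
  have upd: "(as @ p # bs @ q # cs)[length as := q', length as + Suc (length bs) := p'] = as @ q' # bs @ p' # cs"
    for as bs cs :: "'a list" and p q p' q'
    by (simp add: list_update_append)
  have "(?as @ xs ! i # ?bs @ xs ! j # ?cs)[i := xs ! j, j := xs ! i] = ?as @ xs ! j # ?bs @ xs ! i # ?cs"
    using upd[of ?as "xs ! i" ?bs "xs ! j" ?cs "xs ! j" "xs ! i"] l assms by simp
  then show ?thesis
    using that[of ?as ?bs ?cs] 3 l by simp
qed

lemma list_sign_swap_nth:
  assumes "distinct xs" "i < j" "j < length xs"
  shows "list_sign (xs[i := xs ! j, j := xs ! i]) = - list_sign xs"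
proof -
  obtain as bs cs where *: "xs = as @ xs ! i # bs @ xs ! j # cs"
    "xs[i := xs ! j, j := xs ! i] = as @ xs ! j # bs @ xs ! i # cs"
    using list_split2[OF assms(2,3)] by metis
  have "distinct (xs ! j # bs @ xs ! i # cs)"
    using assms(1) by (subst (asm) *(1)) auto
  then have "list_sign (as @ xs ! j # bs @ xs ! i # cs) = - list_sign (as @ xs ! i # bs @ xs ! j # cs)"
    by (intro list_sign_append_minus list_sign_swap_distant) auto
  then show ?thesis using * by simp
qed

lemma prod_list_pm1: "set xs \<subseteq> {1, - 1 :: int} \<Longrightarrow> prod_list xs \<in> {1, - 1}"
  by (induction xs) auto

lemma list_sign_pm1: "list_sign xs \<in> {1, - 1}"
proof (induction xs)
  case (Cons x xs)
  have "(\<Prod>y\<leftarrow>xs. pair_sign x y) \<in> {1, - 1}"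
    by (intro prod_list_pm1) (auto simp: pair_sign_def)
  then show ?case using Cons by auto
qed simp

text \<open>\<^const>\<open>set_encode\<close> only provides a linear order on the vertices.\<close>

definition label_sign :: "hgraph \<Rightarrow> labelling \<Rightarrow> int" where
  "label_sign X L = list_sign (map set_encode (numbering L)) *
     (\<Prod>e\<in>edges X. if Min e \<in> initial L then 1 else - 1)"

lemma label_sign_pm1: "label_sign X L \<in> {1, - 1}"
proof -
  have "(\<Prod>e\<in>F. if Min e \<in> I then 1 else - 1 :: int) \<in> {1, - 1}" for F :: "nat set set" and I
    by (induction F rule: infinite_finite_induct) auto
  moreover have sign_mult: "m * n \<in> {1, - 1 :: int}" if "m \<in> {1, - 1}" "n \<in> {1, - 1}" for m n
    using that by auto
  ultimately show ?thesis
    unfolding label_sign_def using list_sign_pm1 by blast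
qed

lemma label_sign_square [simp]: "label_sign X L * label_sign X L = 1"
  using label_sign_pm1[of X L] by auto

text \<open>Products of signs along two operations are normalised with \<open>mult.assoc\<close>;
  this form cancels an intermediate sign inside the nested product.\<close>

lemma label_sign_square_left [simp]: "label_sign X L * (label_sign X L * n) = n"
  by (simp flip: mult.assoc)

section \<open>Elementary facts about half-edges, edges and vertices\<close>

lemma wf_finite_halves: "wf_graph X \<Longrightarrow> finite (halves X)"
  by (simp add: wf_graph_def)

lemma wf_finite_edges: "wf_graph X \<Longrightarrow> finite (edges X)"
  unfolding wf_graph_def using finite_elements by blast

lemma wf_finite_verts: "wf_graph X \<Longrightarrow> finite (verts X)"
  unfolding wf_graph_def using finite_elements by blast

lemma wf_edge_subset: "wf_graph X \<Longrightarrow> e \<in> edges X \<Longrightarrow> e \<subseteq> halves X"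
  by (auto simp: halves_def)

lemma wf_Union_verts: "wf_graph X \<Longrightarrow> \<Union> (verts X) = halves X"
  by (simp add: wf_graph_def partition_on_def)

lemma wf_vert_subset: "wf_graph X \<Longrightarrow> v \<in> verts X \<Longrightarrow> v \<subseteq> halves X"
  using wf_Union_verts by blast

lemma wf_finite_edge: "wf_graph X \<Longrightarrow> e \<in> edges X \<Longrightarrow> finite e"
  by (rule finite_subset[OF wf_edge_subset wf_finite_halves])

lemma wf_finite_vert: "wf_graph X \<Longrightarrow> v \<in> verts X \<Longrightarrow> finite v"
  by (rule finite_subset[OF wf_vert_subset wf_finite_halves])

lemma wf_edges_eq: "wf_graph X \<Longrightarrow> e \<in> edges X \<Longrightarrow> f \<in> edges X \<Longrightarrow> h \<in> e \<Longrightarrow> h \<in> f \<Longrightarrow> e = f"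
  unfolding wf_graph_def partition_on_def by (meson disjoint_iff disjointD)

lemma wf_verts_eq: "wf_graph X \<Longrightarrow> v \<in> verts X \<Longrightarrow> w \<in> verts X \<Longrightarrow> h \<in> v \<Longrightarrow> h \<in> w \<Longrightarrow> v = w"
  unfolding wf_graph_def partition_on_def by (meson disjoint_iff disjointD)

lemma edge_of_eq: "wf_graph X \<Longrightarrow> e \<in> edges X \<Longrightarrow> h \<in> e \<Longrightarrow> edge_of X h = e"
  unfolding edge_of_def by (rule the_equality) (auto dest: wf_edges_eq)

lemma vertex_of_eq: "wf_graph X \<Longrightarrow> v \<in> verts X \<Longrightarrow> h \<in> v \<Longrightarrow> vertex_of X h = v"
  unfolding vertex_of_def by (rule the_equality) (auto dest: wf_verts_eq)

lemma edge_of_in: assumes "wf_graph X" "h \<in> halves X"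
  shows "edge_of X h \<in> edges X" "h \<in> edge_of X h"
  using assms edge_of_eq[OF assms(1)] unfolding halves_def by blast+

lemma vertex_of_in: assumes "wf_graph X" "h \<in> halves X"
  shows "vertex_of X h \<in> verts X" "h \<in> vertex_of X h"
  using assms vertex_of_eq[OF assms(1)] wf_Union_verts[OF assms(1)] by blast+

lemma compl_half_eq:
  assumes "wf_graph X" "{h, k} \<in> edges X"
  shows "compl_half X h = k" "h \<noteq> k"
proof -
  have "card {h, k} = 2" using assms by (simp add: wf_graph_def)
  then show "h \<noteq> k" by auto
  have "edge_of X h = {h, k}" using edge_of_eq[OF assms] by simp
  then show "compl_half X h = k"
    unfolding compl_half_def using \<open>h \<noteq> k\<close> by auto
qed

lemma edge_of_compl:
  assumes "wf_graph X" "h \<in> halves X"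
  shows "edge_of X h = {h, compl_half X h}"
proof -
  have "card (edge_of X h) = 2" using edge_of_in[OF assms] assms by (simp add: wf_graph_def)
  then obtain k where "edge_of X h = {h, k}"
    using edge_of_in(2)[OF assms] by (metis card_2_iff insert_commute insertE singletonD)
  then show ?thesis using compl_half_eq[OF assms(1), of h k] edge_of_in[OF assms] by simp
qed

lemma compl_half_props:
  assumes "wf_graph X" "h \<in> halves X"
  shows "{h, compl_half X h} \<in> edges X" "compl_half X h \<in> halves X" "compl_half X h \<noteq> h"
    "compl_half X (compl_half X h) = h"
proof -
  show 1: "{h, compl_half X h} \<in> edges X"
    using edge_of_in[OF assms] edge_of_compl[OF assms] by simp
  then show "compl_half X h \<in> halves X" by (auto simp: halves_def)
  show "compl_half X h \<noteq> h" using compl_half_eq(2)[OF assms(1) 1] by simp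
  show "compl_half X (compl_half X h) = h"
    using compl_half_eq(1)[OF assms(1), of "compl_half X h" h] 1 by (simp add: insert_commute)
qed

lemma edge_cases:
  assumes "wf_graph X" "e \<in> edges X"
  obtains h where "h \<in> halves X" "e = {h, compl_half X h}"
proof -
  have "card e = 2" using assms by (simp add: wf_graph_def)
  then obtain h k where "e = {h, k}" by (auto simp: card_2_iff)
  with assms have "h \<in> halves X" "compl_half X h = k"
    using compl_half_eq by (auto simp: halves_def)
  with that \<open>e = {h, k}\<close> show ?thesis by auto
qed

lemma edges_compl: "wf_graph X \<Longrightarrow> edges X = (\<lambda>h. {h, compl_half X h}) ` halves X"
  using compl_half_props(1) by (fastforce elim: edge_cases)

section \<open>Labellings and the effect of an elementary change on the sign\<close>

lemma is_labelling_iff: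
  assumes "wf_graph X"
  shows "is_labelling X L \<longleftrightarrow> distinct (numbering L) \<and> set (numbering L) = verts X \<and>
     initial L \<subseteq> halves X \<and> (\<forall>h\<in>halves X. compl_half X h \<in> initial L \<longleftrightarrow> h \<notin> initial L)"
proof -
  have "card (I \<inter> {h, compl_half X h}) = 1 \<longleftrightarrow> (compl_half X h \<in> I \<longleftrightarrow> h \<notin> I)"
    if "h \<in> halves X" for h I
    using compl_half_props(3)[OF assms that] by (auto simp: card_Suc_eq Int_insert_right)
  then show ?thesis
    unfolding is_labelling_def edges_compl[OF assms] by auto
qed

lemma is_labelling_reverse_arrow:
  assumes "wf_graph X" "is_labelling X L" "e \<in> edges X"
  shows "is_labelling X (reverse_arrow e L)"
proof -
  obtain a where a: "a \<in> halves X" "e = {a, compl_half X a}"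
    using edge_cases[OF assms(1,3)] .
  note c = compl_half_props[OF assms(1)]
  have "compl_half X h \<in> e \<longleftrightarrow> h \<in> e" if "h \<in> halves X" for h
    using a c that by (metis insertE insertI1 insertI2 singletonD)
  then show ?thesis
    using assms(2) wf_edge_subset[OF assms(1,3)] c(2)
    unfolding is_labelling_iff[OF assms(1)] reverse_arrow_def by auto
qed

lemma is_labelling_swap_numbers:
  assumes "is_labelling X L" "i < j" "j < length (numbering L)"
  shows "is_labelling X (swap_numbers i j L)"
  using assms unfolding is_labelling_def swap_numbers_def
  by (auto simp: distinct_swap set_swap)

text \<open>Exactly one factor changes: the reference half-edge \<open>Min e\<close> enters or
  leaves the set of initial half-edges, and all other edges are disjoint from
  \<open>e\<close>.\<close>

lemma label_sign_reverse_arrow: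
  assumes "wf_graph X" "is_labelling X L" "e \<in> edges X"
  shows "label_sign X (reverse_arrow e L) = - label_sign X L"
proof -
  let ?I = "initial L" and ?J = "initial (reverse_arrow e L)"
  have mem: "Min f \<in> f" if "f \<in> edges X" for f
    using that assms(1) wf_finite_edge[OF assms(1) that] by (intro Min_in) (auto simp: wf_graph_def)
  have J: "?J = (?I - e) \<union> (e - ?I)" by (simp add: reverse_arrow_def)
  have e: "(Min e \<in> ?J) = (Min e \<notin> ?I)"
    using mem[OF assms(3)] by (auto simp: J)
  have f: "(Min f \<in> ?J) = (Min f \<in> ?I)" if "f \<in> edges X - {e}" for f
    using mem[of f] that wf_edges_eq[OF assms(1) assms(3), of f] by (auto simp: J)
  have split: "(\<Prod>f\<in>edges X. if Min f \<in> K then 1 else - 1 :: int) =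
     (if Min e \<in> K then 1 else - 1) * (\<Prod>f\<in>edges X - {e}. if Min f \<in> K then 1 else - 1)" for K
    by (rule prod.remove) (use assms wf_finite_edges in auto)
  have "(\<Prod>f\<in>edges X - {e}. if Min f \<in> ?J then 1 else - 1 :: int) =
    (\<Prod>f\<in>edges X - {e}. if Min f \<in> ?I then 1 else - 1)"
    by (rule prod.cong) (use f in auto)
  then have "(\<Prod>f\<in>edges X. if Min f \<in> ?J then 1 else - 1 :: int) =
    - (\<Prod>f\<in>edges X. if Min f \<in> ?I then 1 else - 1)"
    unfolding split[of ?I] split[of ?J] e by auto
  then show ?thesis by (simp add: label_sign_def reverse_arrow_def)
qed

lemma inj_on_set_encode_verts: "wf_graph X \<Longrightarrow> inj_on set_encode (verts X)"
  by (rule inj_on_subset[OF inj_on_set_encode]) (auto dest: wf_finite_vert)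

lemma label_sign_swap_numbers:
  assumes "wf_graph X" "is_labelling X L" "i < j" "j < length (numbering L)"
  shows "label_sign X (swap_numbers i j L) = - label_sign X L"
proof -
  have "distinct (map set_encode (numbering L))"
    using assms(2) inj_on_set_encode_verts[OF assms(1)] by (simp add: distinct_map is_labelling_def)
  from list_sign_swap_nth[OF this assms(3)] assms(3,4) show ?thesis
    by (simp add: label_sign_def swap_numbers_def map_update)
qed

lemma elementary_change_labelling:
  "wf_graph X \<Longrightarrow> (L, L') \<in> elementary_change X \<Longrightarrow> is_labelling X L \<and> is_labelling X L'"
  by (auto simp: elementary_change_def is_labelling_reverse_arrow is_labelling_swap_numbers)

lemma elementary_change_sign:
  "wf_graph X \<Longrightarrow> (L, L') \<in> elementary_change X \<Longrightarrow> label_sign X L' = - label_sign X L"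
  by (auto simp: elementary_change_def label_sign_reverse_arrow label_sign_swap_numbers)

section \<open>Connectedness of the labellings of a graph\<close>

lemma elementary_change_rtrancl_labelling:
  "(L, L') \<in> (elementary_change X)\<^sup>* \<Longrightarrow> wf_graph X \<Longrightarrow> is_labelling X L \<Longrightarrow> is_labelling X L'"
  by (induction rule: rtrancl_induct) (auto dest: elementary_change_labelling)

text \<open>Reversals of different edges act on disjoint sets, so performing them one after the
  other toggles the union.\<close>

lemma elementary_changes_arrows:
  assumes "wf_graph X" "is_labelling X L" "F \<subseteq> edges X"
  shows "(L, L\<lparr>initial := (initial L - \<Union> F) \<union> (\<Union> F - initial L)\<rparr>) \<in> (elementary_change X)\<^sup>*"
proof -
  have "finite F" using assms wf_finite_edges finite_subset by blast
  then show ?thesis using assms(3)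
  proof (induction F)
    case (insert e F)
    let ?L = "L\<lparr>initial := (initial L - \<Union> F) \<union> (\<Union> F - initial L)\<rparr>"
    have d: "e \<inter> \<Union> F = {}"
      using insert.prems insert.hyps wf_edges_eq[OF assms(1)] by blast
    have 1: "(L, ?L) \<in> (elementary_change X)\<^sup>*" using insert by auto
    have "L\<lparr>initial := (initial L - \<Union> (insert e F)) \<union> (\<Union> (insert e F) - initial L)\<rparr> = reverse_arrow e ?L"
    proof -
      have "sym_diff (initial L) (e \<union> \<Union> F) = sym_diff (sym_diff (initial L) (\<Union> F)) e"
        using d by blast
      then show ?thesis by (simp add: reverse_arrow_def)
    qed
    moreover have "is_labelling X ?L"
      using elementary_change_rtrancl_labelling[OF 1] assms by blast
    ultimately have "(?L, L\<lparr>initial := (initial L - \<Union> (insert e F)) \<union> (\<Union> (insert e F) - initial L)\<rparr>)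
        \<in> elementary_change X"
      using insert.prems unfolding elementary_change_def by auto
    with 1 show ?case by (rule rtrancl_into_rtrancl)
  qed simp
qed

text \<open>Selection sort: \<open>ps\<close> is the part already in place, and one exchange brings
  the next entry \<open>b\<close> behind it. The prefix is carried along because
  \<open>swap_numbers\<close> uses absolute positions.\<close>

lemma elementary_changes_numbering:
  assumes "wf_graph X" "is_labelling X L" "numbering L = ps @ as" "distinct (ps @ bs)" "set bs = set as"
  shows "(L, L\<lparr>numbering := ps @ bs\<rparr>) \<in> (elementary_change X)\<^sup>*"
  using assms(2-)
proof (induction bs arbitrary: ps as L)
  case Nil
  then have "L\<lparr>numbering := ps @ []\<rparr> = L" by simp
  then show ?case by simp
next
  case (Cons b bs)
  have dL: "distinct (ps @ as)" using Cons.prems by (metis is_labelling_def)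
  obtain j where j: "j < length as" "as ! j = b"
    using Cons.prems(4) by (metis in_set_conv_nth list.set_intros(1))
  let ?n = "length ps"
  obtain L' where L': "(L, L') \<in> (elementary_change X)\<^sup>*" and n': "\<exists>as'. numbering L' = ps @ b # as'"
    and i': "initial L' = initial L"
  proof (cases "j = 0")
    case True
    then have "as = b # tl as" using j by (cases as) auto
    then show ?thesis using that[of L] Cons.prems(2) by auto
  next
    case False
    let ?L' = "swap_numbers ?n (?n + j) L"
    have s: "?n < ?n + j" "?n + j < length (numbering L)" using j False Cons.prems(2) by auto
    then have 1: "(L, ?L') \<in> elementary_change X"
      using Cons.prems(1) unfolding elementary_change_def by blast
    have nL: "numbering ?L' = (numbering L)[?n := numbering L ! (?n + j), ?n + j := numbering L ! ?n]"
      by (simp add: swap_numbers_def)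
    obtain as' bs' cs' where
      *: "numbering L = as' @ numbering L ! ?n # bs' @ numbering L ! (?n + j) # cs'" "length as' = ?n"
      "numbering ?L' = as' @ numbering L ! (?n + j) # bs' @ numbering L ! ?n # cs'"
      unfolding nL by (rule list_split2[OF s])
    have "as' = ps" using *(1,2) Cons.prems(2) by (metis append_eq_append_conv)
    moreover have "numbering L ! (?n + j) = b" using Cons.prems(2) j by (simp add: nth_append)
    ultimately have "\<exists>as'. numbering ?L' = ps @ b # as'" using *(3) by auto
    then show ?thesis using that[of ?L'] 1 by (auto simp: swap_numbers_def)
  qed
  obtain as' where as': "numbering L' = ps @ b # as'" using n' by blast
  have lab': "is_labelling X L'" using elementary_change_rtrancl_labelling[OF L'] Cons.prems assms(1) by blast
  have "distinct (ps @ b # as')" "set (ps @ b # as') = set (ps @ as)"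
    using lab' Cons.prems(1,2) as' by (metis is_labelling_def)+
  then have "set bs = set as'"
    using Cons.prems(3,4) dL by auto
  then have "(L', L'\<lparr>numbering := (ps @ [b]) @ bs\<rparr>) \<in> (elementary_change X)\<^sup>*"
    using Cons.prems(3) as' by (intro Cons.IH[OF lab', of "ps @ [b]" as']) auto
  moreover have "L'\<lparr>numbering := (ps @ [b]) @ bs\<rparr> = L\<lparr>numbering := ps @ b # bs\<rparr>"
    using i' by simp
  ultimately show ?case using L' by (metis rtrancl_trans)
qed

lemma labellings_connected:
  assumes "wf_graph X" "is_labelling X L" "is_labelling X L'"
  shows "(L, L') \<in> (elementary_change X)\<^sup>*"
proof -
  let ?M = "L\<lparr>numbering := numbering L'\<rparr>"
  have 1: "(L, ?M) \<in> (elementary_change X)\<^sup>*"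
    using elementary_changes_numbering[OF assms(1,2), of "[]" "numbering L" "numbering L'"] assms
    by (simp add: is_labelling_def)
  then have M: "is_labelling X ?M"
    using elementary_change_rtrancl_labelling assms by blast
  \<comment> \<open>The edges whose arrows disagree. Exactly one half of an edge is initial, so
    toggling such an edge makes its arrows agree.\<close>
  let ?F = "{e \<in> edges X. initial L \<inter> e \<noteq> initial L' \<inter> e}"
  let ?N = "?M\<lparr>initial := (initial ?M - \<Union> ?F) \<union> (\<Union> ?F - initial ?M)\<rparr>"
  have 2: "(?M, ?N) \<in> (elementary_change X)\<^sup>*"
    by (rule elementary_changes_arrows[OF assms(1) M]) auto
  have "h \<in> initial ?N \<longleftrightarrow> h \<in> initial L'" for h
  proof (cases "h \<in> halves X")
    case True
    let ?h = "compl_half X h"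
    have A: "(?h \<in> initial L) = (h \<notin> initial L)" "(?h \<in> initial L') = (h \<notin> initial L')"
      using True assms by (auto simp: is_labelling_iff)
    have "h \<in> \<Union> ?F \<longleftrightarrow> {h, ?h} \<in> ?F"
      using wf_edges_eq[OF assms(1)] compl_half_props[OF assms(1) True] by auto
    also have "\<dots> \<longleftrightarrow> (h \<in> initial L) \<noteq> (h \<in> initial L')"
      using A compl_half_props[OF assms(1) True] by auto
    finally show ?thesis by auto
  next
    case False
    then show ?thesis using assms by (auto simp: is_labelling_iff halves_def)
  qed
  then have "?N = L'" by (simp add: set_eq_iff)
  with 1 2 show ?thesis by (metis rtrancl_trans)
qed

section \<open>Orientations as classes of labellings of equal sign\<close>

lemma rtrancl_relcomp_self:
  "(x, y) \<in> R\<^sup>* \<Longrightarrow> (x, y) \<in> (R O R)\<^sup>* \<or> (\<exists>z. (x, z) \<in> (R O R)\<^sup>* \<and> (z, y) \<in> R)"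
proof (induction rule: rtrancl_induct)
  case (step y z)
  then show ?case by (meson relcompI rtrancl.rtrancl_into_rtrancl)
qed simp

lemma even_changes_sign:
  "(L, L') \<in> (elementary_change X O elementary_change X)\<^sup>* \<Longrightarrow> wf_graph X \<Longrightarrow> is_labelling X L \<Longrightarrow>
   is_labelling X L' \<and> label_sign X L' = label_sign X L"
proof (induction rule: rtrancl_induct)
  case (step y z)
  then show ?case
    by (metis add.inverse_inverse elementary_change_labelling elementary_change_sign relcompE prod.inject)
qed simp

text \<open>Some path of changes joins any two labellings, and the parity of its length is read off
  from the signs: equal signs force an even length.\<close>

lemma orientation_of_eq:
  assumes "wf_graph X" "is_labelling X L"
  shows "orientation_of X L = {L'. is_labelling X L' \<and> label_sign X L' = label_sign X L}"
proof (intro equalityI subsetI)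
  fix L' assume "L' \<in> orientation_of X L"
  then show "L' \<in> {L'. is_labelling X L' \<and> label_sign X L' = label_sign X L}"
    using even_changes_sign assms by (auto simp: orientation_of_def)
next
  fix L' assume L': "L' \<in> {L'. is_labelling X L' \<and> label_sign X L' = label_sign X L}"
  have False if "(L, M) \<in> (elementary_change X O elementary_change X)\<^sup>*" "(M, L') \<in> elementary_change X" for M
  proof -
    have "label_sign X M = label_sign X L" using even_changes_sign[OF that(1)] assms by blast
    then have "label_sign X L' = - label_sign X L"
      using elementary_change_sign[OF assms(1) that(2)] by simp
    then show False using L' label_sign_pm1[of X L] by auto
  qed
  then show "L' \<in> orientation_of X L"
    using rtrancl_relcomp_self[OF labellings_connected[OF assms, of L']] L'
    by (auto simp: orientation_of_def)
qed

lemma opposite_eq: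
  assumes "wf_graph X" "is_labelling X L"
  shows "opposite X (orientation_of X L) = {L'. is_labelling X L' \<and> label_sign X L' = - label_sign X L}"
proof (intro equalityI subsetI)
  fix L' assume "L' \<in> opposite X (orientation_of X L)"
  then show "L' \<in> {L'. is_labelling X L' \<and> label_sign X L' = - label_sign X L}"
    using elementary_change_sign[OF assms(1)] elementary_change_labelling[OF assms(1)]
    unfolding opposite_def orientation_of_eq[OF assms] by fastforce
next
  fix L' assume L': "L' \<in> {L'. is_labelling X L' \<and> label_sign X L' = - label_sign X L}"
  \<comment> \<open>A connecting path is therefore nonempty; the source of its last change has the
    sign of \<open>L\<close>.\<close>
  have "L' \<noteq> L" using L' label_sign_pm1[of X L] by auto
  then obtain M where M: "(M, L') \<in> elementary_change X"
    using labellings_connected[OF assms, of L'] L' by (auto elim: rtranclE)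
  then have "M \<in> orientation_of X L"
    using elementary_change_sign[OF assms(1) M] elementary_change_labelling[OF assms(1) M] L'
    unfolding orientation_of_eq[OF assms] by auto
  with M show "L' \<in> opposite X (orientation_of X L)" by (auto simp: opposite_def)
qed

section \<open>Oriented graphs as graphs with a sign\<close>

lemma wf_ugraph: "wf_graph (ugraph A)"
  using Rep_ograph[of A] by (auto simp: ugraph_def)

text \<open>The choice is immaterial by \<open>orient_iff\<close>. The value depends on the names of
  the half-edges, so it compares orientations of one graph, not of isomorphic graphs.\<close>

definition orient_sign :: "ograph \<Rightarrow> int" where
  "orient_sign A = label_sign (ugraph A) (SOME L. L \<in> orient A)"

lemma orient_iff: "L \<in> orient A \<longleftrightarrow> is_labelling (ugraph A) L \<and> label_sign (ugraph A) L = orient_sign A"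
proof -
  have "orient A \<in> orientations (ugraph A)"
    using Rep_ograph[of A] by (auto simp: ugraph_def orient_def)
  then obtain L0 where L0: "is_labelling (ugraph A) L0" "orient A = orientation_of (ugraph A) L0"
    by (auto simp: orientations_def)
  note eq = orientation_of_eq[OF wf_ugraph L0(1)]
  have "L0 \<in> orient A" using L0 eq by simp
  then have "(SOME L. L \<in> orient A) \<in> orient A" by (rule someI)
  then have "orient_sign A = label_sign (ugraph A) L0"
    using L0(2) eq by (auto simp: orient_sign_def)
  then show ?thesis using L0(2) eq by auto
qed

lemma orient_nonempty: "\<exists>L. L \<in> orient A"
proof -
  have "orient A \<in> orientations (ugraph A)"
    using Rep_ograph[of A] by (auto simp: ugraph_def orient_def)
  then show ?thesis
    using orientation_of_eq[OF wf_ugraph] by (auto simp: orientations_def)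
qed

lemma orient_sign_pm1: "orient_sign A \<in> {1, - 1}"
  by (simp only: orient_sign_def label_sign_pm1)

lemma ograph_eqI:
  assumes "ugraph A = ugraph B" "orient_sign A = orient_sign B"
  shows "A = B"
proof -
  have "orient A = orient B" using assms orient_iff by auto
  then have "Rep_ograph A = Rep_ograph B"
    using assms(1) by (simp add: ugraph_def orient_def prod_eq_iff)
  then show ?thesis by (simp add: Rep_ograph_inject)
qed

lemma Abs_ograph_orientation:
  assumes "wf_graph X" "is_labelling X L"
  shows "ugraph (Abs_ograph (X, orientation_of X L)) = X"
    "orient_sign (Abs_ograph (X, orientation_of X L)) = label_sign X L"
proof -
  let ?A = "Abs_ograph (X, orientation_of X L)"
  have R: "Rep_ograph ?A = (X, orientation_of X L)"
    by (rule Abs_ograph_inverse) (use assms in \<open>auto simp: orientations_def\<close>)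
  then show u: "ugraph ?A = X" by (simp add: ugraph_def)
  have "L \<in> orient ?A" using R orientation_of_eq[OF assms] assms by (simp add: orient_def)
  then show "orient_sign ?A = label_sign X L" using u orient_iff[of L ?A] by simp
qed

text \<open>Supplies labellings adapted to several edges at once: \<open>P\<close> holds the
  half-edges that have to be initial, at most one in each edge, and \<open>vs\<close> the vertices
  that get the first numbers.\<close>

lemma labelling_exists:
  assumes "wf_graph X" "P \<subseteq> halves X" "\<And>a. a \<in> P \<Longrightarrow> compl_half X a \<notin> P"
    and "distinct vs" "set vs \<subseteq> verts X"
  obtains L xs where "is_labelling X L" "P \<subseteq> initial L" "numbering L = vs @ xs"
proof -
  obtain xs where xs: "distinct xs" "set xs = verts X - set vs"
    using finite_distinct_list[of "verts X - set vs"] wf_finite_verts[OF assms(1)] by auto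
  \<comment> \<open>Edges that miss \<open>P\<close> get their smaller half-edge as the initial
    one.\<close>
  let ?I = "{a \<in> halves X. a \<in> P \<or> (compl_half X a \<notin> P \<and> a < compl_half X a)}"
  note c = compl_half_props[OF assms(1)]
  have "(compl_half X h \<in> ?I) = (h \<notin> ?I)" if "h \<in> halves X" for h
    using c[OF that] that assms(3)[of h] assms(3)[of "compl_half X h"] by auto
  then have "is_labelling X \<lparr>numbering = vs @ xs, initial = ?I\<rparr>"
    using xs assms by (auto simp: is_labelling_iff)
  then show ?thesis using assms(2) by (intro that) auto
qed

text \<open>Makes the factor of an edge in \<open>label_sign\<close> antisymmetric in the two
  half-edges, so that it can be compared between graphs with different edges.\<close>

lemma arrow_factor:
  assumes "a \<in> I" "b \<notin> I"
  shows "(if Min {a, b :: nat} \<in> I then 1 else - 1) = pair_sign a b"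
  using assms by (auto simp: pair_sign_def min_def)

lemma is_loop_iff:
  assumes "wf_graph X" "{h, k} \<in> edges X"
  shows "is_loop X {h, k} \<longleftrightarrow> vertex_of X h = vertex_of X k"
proof -
  have "h \<in> halves X" "k \<in> halves X" using assms by (auto simp: halves_def)
  then show ?thesis
    using vertex_of_in[OF assms(1)] vertex_of_eq[OF assms(1)] unfolding is_loop_def
    by (metis bot.extremum insert_subset)
qed

section \<open>Collapsing\<close>

text \<open>An edge together with a direction. The collapsed graph depends on the set
  \<open>{h, k}\<close> only; the direction matters for the labellings.\<close>

locale collapsible =
  fixes X :: hgraph and h k :: nat
  assumes wf: "wf_graph X" and edge: "{h, k} \<in> edges X" and nonloop: "vertex_of X h \<noteq> vertex_of X k"
begin

abbreviation "Y \<equiv> collapse_graph {h, k} X"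
abbreviation "u \<equiv> vertex_of X h \<union> vertex_of X k - {h, k}"

lemma halves_hk: "h \<in> halves X" "k \<in> halves X"
  using edge by (auto simp: halves_def)

lemma verts_hk: "vertex_of X h \<in> verts X" "vertex_of X k \<in> verts X"
  "h \<in> vertex_of X h" "k \<in> vertex_of X k"
  using vertex_of_in[OF wf] halves_hk by auto

lemma hk: "h \<noteq> k" "compl_half X h = k" "compl_half X k = h"
  using compl_half_eq[OF wf edge] compl_half_eq[OF wf, of k h] edge by (auto simp: insert_commute)

lemma verts_meeting: "v \<in> verts X \<Longrightarrow> v \<inter> {h, k} \<noteq> {} \<longleftrightarrow> v = vertex_of X h \<or> v = vertex_of X k"
  using verts_hk vertex_of_eq[OF wf, of v] by auto

lemma verts_collapse: "verts Y = insert u (verts X - {vertex_of X h, vertex_of X k})"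
proof -
  have "{v \<in> verts X. v \<inter> {h, k} \<noteq> {}} = {vertex_of X h, vertex_of X k}"
    using verts_meeting verts_hk by blast
  moreover have "{v \<in> verts X. v \<inter> {h, k} = {}} = verts X - {vertex_of X h, vertex_of X k}"
    using verts_meeting by blast
  ultimately show ?thesis by (simp add: collapse_graph_def)
qed

lemma edges_collapse: "edges Y = edges X - {{h, k}}"
  by (simp add: collapse_graph_def)

lemma halves_collapse: "halves Y = halves X - {h, k}"
proof -
  have "x \<notin> {h, k}" if "e \<in> edges X" "e \<noteq> {h, k}" "x \<in> e" for x e
    using wf_edges_eq[OF wf that(1) edge] that by auto
  then show ?thesis unfolding halves_def edges_collapse by blast
qed

lemma merged_disjoint: "v \<in> verts X - {vertex_of X h, vertex_of X k} \<Longrightarrow> v \<inter> (vertex_of X h \<union> vertex_of X k) = {}"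
  using wf_verts_eq[OF wf] verts_hk by blast

text \<open>The valences of the two ends add up and two half-edges disappear: at least 3 + 3 - 2
  remain.\<close>

lemma card_u: "card u \<ge> 3"
proof -
  let ?a = "vertex_of X h" and ?b = "vertex_of X k"
  have fin: "finite ?a" "finite ?b" using wf_finite_vert[OF wf] verts_hk by auto
  have "?a \<inter> ?b = {}" using wf_verts_eq[OF wf verts_hk(1,2)] nonloop by blast
  then have "card (?a \<union> ?b) = card ?a + card ?b" using fin by (simp add: card_Un_disjoint)
  moreover have "card ?a \<ge> 3" "card ?b \<ge> 3" using wf verts_hk by (auto simp: wf_graph_def)
  moreover have "card u = card (?a \<union> ?b) - 2"
    using verts_hk hk by (subst card_Diff_subset) auto
  ultimately show ?thesis by simp
qed

lemma u_nonempty: "u \<noteq> {}"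
  using card_u by (metis card.empty not_numeral_le_zero)

text \<open>Being disjoint from the other vertices excludes equality because \<open>u\<close> is
  nonempty. Hence the numbering after the collapse has no repetition.\<close>

lemma u_notin: "u \<notin> verts X - {vertex_of X h, vertex_of X k}"
  using merged_disjoint u_nonempty by blast

lemma wf_collapse: "wf_graph Y"
proof -
  have "partition_on (halves X - {h, k}) (edges X - {{h, k}})"
  proof (rule partition_onI)
    show "\<Union> (edges X - {{h, k}}) = halves X - {h, k}"
      using halves_collapse by (simp add: halves_def edges_collapse)
    show "disjnt p p'" if "p \<in> edges X - {{h, k}}" "p' \<in> edges X - {{h, k}}" "p \<noteq> p'" for p p'
      using that wf_edges_eq[OF wf] by (auto simp: disjnt_def)
    show "{} \<notin> edges X - {{h, k}}"
      using wf by (auto simp: wf_graph_def)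
  qed
  moreover have "partition_on (halves X - {h, k}) (verts Y)"
  proof (rule partition_onI)
    have "\<Union> (verts X - {vertex_of X h, vertex_of X k}) \<union> u = halves X - {h, k}"
    proof -
      have "\<Union> (verts X - {vertex_of X h, vertex_of X k}) \<inter> {h, k} = {}"
        using merged_disjoint verts_hk by blast
      moreover have "halves X = \<Union> (verts X - {vertex_of X h, vertex_of X k}) \<union> (vertex_of X h \<union> vertex_of X k)"
        using wf_Union_verts[OF wf] verts_hk(1,2) by (metis Union_Un_distrib Union_insert Union_empty Un_empty_right
          Un_Diff_cancel2 empty_subsetI insert_subset sup.absorb1)
      ultimately show ?thesis by blast
    qed
    then show "\<Union> (verts Y) = halves X - {h, k}" unfolding verts_collapse by blast
    show "disjnt p p'" if "p \<in> verts Y" "p' \<in> verts Y" "p \<noteq> p'" for p p'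
    proof -
      have "disjnt v v'" if "v \<in> verts X" "v' \<in> verts X" "v \<noteq> v'" for v v'
        using wf_verts_eq[OF wf that(1,2)] that(3) by (auto simp: disjnt_def)
      moreover have "disjnt v u" if "v \<in> verts X - {vertex_of X h, vertex_of X k}" for v
        using merged_disjoint[OF that] by (auto simp: disjnt_def)
      ultimately show ?thesis
        using that unfolding verts_collapse by (simp only: insert_iff) (metis Diff_iff disjnt_sym)
    qed
    show "{} \<notin> verts Y"
      using u_nonempty wf unfolding verts_collapse wf_graph_def by auto
  qed
  moreover have "card v \<ge> 3" if "v \<in> verts Y" for v
    using that card_u wf unfolding verts_collapse wf_graph_def by auto
  moreover have "finite (halves Y)" "\<forall>e\<in>edges Y. card e = 2"
    using wf halves_collapse edges_collapse by (auto simp: wf_graph_def)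
  ultimately show ?thesis
    unfolding wf_graph_def halves_collapse edges_collapse by auto
qed

lemma compl_collapse: "x \<in> halves Y \<Longrightarrow> compl_half Y x = compl_half X x"
proof -
  assume x: "x \<in> halves Y"
  then have "{x, compl_half X x} \<in> edges Y"
    using compl_half_props[OF wf, of x] unfolding halves_collapse edges_collapse by auto
  then show ?thesis using compl_half_eq[OF wf_collapse] by blast
qed

lemma vertex_of_collapse:
  assumes "x \<in> halves Y"
  shows "vertex_of Y x = (if vertex_of X x \<in> {vertex_of X h, vertex_of X k} then u else vertex_of X x)"
proof -
  have x: "x \<in> halves X" "x \<noteq> h" "x \<noteq> k" using assms by (auto simp: halves_collapse)
  then show ?thesis
    using vertex_of_in[OF wf x(1)]
    by (auto intro!: vertex_of_eq[OF wf_collapse] simp: verts_collapse)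
qed

text \<open>The only new coincidences are between the two ends of the collapsed edge. This decides
  which later collapses and contractions remain admissible.\<close>

lemma vertex_of_collapse_eq_iff:
  assumes "x \<in> halves Y" "y \<in> halves Y"
  shows "vertex_of Y x = vertex_of Y y \<longleftrightarrow> vertex_of X x = vertex_of X y \<or>
    {vertex_of X x, vertex_of X y} \<subseteq> {vertex_of X h, vertex_of X k}"
proof -
  have ne: "u \<noteq> vertex_of X z" if "z \<in> halves Y" "vertex_of X z \<notin> {vertex_of X h, vertex_of X k}" for z
  proof -
    have "vertex_of X z \<in> verts X - {vertex_of X h, vertex_of X k}"
      using that vertex_of_in[OF wf, of z] by (simp add: halves_collapse)
    then show ?thesis using u_notin by metis
  qed
  have "((if p \<in> {a, b} then w else p) = (if q \<in> {a, b} then w else q)) = (p = q \<or> {p, q} \<subseteq> {a, b})"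
    if "p \<notin> {a, b} \<Longrightarrow> w \<noteq> p" "q \<notin> {a, b} \<Longrightarrow> w \<noteq> q" for p q a b w :: "nat set"
    using that by auto
  from this[OF ne[OF assms(1)] ne[OF assms(2)]] show ?thesis
    unfolding vertex_of_collapse[OF assms(1)] vertex_of_collapse[OF assms(2)] .
qed

lemma is_labelling_collapse:
  assumes L: "is_labelling X L" "numbering L = vertex_of X h # vertex_of X k # xs"
  shows "collapse_labelling {h, k} L = \<lparr>numbering = u # xs, initial = initial L - {h, k}\<rparr>"
    "is_labelling Y (collapse_labelling {h, k} L)"
proof -
  show eq: "collapse_labelling {h, k} L = \<lparr>numbering = u # xs, initial = initial L - {h, k}\<rparr>"
    using L by (simp add: collapse_labelling_def)
  have xs: "distinct xs" "set xs = verts X - {vertex_of X h, vertex_of X k}"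
    using L by (auto simp: is_labelling_def)
  have "compl_half Y x \<notin> {h, k}" if "x \<in> halves Y" for x
    using that compl_half_props[OF wf_collapse that] by (auto simp: halves_collapse)
  then show "is_labelling Y (collapse_labelling {h, k} L)"
    unfolding eq is_labelling_iff[OF wf_collapse]
    using xs u_notin L(1) compl_collapse
    by (auto simp: verts_collapse is_labelling_iff[OF wf] halves_collapse)
qed

text \<open>The right-hand side does not depend on the labelling, and exchanging \<open>h\<close> and \<open>k\<close> does not change it.\<close>

lemma collapse_sign:
  assumes L: "is_labelling X L" "numbering L = vertex_of X h # vertex_of X k # xs"
    and I: "h \<in> initial L" "k \<notin> initial L"
  shows "label_sign X L * label_sign Y (collapse_labelling {h, k} L) =
    pair_sign (set_encode (vertex_of X h)) (set_encode (vertex_of X k)) * pair_sign h k *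
    (\<Prod>v\<in>verts X - {vertex_of X h, vertex_of X k}.
       pair_sign (set_encode (vertex_of X h)) (set_encode v) *
       pair_sign (set_encode (vertex_of X k)) (set_encode v) *
       pair_sign (set_encode u) (set_encode v))"
proof -
  let ?p = "\<lambda>v. \<Prod>w\<in>verts X - {vertex_of X h, vertex_of X k}. pair_sign (set_encode v) (set_encode w)"
  let ?q = "\<Prod>f\<in>edges X - {{h, k}}. if Min f \<in> initial L then 1 else - 1 :: int"
  have xs: "distinct xs" "set xs = verts X - {vertex_of X h, vertex_of X k}"
    using L by (auto simp: is_labelling_def)
  have p: "(\<Prod>y\<leftarrow>map set_encode xs. pair_sign (set_encode v) y) = ?p v" for v
    using prod.distinct_set_conv_list[OF xs(1), of "\<lambda>w. pair_sign (set_encode v) (set_encode w)"] xs(2)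
    by (simp add: comp_def)
  \<comment> \<open>The comparisons among the other vertices and the arrows of the other edges enter
    both signs, so they only occur as squares.\<close>
  have ls: "list_sign (map set_encode xs) * list_sign (map set_encode xs) = 1"
    "?q * ?q = 1"
  proof -
    show "list_sign (map set_encode xs) * list_sign (map set_encode xs) = 1"
      using list_sign_pm1[of "map set_encode xs"] by auto
    show "?q * ?q = 1"
      by (simp flip: prod.distrib) (rule prod.neutral, auto)
  qed
  have 1: "label_sign X L = pair_sign (set_encode (vertex_of X h)) (set_encode (vertex_of X k)) *
     ?p (vertex_of X h) * ?p (vertex_of X k) * list_sign (map set_encode xs) * (pair_sign h k * ?q)"
    unfolding label_sign_def prod.remove[OF wf_finite_edges[OF wf] edge] L(2)
    using arrow_factor[OF I] p by simp
  have "(\<Prod>f\<in>edges Y. if Min f \<in> initial L - {h, k} then 1 else - 1) = ?q"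
    unfolding edges_collapse
  proof (rule prod.cong)
    fix f assume f: "f \<in> edges X - {{h, k}}"
    then have "Min f \<in> f" using wf_finite_edge[OF wf, of f] wf by (intro Min_in) (auto simp: wf_graph_def)
    then have "Min f \<notin> {h, k}" using wf_edges_eq[OF wf, of f "{h, k}"] edge f by blast
    then show "(if Min f \<in> initial L - {h, k} then 1 else - 1) = (if Min f \<in> initial L then 1 else - 1 :: int)"
      by auto
  qed simp
  then have 2: "label_sign Y (collapse_labelling {h, k} L) = ?p u * list_sign (map set_encode xs) * ?q"
    unfolding is_labelling_collapse(1)[OF L] label_sign_def using p by simp
  have "label_sign X L * label_sign Y (collapse_labelling {h, k} L) =
    pair_sign (set_encode (vertex_of X h)) (set_encode (vertex_of X k)) * pair_sign h k *
    (?p (vertex_of X h) * ?p (vertex_of X k) * ?p u) *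
    (list_sign (map set_encode xs) * list_sign (map set_encode xs)) * (?q * ?q)"
    unfolding 1 2 by (simp only: mult_ac)
  then show ?thesis unfolding ls by (simp add: prod.distrib)
qed

text \<open>Reversing the arrow of such an edge corrects the sign of a labelling adapted to the edge \<open>{h, k}\<close>.\<close>

lemma another_edge: "\<exists>g\<in>edges X. g \<noteq> {h, k}"
proof -
  have "card (vertex_of X h) \<ge> 3" using wf verts_hk by (auto simp: wf_graph_def)
  then have "\<not> vertex_of X h \<subseteq> {h, k}"
    using card_mono[of "{h, k}" "vertex_of X h"] hk by auto
  then obtain x where "x \<in> halves X" "x \<notin> {h, k}"
    using wf_vert_subset[OF wf verts_hk(1)] by blast
  then show ?thesis using edge_of_in[OF wf] by metis
qed

end

lemma collapsible_commute: "collapsible X h k \<Longrightarrow> collapsible X k h"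
  by (auto simp add: collapsible_def insert_commute)

lemma runs_from_1_to_2E:
  assumes "wf_graph X" "is_labelling X L" "e \<in> edges X" "runs_from_1_to_2 e L"
  obtains h k xs where "e = {h, k}" "collapsible X h k" "h \<in> initial L" "k \<notin> initial L"
    "numbering L = vertex_of X h # vertex_of X k # xs"
proof -
  obtain h k where hk: "e = {h, k}" "h \<in> initial L" "k \<notin> initial L" "length (numbering L) \<ge> 2"
     "h \<in> numbering L ! 0" "k \<in> numbering L ! 1"
    using assms(4) by (auto simp: runs_from_1_to_2_def)
  obtain v w xs where n: "numbering L = v # w # xs"
    using hk(4) by (metis Suc_le_length_iff numeral_2_eq_2)
  have "v \<in> verts X" "w \<in> verts X" "v \<noteq> w" using assms(2) n by (auto simp: is_labelling_def)
  then have "vertex_of X h = v" "vertex_of X k = w"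
    using vertex_of_eq[OF assms(1)] n hk by auto
  then show ?thesis
    using that[of h k xs] hk n \<open>v \<noteq> w\<close> assms by (auto simp: collapsible_def)
qed

text \<open>\<open>runs_from_1_to_2\<close> leaves open which half-edge is initial. For labellings
  that run in opposite directions, the exchanged vertices and the reversed arrow each contribute -1
  to the formula of \<open>collapse_sign\<close>, and the two cancel.\<close>

lemma collapse_sign_indep:
  assumes "wf_graph X" "e \<in> edges X" "is_labelling X L" "runs_from_1_to_2 e L"
    "is_labelling X L'" "runs_from_1_to_2 e L'"
  shows "label_sign X L * label_sign (collapse_graph e X) (collapse_labelling e L) =
    label_sign X L' * label_sign (collapse_graph e X) (collapse_labelling e L')"
proof -
  obtain h k xs where 1: "e = {h, k}" "collapsible X h k" "h \<in> initial L" "k \<notin> initial L"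
    "numbering L = vertex_of X h # vertex_of X k # xs"
    using runs_from_1_to_2E assms by metis
  obtain h' k' xs' where 2: "e = {h', k'}" "collapsible X h' k'" "h' \<in> initial L'" "k' \<notin> initial L'"
    "numbering L' = vertex_of X h' # vertex_of X k' # xs'"
    using runs_from_1_to_2E assms by metis
  interpret a: collapsible X h k by (rule 1(2))
  interpret b: collapsible X h' k' by (rule 2(2))
  have inj: "set_encode (vertex_of X h) \<noteq> set_encode (vertex_of X k)"
    using a.nonloop a.verts_hk inj_on_set_encode_verts[OF a.wf] by (auto dest: inj_onD)
  consider "h' = h" "k' = k" | "h' = k" "k' = h"
    using 1(1) 2(1) by (metis doubleton_eq_iff)
  then show ?thesis
  proof cases
    case a: 1
    show ?thesis
      using a.collapse_sign[OF assms(3) 1(5,3,4)] b.collapse_sign[OF assms(5) 2(5,3,4)]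
      unfolding a 1(1) by simp
  next
    case b: 2
    show ?thesis
      using a.collapse_sign[OF assms(3) 1(5,3,4)] b.collapse_sign[OF assms(5) 2(5,3,4)]
        pair_sign_swap[OF a.hk(1)] pair_sign_swap[OF inj]
      unfolding b 1(1) by (simp add: insert_commute Un_commute mult_ac)
  qed
qed

lemma (in collapsible) runsI:
  assumes "numbering L = vertex_of X h # vertex_of X k # xs" "h \<in> initial L" "k \<notin> initial L"
  shows "runs_from_1_to_2 {h, k} L"
  using assms verts_hk unfolding runs_from_1_to_2_def by auto

text \<open>Guarantees that the \<open>SOME\<close> in \<open>collapse\<close> has a witness inside
  the given orientation: a wrong sign is repaired away from the edge \<open>{h, k}\<close> and the
  first two numbers.\<close>

lemma (in collapsible) exists_running:
  assumes "s = label_sign X L0" "is_labelling X L0"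
  shows "\<exists>L. is_labelling X L \<and> label_sign X L = s \<and> runs_from_1_to_2 {h, k} L"
proof -
  obtain L xs where L: "is_labelling X L" "{h} \<subseteq> initial L" "numbering L = [vertex_of X h, vertex_of X k] @ xs"
    by (rule labelling_exists[OF wf, of "{h}" "[vertex_of X h, vertex_of X k]"])
      (use halves_hk hk verts_hk nonloop in auto)
  have "k \<notin> initial L" using L(1,2) hk halves_hk by (auto simp: is_labelling_iff[OF wf])
  then have r: "runs_from_1_to_2 {h, k} L" using L by (intro runsI) auto
  obtain g where g: "g \<in> edges X" "g \<noteq> {h, k}" using another_edge by blast
  have disj: "h \<notin> g" "k \<notin> g" using wf_edges_eq[OF wf g(1) edge] g by auto
  have r': "runs_from_1_to_2 {h, k} (reverse_arrow g L)"
    using L \<open>k \<notin> initial L\<close> disj by (intro runsI) (auto simp: reverse_arrow_def)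
  have "s \<in> {1, - 1}" using assms(1) label_sign_pm1 by blast
  then consider "label_sign X L = s" | "label_sign X (reverse_arrow g L) = s"
    using label_sign_pm1[of X L] label_sign_reverse_arrow[OF wf L(1) g(1)] by force
  then show ?thesis
    using r r' L(1) is_labelling_reverse_arrow[OF wf L(1) g(1)] by cases blast+
qed

text \<open>By \<open>collapse_sign_indep\<close> every adapted labelling computes the sign, even
  one outside \<open>orient A\<close>: a wrong sign before the collapse is matched by a wrong sign
  after it.\<close>

lemma collapse_ograph:
  assumes "collapsible (ugraph A) h k"
  shows "ugraph (collapse {h, k} A) = collapse_graph {h, k} (ugraph A)"
    and "is_labelling (ugraph A) L \<Longrightarrow> runs_from_1_to_2 {h, k} L \<Longrightarrow>
      orient_sign (collapse {h, k} A) = orient_sign A * label_sign (ugraph A) L *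
        label_sign (collapse_graph {h, k} (ugraph A)) (collapse_labelling {h, k} L)"
proof -
  interpret collapsible "ugraph A" h k by fact
  let ?L = "SOME L. L \<in> orient A \<and> runs_from_1_to_2 {h, k} L"
  obtain L0 where "L0 \<in> orient A" using orient_nonempty by blast
  then have "\<exists>L. L \<in> orient A \<and> runs_from_1_to_2 {h, k} L"
    using exists_running[of "orient_sign A" L0] by (auto simp: orient_iff)
  then have "?L \<in> orient A \<and> runs_from_1_to_2 {h, k} ?L" by (rule someI_ex)
  then have L: "is_labelling (ugraph A) ?L" "label_sign (ugraph A) ?L = orient_sign A"
    "runs_from_1_to_2 {h, k} ?L" by (auto simp: orient_iff)
  have c: "is_labelling (collapse_graph {h, k} (ugraph A)) (collapse_labelling {h, k} ?L)"
  proof -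
    obtain h' k' xs where "{h, k} = {h', k'}" "collapsible (ugraph A) h' k'"
      "numbering ?L = vertex_of (ugraph A) h' # vertex_of (ugraph A) k' # xs"
      using runs_from_1_to_2E[OF wf L(1) edge L(3)] by metis
    then show ?thesis using collapsible.is_labelling_collapse(2) L(1) by metis
  qed
  have eq: "collapse {h, k} A = Abs_ograph (collapse_graph {h, k} (ugraph A),
    orientation_of (collapse_graph {h, k} (ugraph A)) (collapse_labelling {h, k} ?L))"
    by (simp add: collapse_def Let_def)
  show "ugraph (collapse {h, k} A) = collapse_graph {h, k} (ugraph A)"
    unfolding eq by (rule Abs_ograph_orientation(1)[OF wf_collapse c])
  assume "is_labelling (ugraph A) L" "runs_from_1_to_2 {h, k} L"
  from collapse_sign_indep[OF wf edge this L(1,3)]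
  show "orient_sign (collapse {h, k} A) = orient_sign A * label_sign (ugraph A) L *
        label_sign (collapse_graph {h, k} (ugraph A)) (collapse_labelling {h, k} L)"
    unfolding eq Abs_ograph_orientation(2)[OF wf_collapse c] L(2)[symmetric] by (simp add: mult.assoc)
qed

section \<open>Regluing\<close>

text \<open>The vertices are left free, since regluing itself concerns the edges only;
  \<open>contractible\<close> adds that \<open>h\<close> and \<open>k\<close> begin at different
  vertices.\<close>

locale regluable =
  fixes X :: hgraph and h k :: nat
  assumes wf: "wf_graph X" and halves_hk: "h \<in> halves X" "k \<in> halves X"
    and distinct_hk: "h \<noteq> k" "k \<noteq> compl_half X h"
begin

abbreviation "Y \<equiv> reglue_graph h k X"
abbreviation "h' \<equiv> compl_half X h"
abbreviation "k' \<equiv> compl_half X k"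

lemma distinct4: "h' \<in> halves X" "k' \<in> halves X" "h' \<noteq> h" "k' \<noteq> k" "compl_half X h' = h" "compl_half X k' = k"
   "h' \<noteq> k'" "h' \<noteq> k" "k' \<noteq> h"
  using compl_half_props[OF wf halves_hk(1)] compl_half_props[OF wf halves_hk(2)] distinct_hk by auto

lemma verts_reglue [simp]: "verts Y = verts X"
  by (simp add: reglue_graph_def)

lemma edges_reglue: "edges Y = (edges X - {{h, h'}, {k, k'}}) \<union> {{h, k}, {h', k'}}"
  using edge_of_compl[OF wf] halves_hk by (simp add: reglue_graph_def)

lemma other_edges:
  assumes "e \<in> edges X - {{h, h'}, {k, k'}}"
  shows "e \<inter> {h, k, h', k'} = {}"
proof -
  have "{h, h'} \<in> edges X" "{k, k'} \<in> edges X" using compl_half_props[OF wf] halves_hk by auto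
  then show ?thesis using assms wf_edges_eq[OF wf, of e] by blast
qed

lemma halves_reglue [simp]: "halves Y = halves X"
proof -
  have "edges X = (edges X - {{h, h'}, {k, k'}}) \<union> {{h, h'}, {k, k'}}"
    using compl_half_props(1)[OF wf] halves_hk by auto
  then have "halves X = \<Union> (edges X - {{h, h'}, {k, k'}}) \<union> {h, h', k, k'}"
    unfolding halves_def by (metis Union_Un_distrib Union_insert Union_empty Un_insert_left Un_empty_left Un_empty_right)
  then show ?thesis unfolding halves_def edges_reglue by auto
qed

lemma wf_reglue: "wf_graph Y"
proof -
  have "disjnt p q" if "p \<in> edges Y" "q \<in> edges Y" "p \<noteq> q" for p q
  proof -
    have a: "disjnt p q" if "p \<in> edges X" "q \<in> edges X" "p \<noteq> q" for p q
      using wf_edges_eq[OF wf that(1,2)] that(3) by (auto simp: disjnt_def)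
    have b: "disjnt p {h, k}" "disjnt p {h', k'}" if "p \<in> edges X - {{h, h'}, {k, k'}}" for p
      using other_edges[OF that] by (auto simp: disjnt_def)
    have c: "disjnt {h, k} {h', k'}" using distinct4 distinct_hk by auto
    have "p \<in> edges X - {{h, h'}, {k, k'}} \<or> p = {h, k} \<or> p = {h', k'}"
      "q \<in> edges X - {{h, h'}, {k, k'}} \<or> q = {h, k} \<or> q = {h', k'}"
      using that unfolding edges_reglue by auto
    then show ?thesis using a b c \<open>p \<noteq> q\<close> by (metis Diff_iff disjnt_sym)
  qed
  then have "partition_on (halves Y) (edges Y)"
    using wf by (intro partition_onI) (auto simp: halves_def edges_reglue wf_graph_def)
  moreover have "card e = 2" if "e \<in> edges Y" for e
    using that distinct4 distinct_hk wf by (auto simp: edges_reglue wf_graph_def)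
  ultimately show ?thesis using wf by (simp add: wf_graph_def)
qed

lemma compl_reglue:
  "compl_half Y h = k" "compl_half Y k = h" "compl_half Y h' = k'" "compl_half Y k' = h'"
  "x \<in> halves X \<Longrightarrow> x \<notin> {h, k, h', k'} \<Longrightarrow> compl_half Y x = compl_half X x"
proof -
  have "{h, k} \<in> edges Y" "{h', k'} \<in> edges Y" "{k, h} \<in> edges Y" "{k', h'} \<in> edges Y"
    by (auto simp: edges_reglue insert_commute)
  then show "compl_half Y h = k" "compl_half Y k = h" "compl_half Y h' = k'" "compl_half Y k' = h'"
    using compl_half_eq[OF wf_reglue] by auto
  assume x: "x \<in> halves X" "x \<notin> {h, k, h', k'}"
  then have "{x, compl_half X x} \<in> edges Y"
    using compl_half_props[OF wf x(1)] by (auto simp: edges_reglue)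
  then show "compl_half Y x = compl_half X x"
    using compl_half_eq[OF wf_reglue] by auto
qed

text \<open>Regluing as a change of the complement involution at four points;
  \<open>reglue_reglue\<close> compares two graphs in this form.\<close>

lemma compl_reglue_if:
  "x \<in> halves X \<Longrightarrow> compl_half Y x =
    (if x = h then k else if x = k then h else if x = h' then k' else if x = k' then h' else compl_half X x)"
  using compl_reglue by auto

lemma vertex_of_reglue [simp]: "vertex_of Y x = vertex_of X x"
  by (simp add: vertex_of_def)

text \<open>If \<open>h\<close> is initial and \<open>k\<close> terminal, then \<open>h'\<close> is
  terminal and \<open>k'\<close> initial, so each new edge again has exactly one initial
  half-edge.\<close>

lemma is_labelling_reglue:
  assumes "is_labelling X L" "h \<in> initial L" "k \<notin> initial L"
  shows "is_labelling Y L"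
proof -
  have I: "h' \<notin> initial L" "k' \<in> initial L"
    using assms halves_hk by (auto simp: is_labelling_iff[OF wf])
  have "(compl_half Y x \<in> initial L) = (x \<notin> initial L)" if "x \<in> halves X" for x
  proof (cases "x \<in> {h, k, h', k'}")
    case True
    then show ?thesis using I assms compl_reglue by auto
  next
    case False
    then show ?thesis using compl_reglue(5)[OF that False] assms(1) that by (auto simp: is_labelling_iff[OF wf])
  qed
  then show ?thesis using assms(1) by (simp add: is_labelling_iff[OF wf] is_labelling_iff[OF wf_reglue])
qed

text \<open>The numbering and all other edges enter both signs and square to 1. The two cut and the
  two new edges remain, and their factors no longer mention \<open>L\<close>.\<close>

lemma reglue_sign:
  assumes "is_labelling X L" "h \<in> initial L" "k \<notin> initial L"
  shows "label_sign X L * label_sign Y L =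
    pair_sign h h' * pair_sign k' k * (pair_sign h k * pair_sign k' h')"
proof -
  have I: "h' \<notin> initial L" "k' \<in> initial L"
    using assms halves_hk by (auto simp: is_labelling_iff[OF wf])
  let ?w = "\<lambda>f. if Min f \<in> initial L then 1 else - 1 :: int"
  let ?E = "edges X - {{h, h'}, {k, k'}}" and ?l = "list_sign (map set_encode (numbering L))"
  have E: "edges X = insert {h, h'} (insert {k, k'} ?E)"
    using compl_half_props(1)[OF wf] halves_hk by auto
  have fin: "finite ?E" using wf_finite_edges[OF wf] by simp
  have n: "{h, h'} \<noteq> {k, k'}" "{h, k} \<noteq> {h', k'}" "{h, k} \<notin> ?E" "{h', k'} \<notin> ?E"
    using distinct4 distinct_hk other_edges[of "{h, k}"] other_edges[of "{h', k'}"]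
    by (auto simp: doubleton_eq_iff)
  have "prod ?w (edges X) = ?w {h, h'} * (?w {k, k'} * prod ?w ?E)"
    by (subst E) (use fin n in simp)
  then have 1: "prod ?w (edges X) = pair_sign h h' * (pair_sign k' k * prod ?w ?E)"
    using arrow_factor[of h "initial L" h'] arrow_factor[of k' "initial L" k] I assms by (simp add: insert_commute)
  have "prod ?w (edges Y) = ?w {h, k} * (?w {h', k'} * prod ?w ?E)"
    unfolding edges_reglue using fin n by simp
  then have 2: "prod ?w (edges Y) = pair_sign h k * (pair_sign k' h' * prod ?w ?E)"
    using arrow_factor[of h "initial L" k] arrow_factor[of k' "initial L" h'] I assms by (simp add: insert_commute)
  have "prod ?w ?E * prod ?w ?E = 1" "?l * ?l = 1"
  proof -
    show "prod ?w ?E * prod ?w ?E = 1"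
      by (simp flip: prod.distrib) (rule prod.neutral, auto)
    show "?l * ?l = 1" using list_sign_pm1[of "map set_encode (numbering L)"] by auto
  qed
  moreover have "label_sign X L * label_sign Y L = (?l * ?l) * (prod ?w ?E * prod ?w ?E) *
     (pair_sign h h' * pair_sign k' k * (pair_sign h k * pair_sign k' h'))"
    unfolding label_sign_def 1 2 by (simp only: mult_ac)
  ultimately show ?thesis by simp
qed

text \<open>The arrows of the two cut edges are prescribed but the numbering is free, so exchanging
  the numbers 1 and 2 corrects a wrong sign. Two vertices are available because \<open>h\<close> and
  \<open>k\<close> begin at different ones.\<close>

lemma exists_reglue_labelling:
  assumes "vertex_of X h \<noteq> vertex_of X k" "s = label_sign X L0"
  shows "\<exists>L. is_labelling X L \<and> label_sign X L = s \<and> h \<in> initial L \<and> k \<notin> initial L"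
proof -
  obtain L xs where L: "is_labelling X L" "{h, k'} \<subseteq> initial L" "numbering L = [vertex_of X h, vertex_of X k] @ xs"
    by (rule labelling_exists[OF wf, of "{h, k'}" "[vertex_of X h, vertex_of X k]"])
      (use halves_hk distinct_hk distinct4 assms vertex_of_in[OF wf] in auto)
  then have k: "k \<notin> initial L" using halves_hk by (auto simp: is_labelling_iff[OF wf])
  have l: "0 < (1::nat)" "1 < length (numbering L)" using L by auto
  have "s \<in> {1, - 1}" using assms(2) label_sign_pm1 by blast
  then consider "label_sign X L = s" | "label_sign X (swap_numbers 0 1 L) = s"
    using label_sign_pm1[of X L] label_sign_swap_numbers[OF wf L(1) l] by force
  then show ?thesis
    using k L is_labelling_swap_numbers[OF L(1) l]
    by cases (auto simp: swap_numbers_def)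
qed

end

text \<open>As with \<open>collapse_ograph\<close>, any labelling with the two prescribed arrows
  computes the sign, because the transition factor in \<open>reglue_sign\<close> does not depend on
  it.\<close>

lemma reglue_ograph:
  assumes "regluable (ugraph A) h k" "vertex_of (ugraph A) h \<noteq> vertex_of (ugraph A) k"
  shows "ugraph (reglue h k A) = reglue_graph h k (ugraph A)"
    and "is_labelling (ugraph A) L \<Longrightarrow> h \<in> initial L \<Longrightarrow> k \<notin> initial L \<Longrightarrow>
      orient_sign (reglue h k A) = orient_sign A * label_sign (ugraph A) L *
        label_sign (reglue_graph h k (ugraph A)) L"
proof -
  interpret regluable "ugraph A" h k by fact
  let ?L = "SOME L. L \<in> orient A \<and> h \<in> initial L \<and> k \<notin> initial L"
  obtain L0 where "L0 \<in> orient A" using orient_nonempty by blast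
  then have "\<exists>L. L \<in> orient A \<and> h \<in> initial L \<and> k \<notin> initial L"
    using exists_reglue_labelling[OF assms(2), of "orient_sign A" L0] by (auto simp: orient_iff)
  then have "?L \<in> orient A \<and> h \<in> initial ?L \<and> k \<notin> initial ?L" by (rule someI_ex)
  then have L: "is_labelling (ugraph A) ?L" "label_sign (ugraph A) ?L = orient_sign A"
    "h \<in> initial ?L" "k \<notin> initial ?L" by (auto simp: orient_iff)
  note c = is_labelling_reglue[OF L(1,3,4)]
  have eq: "reglue h k A = Abs_ograph (Y, orientation_of Y ?L)"
    by (simp add: reglue_def Let_def)
  show "ugraph (reglue h k A) = Y"
    unfolding eq by (rule Abs_ograph_orientation(1)[OF wf_reglue c])
  assume "is_labelling (ugraph A) L" "h \<in> initial L" "k \<notin> initial L"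
  from reglue_sign[OF this]
  have "label_sign (ugraph A) ?L * label_sign Y ?L = label_sign (ugraph A) L * label_sign Y L"
    unfolding reglue_sign[OF L(1,3,4)] by (rule sym)
  then have "label_sign Y ?L = label_sign (ugraph A) ?L * (label_sign (ugraph A) L * label_sign Y L)"
    using label_sign_square_left[of "ugraph A" ?L "label_sign Y ?L"] by simp
  then show "orient_sign (reglue h k A) = orient_sign A * label_sign (ugraph A) L * label_sign Y L"
    unfolding eq Abs_ograph_orientation(2)[OF wf_reglue c] L(2)[symmetric] by (simp only: mult.assoc)
qed

section \<open>Commutation of collapses and regluings\<close>

text \<open>The relation given by \<open>opposite\<close>, expressed through signs;
  \<open>opposed_iff\<close> proves the agreement.\<close>

definition opposed :: "ograph \<Rightarrow> ograph \<Rightarrow> bool" where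
  "opposed A B \<longleftrightarrow> ugraph A = ugraph B \<and> orient_sign A = - orient_sign B"

section \<open>Even and odd rearrangements of the first numbers\<close>

lemma distinct_encodings:
  assumes "wf_graph X" "is_labelling X L"
  shows "distinct (map set_encode (numbering L))"
  using assms inj_on_set_encode_verts[of X] by (simp add: distinct_map is_labelling_def)

text \<open>A rotation of three entries consists of two adjacent exchanges.\<close>

lemma list_sign_rotate3:
  assumes "distinct [a, b, c]"
  shows "list_sign (b # c # a # xs) = list_sign (a # b # c # xs)"
  using assms pair_sign_swap[of a b] pair_sign_swap[of a c] by (simp add: mult_ac)

text \<open>Exchanging two blocks of length two takes four adjacent exchanges.\<close>

lemma list_sign_rotate4:
  assumes "distinct [a, b, c, d]"
  shows "list_sign (c # d # a # b # xs) = list_sign (a # b # c # d # xs)"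
  using assms pair_sign_swap[of a c] pair_sign_swap[of a d] pair_sign_swap[of b c] pair_sign_swap[of b d]
  by (simp add: mult_ac)

lemma is_labelling_permute:
  assumes "is_labelling X \<lparr>numbering = xs, initial = I\<rparr>" "mset ys = mset xs"
  shows "is_labelling X \<lparr>numbering = ys, initial = I\<rparr>"
  using assms(1) mset_eq_setD[OF assms(2)] mset_eq_imp_distinct_iff[OF assms(2)]
  by (simp add: is_labelling_def)

lemma label_sign_swap2:
  assumes "wf_graph X" "is_labelling X \<lparr>numbering = a # b # xs, initial = I\<rparr>"
  shows "label_sign X \<lparr>numbering = b # a # xs, initial = I\<rparr> = - label_sign X \<lparr>numbering = a # b # xs, initial = I\<rparr>"
    "is_labelling X \<lparr>numbering = b # a # xs, initial = I\<rparr>"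
proof -
  have "distinct (map set_encode [a, b])"
    using distinct_encodings[OF assms] by simp
  then have "list_sign (map set_encode (b # a # xs)) = - list_sign (map set_encode (a # b # xs))"
    unfolding list.map by (intro list_sign_swap) auto
  then show "label_sign X \<lparr>numbering = b # a # xs, initial = I\<rparr> = - label_sign X \<lparr>numbering = a # b # xs, initial = I\<rparr>"
    by (simp only: label_sign_def labelling.select_convs mult_minus_left)
  show "is_labelling X \<lparr>numbering = b # a # xs, initial = I\<rparr>"
    by (rule is_labelling_permute[OF assms(2)]) simp
qed

lemma label_sign_rotate3:
  assumes "wf_graph X" "is_labelling X \<lparr>numbering = a # b # c # xs, initial = I\<rparr>"
  shows "label_sign X \<lparr>numbering = b # c # a # xs, initial = I\<rparr> = label_sign X \<lparr>numbering = a # b # c # xs, initial = I\<rparr>"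
    "is_labelling X \<lparr>numbering = b # c # a # xs, initial = I\<rparr>"
proof -
  have "distinct (map set_encode [a, b, c])"
    using distinct_encodings[OF assms] by simp
  then have "list_sign (map set_encode (b # c # a # xs)) = list_sign (map set_encode (a # b # c # xs))"
    unfolding list.map by (intro list_sign_rotate3) simp
  then show "label_sign X \<lparr>numbering = b # c # a # xs, initial = I\<rparr> = label_sign X \<lparr>numbering = a # b # c # xs, initial = I\<rparr>"
    by (simp only: label_sign_def labelling.select_convs mult_minus_left)
  show "is_labelling X \<lparr>numbering = b # c # a # xs, initial = I\<rparr>"
    by (rule is_labelling_permute[OF assms(2)]) simp
qed

lemma label_sign_rotate4:
  assumes "wf_graph X" "is_labelling X \<lparr>numbering = a # b # c # d # xs, initial = I\<rparr>"
  shows "label_sign X \<lparr>numbering = c # d # a # b # xs, initial = I\<rparr> = label_sign X \<lparr>numbering = a # b # c # d # xs, initial = I\<rparr>"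
    "is_labelling X \<lparr>numbering = c # d # a # b # xs, initial = I\<rparr>"
proof -
  have "distinct (map set_encode [a, b, c, d])"
    using distinct_encodings[OF assms] by simp
  then have "list_sign (map set_encode (c # d # a # b # xs)) = list_sign (map set_encode (a # b # c # d # xs))"
    unfolding list.map by (intro list_sign_rotate4) simp
  then show "label_sign X \<lparr>numbering = c # d # a # b # xs, initial = I\<rparr> = label_sign X \<lparr>numbering = a # b # c # d # xs, initial = I\<rparr>"
    by (simp only: label_sign_def labelling.select_convs mult_minus_left)
  show "is_labelling X \<lparr>numbering = c # d # a # b # xs, initial = I\<rparr>"
    by (rule is_labelling_permute[OF assms(2)]) simp
qed

text \<open>Spells out the labelling after the collapse, so that a second collapse can start from
  it.\<close>

lemma collapse_step:
  assumes "collapsible X h k" "ugraph A = X" and L: "is_labelling X \<lparr>numbering = vertex_of X h # vertex_of X k # xs, initial = I\<rparr>"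
    "h \<in> I" "k \<notin> I"
  defines "u \<equiv> vertex_of X h \<union> vertex_of X k - {h, k}"
  shows "orient_sign (collapse {h, k} A) = orient_sign A *
      label_sign X \<lparr>numbering = vertex_of X h # vertex_of X k # xs, initial = I\<rparr> *
      label_sign (collapse_graph {h, k} X) \<lparr>numbering = u # xs, initial = I - {h, k}\<rparr>"
    "is_labelling (collapse_graph {h, k} X) \<lparr>numbering = u # xs, initial = I - {h, k}\<rparr>"
proof -
  interpret collapsible X h k by fact
  note c = is_labelling_collapse[OF L(1), of xs]
  have "runs_from_1_to_2 {h, k} \<lparr>numbering = vertex_of X h # vertex_of X k # xs, initial = I\<rparr>"
    by (rule runsI) (use L in auto)
  from collapse_ograph(2)[of A, OF _ _ this]
  show "orient_sign (collapse {h, k} A) = orient_sign A *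
      label_sign X \<lparr>numbering = vertex_of X h # vertex_of X k # xs, initial = I\<rparr> *
      label_sign (collapse_graph {h, k} X) \<lparr>numbering = u # xs, initial = I - {h, k}\<rparr>"
    using assms(1,2) L c(1) by (simp add: u_def)
  show "is_labelling (collapse_graph {h, k} X) \<lparr>numbering = u # xs, initial = I - {h, k}\<rparr>"
    using c by (simp add: u_def)
qed

text \<open>The edges form a path from v(h) over v(k) = v(p) to v(q), numbered 1, 2, 3. After
  collapsing \<open>{h, k}\<close>, the second edge already runs from 1 to 2. In the other order a
  rotation of three comes first, which is even, and afterwards \<open>{h, k}\<close> runs from 2 to
  1; the exchange \<open>s\<close> that corrects this is the minus sign.\<close>

lemma collapse_collapse_adjacent:
  assumes e: "collapsible (ugraph A) h k" and f: "{p, q} \<in> edges (ugraph A)" "{p, q} \<noteq> {h, k}"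
    and adj: "vertex_of (ugraph A) k = vertex_of (ugraph A) p"
    and q: "vertex_of (ugraph A) q \<notin> {vertex_of (ugraph A) h, vertex_of (ugraph A) k}"
  shows "opposed (collapse {p, q} (collapse {h, k} A)) (collapse {h, k} (collapse {p, q} A))"
proof -
  let ?X = "ugraph A" and ?V = "vertex_of (ugraph A)"
  let ?Y = "collapse_graph {h, k} ?X" and ?Z = "collapse_graph {p, q} ?X"
  interpret e: collapsible ?X h k by fact
  interpret f: collapsible ?X p q using e.wf f q adj by unfold_locales auto
  have dis: "{h, k} \<inter> {p, q} = {}" using wf_edges_eq[OF e.wf f(1) e.edge] f(2) by auto
  then have p4: "h \<noteq> p" "h \<noteq> q" "k \<noteq> p" "k \<noteq> q" by auto
  have yH: "p \<in> halves ?Y" "q \<in> halves ?Y" "h \<in> halves ?Z" "k \<in> halves ?Z"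
    using e.halves_collapse f.halves_collapse e.halves_hk f.halves_hk dis by auto
  have Y: "vertex_of ?Y p = e.u" "vertex_of ?Y q = ?V q"
    using e.vertex_of_collapse yH adj q by auto
  have Z: "vertex_of ?Z h = ?V h" "vertex_of ?Z k = f.u"
    using f.vertex_of_collapse yH adj q e.nonloop by auto
  interpret ef: collapsible ?Y p q
    using e.wf_collapse f e.edges_collapse e.vertex_of_collapse_eq_iff[OF yH(1,2)] adj q
    by unfold_locales auto
  interpret fe: collapsible ?Z h k
    using f.wf_collapse f(2) e.edge f.edges_collapse f.vertex_of_collapse_eq_iff[OF yH(3,4)] adj q e.nonloop
    by unfold_locales auto
  obtain L xs where L: "is_labelling ?X L" "{h, p} \<subseteq> initial L" "numbering L = [?V h, ?V k, ?V q] @ xs"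
  proof (rule labelling_exists[OF e.wf])
    show "{h, p} \<subseteq> halves ?X" using e.halves_hk f.halves_hk by simp
    show "compl_half ?X a \<notin> {h, p}" if "a \<in> {h, p}" for a using that e.hk f.hk p4 by auto
    show "distinct [?V h, ?V k, ?V q]" "set [?V h, ?V k, ?V q] \<subseteq> verts ?X"
      using q e.nonloop e.verts_hk f.verts_hk by auto
  qed
  define I where "I = initial L"
  have Leq: "L = \<lparr>numbering = ?V h # ?V k # ?V q # xs, initial = I\<rparr>" using L(3) by (simp add: I_def)
  have I: "h \<in> I" "p \<in> I" "k \<notin> I" "q \<notin> I"
    using L(1,2) e.hk f.hk e.halves_hk f.halves_hk by (auto simp: is_labelling_iff[OF e.wf] I_def)
  note L1 = L(1)[unfolded Leq]
  note 1 = collapse_step[OF e refl L1 I(1,3)]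
  have u1: "ugraph (collapse {h, k} A) = ?Y" by (rule collapse_ograph(1)[OF e])
  have 2: "orient_sign (collapse {p, q} (collapse {h, k} A)) = orient_sign (collapse {h, k} A) *
      label_sign ?Y \<lparr>numbering = e.u # ?V q # xs, initial = I - {h, k}\<rparr> *
      label_sign (collapse_graph {p, q} ?Y) \<lparr>numbering = (e.u \<union> ?V q - {p, q}) # xs, initial = I - {h, k} - {p, q}\<rparr>"
    "is_labelling (collapse_graph {p, q} ?Y) \<lparr>numbering = (e.u \<union> ?V q - {p, q}) # xs, initial = I - {h, k} - {p, q}\<rparr>"
    using collapse_step[OF ef.collapsible_axioms u1, of xs "I - {h, k}"] 1(2) I p4 by (auto simp: Y)
  note r = label_sign_rotate3[OF e.wf L1]
  note 3 = collapse_step[OF f.collapsible_axioms refl r(2)[unfolded adj] I(2,4)]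
  have u3: "ugraph (collapse {p, q} A) = ?Z" by (rule collapse_ograph(1)[OF f.collapsible_axioms])
  note s = label_sign_swap2[OF f.wf_collapse 3(2)]
  have 4: "orient_sign (collapse {h, k} (collapse {p, q} A)) = orient_sign (collapse {p, q} A) *
      label_sign ?Z \<lparr>numbering = ?V h # f.u # xs, initial = I - {p, q}\<rparr> *
      label_sign (collapse_graph {h, k} ?Z) \<lparr>numbering = (?V h \<union> f.u - {h, k}) # xs, initial = I - {p, q} - {h, k}\<rparr>"
    "is_labelling (collapse_graph {h, k} ?Z) \<lparr>numbering = (?V h \<union> f.u - {h, k}) # xs, initial = I - {p, q} - {h, k}\<rparr>"
    using collapse_step[OF fe.collapsible_axioms u3, of xs "I - {p, q}"] s(2) I p4 by (auto simp: Z)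
  have "{h, k} \<inter> ?V q = {}" "{p, q} \<inter> ?V h = {}"
    using e.verts_hk f.verts_hk q adj e.nonloop vertex_of_eq[OF e.wf] by blast+
  then have ueq: "e.u \<union> ?V q - {p, q} = ?V h \<union> f.u - {h, k}" and Ieq: "I - {h, k} - {p, q} = I - {p, q} - {h, k}"
    using adj dis by auto
  \<comment> \<open>The two final labellings have the same numbering, which identifies the vertex
    sets without computing them.\<close>
  have "verts (collapse_graph {p, q} ?Y) = verts (collapse_graph {h, k} ?Z)"
    using 2(2) 4(2) ueq by (simp add: is_labelling_def)
  then have geq: "collapse_graph {p, q} ?Y = collapse_graph {h, k} ?Z"
    by (auto simp: collapse_graph_def)
  have "orient_sign (collapse {p, q} (collapse {h, k} A)) = - orient_sign (collapse {h, k} (collapse {p, q} A))"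
    unfolding 2(1) 1(1) 4(1) 3(1) r(1)[unfolded adj] s(1) ueq Ieq geq
    by (simp add: adj mult.assoc)
  then show ?thesis
    using collapse_ograph(1)[of "collapse {h, k} A" p q] collapse_ograph(1)[of "collapse {p, q} A" h k]
      u1 u3 ef.collapsible_axioms fe.collapsible_axioms geq
    by (simp add: opposed_def)
qed

text \<open>With the four ends numbered 1 to 4, all rearrangements before a collapse are even. The
  two merged vertices end up at the front in opposite orders, and their exchange \<open>s\<close> is
  the minus sign.\<close>

lemma collapse_collapse_apart:
  assumes e: "collapsible (ugraph A) h k" and f: "collapsible (ugraph A) p q"
    and apart: "{vertex_of (ugraph A) p, vertex_of (ugraph A) q} \<inter> {vertex_of (ugraph A) h, vertex_of (ugraph A) k} = {}"
  shows "opposed (collapse {p, q} (collapse {h, k} A)) (collapse {h, k} (collapse {p, q} A))"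
proof -
  let ?X = "ugraph A" and ?V = "vertex_of (ugraph A)"
  let ?Y = "collapse_graph {h, k} ?X" and ?Z = "collapse_graph {p, q} ?X"
  interpret e: collapsible ?X h k by fact
  interpret f: collapsible ?X p q by fact
  have p4: "h \<noteq> p" "h \<noteq> q" "k \<noteq> p" "k \<noteq> q" using apart by auto
  then have dis: "{p, q} \<noteq> {h, k}" by auto
  have yH: "p \<in> halves ?Y" "q \<in> halves ?Y" "h \<in> halves ?Z" "k \<in> halves ?Z"
    using e.halves_collapse f.halves_collapse e.halves_hk f.halves_hk p4 by auto
  have Y: "vertex_of ?Y p = ?V p" "vertex_of ?Y q = ?V q"
    using e.vertex_of_collapse yH apart by auto
  have Z: "vertex_of ?Z h = ?V h" "vertex_of ?Z k = ?V k"
    using f.vertex_of_collapse yH apart by auto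
  interpret ef: collapsible ?Y p q
    using e.wf_collapse f.edge e.edges_collapse Y f.nonloop dis by unfold_locales auto
  interpret fe: collapsible ?Z h k
    using f.wf_collapse e.edge f.edges_collapse Z e.nonloop dis by unfold_locales auto
  obtain L xs where L: "is_labelling ?X L" "{h, p} \<subseteq> initial L" "numbering L = [?V h, ?V k, ?V p, ?V q] @ xs"
  proof (rule labelling_exists[OF e.wf])
    show "{h, p} \<subseteq> halves ?X" using e.halves_hk f.halves_hk by simp
    show "compl_half ?X a \<notin> {h, p}" if "a \<in> {h, p}" for a using that e.hk f.hk p4 by auto
    show "distinct [?V h, ?V k, ?V p, ?V q]" "set [?V h, ?V k, ?V p, ?V q] \<subseteq> verts ?X"
      using apart e.nonloop f.nonloop e.verts_hk f.verts_hk by auto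
  qed
  define I where "I = initial L"
  have Leq: "L = \<lparr>numbering = ?V h # ?V k # ?V p # ?V q # xs, initial = I\<rparr>" using L(3) by (simp add: I_def)
  have I: "h \<in> I" "p \<in> I" "k \<notin> I" "q \<notin> I"
    using L(1,2) e.hk f.hk e.halves_hk f.halves_hk by (auto simp: is_labelling_iff[OF e.wf] I_def)
  note L1 = L(1)[unfolded Leq]
  note 1 = collapse_step[OF e refl L1 I(1,3)]
  note r1 = label_sign_rotate3[OF e.wf_collapse 1(2)]
  have u1: "ugraph (collapse {h, k} A) = ?Y" by (rule collapse_ograph(1)[OF e])
  have 2: "orient_sign (collapse {p, q} (collapse {h, k} A)) = orient_sign (collapse {h, k} A) *
      label_sign ?Y \<lparr>numbering = ?V p # ?V q # e.u # xs, initial = I - {h, k}\<rparr> *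
      label_sign (collapse_graph {p, q} ?Y) \<lparr>numbering = f.u # e.u # xs, initial = I - {h, k} - {p, q}\<rparr>"
    "is_labelling (collapse_graph {p, q} ?Y) \<lparr>numbering = f.u # e.u # xs, initial = I - {h, k} - {p, q}\<rparr>"
    using collapse_step[OF ef.collapsible_axioms u1, of "e.u # xs" "I - {h, k}"] r1(2) I p4 by (auto simp: Y)
  note r = label_sign_rotate4[OF e.wf L1]
  note 3 = collapse_step[OF f refl r(2) I(2,4)]
  note r3 = label_sign_rotate3[OF f.wf_collapse 3(2)]
  have u3: "ugraph (collapse {p, q} A) = ?Z" by (rule collapse_ograph(1)[OF f])
  have 4: "orient_sign (collapse {h, k} (collapse {p, q} A)) = orient_sign (collapse {p, q} A) *
      label_sign ?Z \<lparr>numbering = ?V h # ?V k # f.u # xs, initial = I - {p, q}\<rparr> *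
      label_sign (collapse_graph {h, k} ?Z) \<lparr>numbering = e.u # f.u # xs, initial = I - {p, q} - {h, k}\<rparr>"
    "is_labelling (collapse_graph {h, k} ?Z) \<lparr>numbering = e.u # f.u # xs, initial = I - {p, q} - {h, k}\<rparr>"
    using collapse_step[OF fe.collapsible_axioms u3, of "f.u # xs" "I - {p, q}"] r3(2) I p4 by (auto simp: Z)
  note s = label_sign_swap2[OF fe.wf_collapse 4(2)]
  have Ieq: "I - {h, k} - {p, q} = I - {p, q} - {h, k}" by auto
  have "verts (collapse_graph {p, q} ?Y) = verts (collapse_graph {h, k} ?Z)"
    using 2(2) s(2) by (simp add: is_labelling_def)
  then have geq: "collapse_graph {p, q} ?Y = collapse_graph {h, k} ?Z"
    by (auto simp: collapse_graph_def)
  have "orient_sign (collapse {p, q} (collapse {h, k} A)) = - orient_sign (collapse {h, k} (collapse {p, q} A))"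
    unfolding 2(1) 1(1) 4(1) 3(1) r(1) r1(1) r3(1) Ieq geq s(1)
    by (simp add: mult.assoc)
  then show ?thesis
    using collapse_ograph(1)[of "collapse {h, k} A" p q] collapse_ograph(1)[of "collapse {p, q} A" h k]
      u1 u3 ef.collapsible_axioms fe.collapsible_axioms geq
    by (simp add: opposed_def)
qed

text \<open>The assumption \<open>n\<close> says that the edges are not parallel, so they share one
  vertex or none. Which ends meet is immaterial, as each edge may be read in either
  direction.\<close>

lemma collapse_collapse:
  assumes e: "collapsible (ugraph A) h k" and f: "collapsible (ugraph A) p q" "{p, q} \<noteq> {h, k}"
    and n: "{vertex_of (ugraph A) p, vertex_of (ugraph A) q} \<noteq> {vertex_of (ugraph A) h, vertex_of (ugraph A) k}"
  shows "opposed (collapse {p, q} (collapse {h, k} A)) (collapse {h, k} (collapse {p, q} A))"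
proof -
  let ?V = "vertex_of (ugraph A)"
  interpret e: collapsible "ugraph A" h k by fact
  interpret f: collapsible "ugraph A" p q by fact
  note ef = e.edge f.edge e.nonloop f.nonloop
  have e': "collapsible (ugraph A) k h" and f': "{q, p} \<in> edges (ugraph A)" "{q, p} \<noteq> {h, k}" "{q, p} \<noteq> {k, h}"
      "{p, q} \<noteq> {k, h}"
    using collapsible_commute[OF e] f.edge f(2) by (auto simp: insert_commute)
  consider "{?V p, ?V q} \<inter> {?V h, ?V k} = {}"
    | "?V k = ?V p" "?V q \<notin> {?V h, ?V k}" | "?V h = ?V p" "?V q \<notin> {?V h, ?V k}"
    | "?V k = ?V q" "?V p \<notin> {?V h, ?V k}" | "?V h = ?V q" "?V p \<notin> {?V h, ?V k}"
    using n e.nonloop f.nonloop unfolding doubleton_eq_iff by auto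
  then show ?thesis
  proof cases
    case 1
    then show ?thesis by (rule collapse_collapse_apart[OF e f(1)])
  next
    case 2
    then show ?thesis by (rule collapse_collapse_adjacent[OF e f.edge f(2)])
  next
    case 3
    then show ?thesis using collapse_collapse_adjacent[OF e' f.edge f'(4)] by (auto simp: insert_commute)
  next
    case 4
    then show ?thesis using collapse_collapse_adjacent[OF e f'(1,2)] by (auto simp: insert_commute)
  next
    case 5
    then show ?thesis using collapse_collapse_adjacent[OF e' f'(1,3)] by (auto simp: insert_commute)
  qed
qed

lemma diff_union_diff: "C \<inter> B = {} \<Longrightarrow> (E - A) \<union> C - B = (E - B - A) \<union> C"
  by blast

text \<open>No sign appears: regluing keeps the numbering, and collapsing another edge keeps the
  arrows of the two cut edges, so one labelling serves both orders. The assumption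
  \<open>dis\<close> keeps the edge \<open>{p, q}\<close> apart from both cut edges.\<close>

lemma collapse_reglue:
  assumes g: "regluable (ugraph A) h k" and e: "collapsible (ugraph A) p q"
    and dis: "{h, k} \<inter> {p, q} = {}"
    and ne: "vertex_of (collapse_graph {p, q} (ugraph A)) h \<noteq> vertex_of (collapse_graph {p, q} (ugraph A)) k"
  shows "collapse {p, q} (reglue h k A) = reglue h k (collapse {p, q} A)"
proof -
  let ?X = "ugraph A" and ?V = "vertex_of (ugraph A)"
  let ?Y = "reglue_graph h k ?X" and ?Z = "collapse_graph {p, q} ?X"
  interpret g: regluable ?X h k by fact
  interpret e: collapsible ?X p q by fact
  have p4: "h \<noteq> p" "h \<noteq> q" "k \<noteq> p" "k \<noteq> q" using dis by auto
  have nb: "g.h' \<noteq> p" "g.h' \<noteq> q" "g.k' \<noteq> p" "g.k' \<noteq> q"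
    using e.hk g.distinct4 p4 by metis+
  have zH: "h \<in> halves ?Z" "k \<in> halves ?Z"
    using e.halves_collapse g.halves_hk p4 by auto
  then have nXV: "?V h \<noteq> ?V k" using ne e.vertex_of_collapse_eq_iff by blast
  have cz: "compl_half ?Z h = g.h'" "compl_half ?Z k = g.k'"
    using e.compl_collapse zH by auto
  interpret gz: regluable ?Z h k
    using e.wf_collapse zH g.distinct_hk cz by unfold_locales auto
  have edY: "{p, q} \<in> edges ?Y" "{p, q} \<noteq> {h, g.h'}" "{p, q} \<noteq> {k, g.k'}" "{p, q} \<noteq> {h, k}" "{p, q} \<noteq> {g.h', g.k'}"
  proof -
    show d: "{p, q} \<noteq> {h, g.h'}" "{p, q} \<noteq> {k, g.k'}" "{p, q} \<noteq> {h, k}" "{p, q} \<noteq> {g.h', g.k'}"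
      using p4 nb by (metis insertI1 insertE singletonD)+
    show "{p, q} \<in> edges ?Y" unfolding g.edges_reglue using e.edge d by blast
  qed
  interpret ey: collapsible ?Y p q
    using g.wf_reglue edY e.nonloop by unfold_locales auto
  have geq: "collapse_graph {p, q} ?Y = reglue_graph h k ?Z"
  proof -
    have "edges (collapse_graph {p, q} ?Y) = edges (reglue_graph h k ?Z)"
      unfolding ey.edges_collapse g.edges_reglue gz.edges_reglue e.edges_collapse cz
      using edY(4,5) by (intro diff_union_diff) auto
    then show ?thesis by (auto simp: collapse_graph_def reglue_graph_def)
  qed
  obtain L xs where L: "is_labelling ?X L" "{h, g.k', p} \<subseteq> initial L" "numbering L = [?V p, ?V q] @ xs"
  proof (rule labelling_exists[OF g.wf])
    show "{h, g.k', p} \<subseteq> halves ?X" using e.halves_hk g.halves_hk g.distinct4 by simp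
    show "compl_half ?X a \<notin> {h, g.k', p}" if "a \<in> {h, g.k', p}" for a
      using that e.hk p4 nb g.distinct4 g.distinct_hk by auto
    show "distinct [?V p, ?V q]" "set [?V p, ?V q] \<subseteq> verts ?X"
      using e.nonloop e.verts_hk by auto
  qed
  define I where "I = initial L"
  have Leq: "L = \<lparr>numbering = ?V p # ?V q # xs, initial = I\<rparr>" using L(3) by (simp add: I_def)
  have I: "h \<in> I" "p \<in> I" "k \<notin> I" "q \<notin> I"
    using L(1,2) e.hk e.halves_hk g.halves_hk g.distinct4 by (auto simp: is_labelling_iff[OF e.wf] I_def)
  note L1 = L(1)[unfolded Leq]
  have uY: "ugraph (reglue h k A) = ?Y" by (rule reglue_ograph(1)[OF g nXV])
  have uZ: "ugraph (collapse {p, q} A) = ?Z" by (rule collapse_ograph(1)[OF e])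
  have 1: "orient_sign (reglue h k A) = orient_sign A * label_sign ?X L * label_sign ?Y L"
    by (rule reglue_ograph(2)[OF g nXV L(1)]) (use I in \<open>auto simp: I_def\<close>)
  have LY: "is_labelling ?Y L" by (rule g.is_labelling_reglue[OF L(1)]) (use I in \<open>auto simp: I_def\<close>)
  have 2: "orient_sign (collapse {p, q} (reglue h k A)) = orient_sign (reglue h k A) * label_sign ?Y L *
     label_sign (collapse_graph {p, q} ?Y) \<lparr>numbering = e.u # xs, initial = I - {p, q}\<rparr>"
    using collapse_step(1)[OF ey.collapsible_axioms uY, of xs I] LY I unfolding Leq by simp
  note 3 = collapse_step[OF e refl L1 I(2,4)]
  have 4: "orient_sign (reglue h k (collapse {p, q} A)) = orient_sign (collapse {p, q} A) *
     label_sign ?Z \<lparr>numbering = e.u # xs, initial = I - {p, q}\<rparr> *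
     label_sign (reglue_graph h k ?Z) \<lparr>numbering = e.u # xs, initial = I - {p, q}\<rparr>"
    using reglue_ograph(2)[of "collapse {p, q} A" h k, unfolded uZ, OF gz.regluable_axioms ne 3(2)] I p4 by simp
  show ?thesis
  proof (rule ograph_eqI)
    show "ugraph (collapse {p, q} (reglue h k A)) = ugraph (reglue h k (collapse {p, q} A))"
      using collapse_ograph(1)[of "reglue h k A" p q] reglue_ograph(1)[of "collapse {p, q} A" h k]
        uY uZ ey.collapsible_axioms gz.regluable_axioms ne geq by simp
    show "orient_sign (collapse {p, q} (reglue h k A)) = orient_sign (reglue h k (collapse {p, q} A))"
      unfolding 2 1 4 3(1) geq Leq by (simp add: mult.assoc)
  qed
qed

section \<open>Symmetries of regluing and the interchange of two regluings\<close>

lemma graph_eqI: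
  assumes "wf_graph X" "wf_graph Y" "verts X = verts Y" "halves X = halves Y"
    "\<And>x. x \<in> halves X \<Longrightarrow> compl_half X x = compl_half Y x"
  shows "X = Y"
  using assms edges_compl[OF assms(1)] edges_compl[OF assms(2)] by (simp cong: image_cong)

text \<open>A formula free of labellings, from which the symmetries in \<open>h\<close>,
  \<open>k\<close> and their complements can be read off.\<close>

lemma reglue_orient_sign:
  assumes "regluable (ugraph A) h k" "vertex_of (ugraph A) h \<noteq> vertex_of (ugraph A) k"
  defines "c \<equiv> compl_half (ugraph A)"
  shows "orient_sign (reglue h k A) = orient_sign A *
    (pair_sign h (c h) * pair_sign (c k) k * (pair_sign h k * pair_sign (c k) (c h)))"
proof -
  interpret regluable "ugraph A" h k by fact
  obtain L where L: "is_labelling (ugraph A) L" "h \<in> initial L" "k \<notin> initial L"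
    using exists_reglue_labelling[OF assms(2) refl] by blast
  show ?thesis
    using reglue_ograph(2)[OF assms(1,2) L] reglue_sign[OF L] by (simp add: c_def mult.assoc)
qed

lemma regluable_commute: "regluable X h k \<Longrightarrow> regluable X k h"
  unfolding regluable_def using compl_half_props(4) by metis

lemma regluable_compl: "regluable X h k \<Longrightarrow> regluable X (compl_half X h) (compl_half X k)"
  unfolding regluable_def using compl_half_props(2,4) by metis

text \<open>Exchanging \<open>h\<close> and \<open>k\<close> flips each of the four factors in
  \<open>reglue_orient_sign\<close>.\<close>

lemma reglue_commute:
  assumes "regluable (ugraph A) h k" "vertex_of (ugraph A) h \<noteq> vertex_of (ugraph A) k"
  shows "reglue h k A = reglue k h A"
proof (rule ograph_eqI)
  interpret regluable "ugraph A" h k by fact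
  note c = regluable_commute[OF assms(1)] assms(2)[symmetric]
  show "ugraph (reglue h k A) = ugraph (reglue k h A)"
    unfolding reglue_ograph(1)[OF assms] reglue_ograph(1)[OF c]
    by (simp add: reglue_graph_def insert_commute)
  show "orient_sign (reglue h k A) = orient_sign (reglue k h A)"
    unfolding reglue_orient_sign[OF assms] reglue_orient_sign[OF c]
    using distinct4 distinct_hk pair_sign_swap[of h h'] pair_sign_swap[of k k'] pair_sign_swap[of h k] pair_sign_swap[of h' k']
    by simp
qed

text \<open>Both sides cut the same two edges and form the same two new ones, so only the signs need
  an argument.\<close>

lemma reglue_compl:
  assumes "regluable (ugraph A) h k" "vertex_of (ugraph A) h \<noteq> vertex_of (ugraph A) k"
    and "vertex_of (ugraph A) (compl_half (ugraph A) h) \<noteq> vertex_of (ugraph A) (compl_half (ugraph A) k)"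
  shows "reglue (compl_half (ugraph A) h) (compl_half (ugraph A) k) A = reglue h k A"
proof -
  interpret regluable "ugraph A" h k by fact
  note c = regluable_commute[OF regluable_compl[OF assms(1)]] assms(3)[symmetric]
  interpret c: regluable "ugraph A" "k'" "h'" by (rule c)
  \<comment> \<open>In the order \<open>k'\<close>, \<open>h'\<close> the four factors of the sign
    are permuted and none is flipped; \<open>reglue_commute\<close> then restores the order.\<close>
  have "reglue k' h' A = reglue h k A"
  proof (rule ograph_eqI)
    show "ugraph (reglue k' h' A) = ugraph (reglue h k A)"
      unfolding reglue_ograph(1)[OF assms(1,2)] reglue_ograph(1)[OF c]
      by (rule graph_eqI[OF c.wf_reglue wf_reglue])
        (use distinct4 edges_reglue c.edges_reglue in \<open>auto simp: insert_commute intro: arg_cong2[of _ _ _ _ compl_half]\<close>)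
    show "orient_sign (reglue k' h' A) = orient_sign (reglue h k A)"
      unfolding reglue_orient_sign[OF assms(1,2)] reglue_orient_sign[OF c]
      using distinct4 by (simp add: mult_ac)
  qed
  then show ?thesis using reglue_commute[OF c] by simp
qed

text \<open>The common labelling has \<open>h\<close> and \<open>p\<close> initial and
  \<open>k\<close> and \<open>q\<close> terminal, which \<open>dis\<close> makes consistent. The two
  pairs may still share an edge, through \<open>g.k' = p\<close> or \<open>g.h' = q\<close>; then
  three edges are recombined instead of four.\<close>

lemma reglue_reglue:
  assumes g: "regluable (ugraph A) h k" "vertex_of (ugraph A) h \<noteq> vertex_of (ugraph A) k"
    and f: "regluable (ugraph A) p q" "vertex_of (ugraph A) p \<noteq> vertex_of (ugraph A) q"
    and dis: "{h, k} \<inter> {p, q} = {}" "compl_half (ugraph A) h \<noteq> p" "compl_half (ugraph A) k \<noteq> q"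
    and gf: "regluable (reglue_graph h k (ugraph A)) p q" and fg: "regluable (reglue_graph p q (ugraph A)) h k"
  shows "reglue p q (reglue h k A) = reglue h k (reglue p q A)"
proof -
  let ?X = "ugraph A" and ?V = "vertex_of (ugraph A)"
  let ?Y = "reglue_graph h k ?X" and ?Z = "reglue_graph p q ?X"
  interpret g: regluable ?X h k by fact
  interpret f: regluable ?X p q by fact
  interpret gf: regluable ?Y p q by fact
  interpret fg: regluable ?Z h k by fact
  have p4: "h \<noteq> p" "h \<noteq> q" "k \<noteq> p" "k \<noteq> q" using dis by auto
  have d: "g.h' \<noteq> p" "g.k' \<noteq> q" "f.h' \<noteq> h" "f.k' \<noteq> k"
    using dis f.distinct4 g.distinct4 by auto
  have ne: "f.h' \<noteq> g.h'" "f.h' \<noteq> g.k'" "f.k' \<noteq> g.h'" "f.k' \<noteq> g.k'" "g.h' \<noteq> f.k'" "g.k' \<noteq> f.h'"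
    using p4 g.distinct4 f.distinct4 by metis+
  have uY: "ugraph (reglue h k A) = ?Y" and uZ: "ugraph (reglue p q A) = ?Z"
    using reglue_ograph(1)[OF g] reglue_ograph(1)[OF f] by auto
  obtain L xs where L: "is_labelling ?X L" "{h, g.k', p, f.k'} \<subseteq> initial L" "numbering L = [] @ xs"
  proof (rule labelling_exists[OF g.wf])
    show "{h, g.k', p, f.k'} \<subseteq> halves ?X" using g.halves_hk f.halves_hk g.distinct4 f.distinct4 by simp
    show "compl_half ?X a \<notin> {h, g.k', p, f.k'}" if "a \<in> {h, g.k', p, f.k'}" for a
      using that g.distinct4 f.distinct4 g.distinct_hk f.distinct_hk p4 d ne
      by (elim insertE emptyE) simp_all
    show "distinct ([] :: nat set list)" "set [] \<subseteq> verts ?X" by auto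
  qed
  have I: "h \<in> initial L" "p \<in> initial L" "k \<notin> initial L" "q \<notin> initial L"
    using L(1,2) g.halves_hk f.halves_hk g.distinct4 f.distinct4 by (auto simp: is_labelling_iff[OF g.wf])
  have geq: "reglue_graph p q ?Y = reglue_graph h k ?Z"
  proof (rule graph_eqI[OF gf.wf_reglue fg.wf_reglue])
    fix x assume "x \<in> halves (reglue_graph p q ?Y)"
    then have x: "x \<in> halves ?X" by simp
    have iff: "f.h' = k \<longleftrightarrow> g.k' = p" "f.k' = h \<longleftrightarrow> g.h' = q"
      using g.distinct4 f.distinct4 by metis+
    \<comment> \<open>If both held, \<open>{p, q}\<close> would be a new edge of \<open>?Y\<close>,
      against the regluability of \<open>p\<close> and \<open>q\<close> there.\<close>
    have "\<not> (g.k' = p \<and> g.h' = q)"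
      using gf.distinct_hk(2) g.compl_reglue by auto
    then consider "g.k' = p" "g.h' \<noteq> q" | "g.h' = q" "g.k' \<noteq> p" | "g.h' \<noteq> q" "g.k' \<noteq> p"
      by blast
    then show "compl_half (reglue_graph p q ?Y) x = compl_half (reglue_graph h k ?Z) x"
      unfolding gf.compl_reglue_if[OF x[folded g.halves_reglue]] fg.compl_reglue_if[OF x[folded f.halves_reglue]]
        g.compl_reglue_if[OF x] g.compl_reglue_if[OF f.halves_hk(1)] g.compl_reglue_if[OF f.halves_hk(2)]
        f.compl_reglue_if[OF x] f.compl_reglue_if[OF g.halves_hk(1)] f.compl_reglue_if[OF g.halves_hk(2)]
      using p4 d ne iff g.distinct4 f.distinct4 g.distinct_hk f.distinct_hk
      by cases simp_all
  qed auto
  have 1: "orient_sign (reglue h k A) = orient_sign A * label_sign ?X L * label_sign ?Y L"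
    by (rule reglue_ograph(2)[OF g L(1) I(1,3)])
  have 2: "orient_sign (reglue p q (reglue h k A)) = orient_sign (reglue h k A) * label_sign ?Y L *
      label_sign (reglue_graph p q ?Y) L"
    using reglue_ograph(2)[of "reglue h k A" p q, unfolded uY, OF gf _ g.is_labelling_reglue[OF L(1) I(1,3)] I(2,4)] f
    by simp
  have 3: "orient_sign (reglue p q A) = orient_sign A * label_sign ?X L * label_sign ?Z L"
    by (rule reglue_ograph(2)[OF f L(1) I(2,4)])
  have 4: "orient_sign (reglue h k (reglue p q A)) = orient_sign (reglue p q A) * label_sign ?Z L *
      label_sign (reglue_graph h k ?Z) L"
    using reglue_ograph(2)[of "reglue p q A" h k, unfolded uZ, OF fg _ f.is_labelling_reglue[OF L(1) I(2,4)] I(1,3)] g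
    by simp
  show ?thesis
  proof (rule ograph_eqI)
    show "ugraph (reglue p q (reglue h k A)) = ugraph (reglue h k (reglue p q A))"
      using reglue_ograph(1)[of "reglue h k A" p q] reglue_ograph(1)[of "reglue p q A" h k] uY uZ g f gf fg geq
      by simp
    show "orient_sign (reglue p q (reglue h k A)) = orient_sign (reglue h k (reglue p q A))"
      unfolding 2 1 4 3 geq by (simp add: mult.assoc)
  qed
qed

section \<open>Pairs of contractions\<close>

definition nonloops :: "hgraph \<Rightarrow> nat set set" where
  "nonloops X = {e \<in> edges X. \<not> is_loop X e}"

text \<open>Pairs at a common vertex are omitted because \<open>contract_pair\<close> is zero on
  them.\<close>

definition half_pairs :: "hgraph \<Rightarrow> (nat \<times> nat) set" where
  "half_pairs X = {(h, k). regluable X h k \<and> vertex_of X h \<noteq> vertex_of X k}"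

text \<open>An oriented graph rather than its class, so that the operation can be iterated; on
  \<open>half_pairs\<close> its class is \<open>contract_pair\<close>.\<close>

definition contract :: "nat \<Rightarrow> nat \<Rightarrow> ograph \<Rightarrow> ograph" where
  "contract h k A = collapse {h, k} (reglue h k A)"

lemma nonloops_iff: "wf_graph X \<Longrightarrow> {p, q} \<in> nonloops X \<longleftrightarrow> collapsible X p q"
  using is_loop_iff by (auto simp: nonloops_def collapsible_def)

lemma nonloopsE:
  assumes "wf_graph X" "e \<in> nonloops X"
  obtains p q where "e = {p, q}" "collapsible X p q"
proof -
  from assms have "e \<in> edges X" by (simp add: nonloops_def)
  with edge_cases[OF assms(1)] that assms nonloops_iff[OF assms(1)] show ?thesis by metis
qed

lemma half_pairs_iff:
  assumes "wf_graph X" "p \<in> halves X" "q \<in> halves X"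
  shows "(p, q) \<in> half_pairs X \<longleftrightarrow> q \<noteq> compl_half X p \<and> vertex_of X p \<noteq> vertex_of X q"
  using assms by (auto simp: half_pairs_def regluable_def)

lemma half_pairs_halves: "(p, q) \<in> half_pairs X \<Longrightarrow> p \<in> halves X \<and> q \<in> halves X"
  by (auto simp: half_pairs_def regluable_def)

section \<open>Admissibility of a second operation\<close>

lemma collapsible_iff: "wf_graph X \<Longrightarrow> {p, q} \<in> edges X \<Longrightarrow> collapsible X p q \<longleftrightarrow> vertex_of X p \<noteq> vertex_of X q"
  by (simp add: collapsible_def)

lemma collapsible_edge: "collapsible X p q \<Longrightarrow> {p, q} \<in> edges X"
  by (simp add: collapsible_def)

lemma (in collapsible) vertex_of_collapse_ne_iff:
  assumes "x \<in> halves Y" "y \<in> halves Y"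
  shows "vertex_of Y x \<noteq> vertex_of Y y \<longleftrightarrow> vertex_of X x \<noteq> vertex_of X y \<and>
    {vertex_of X x, vertex_of X y} \<noteq> {vertex_of X h, vertex_of X k}"
proof -
  have "a \<noteq> b \<Longrightarrow> c \<noteq> d \<Longrightarrow> {a, b} \<subseteq> {c, d} \<longleftrightarrow> {a, b} = {c, d}" for a b c d :: "nat set"
    by auto
  then show ?thesis unfolding vertex_of_collapse_eq_iff[OF assms] using nonloop by metis
qed

text \<open>Both conditions that link \<open>{p, q}\<close> with \<open>{h, k}\<close> are symmetric
  in the two sets; this is what allows exchanging the order of a collapse and a contraction.\<close>

lemma (in collapsible) half_pairs_collapse_iff:
  "(p, q) \<in> half_pairs Y \<longleftrightarrow> (p, q) \<in> half_pairs X \<and> {p, q} \<inter> {h, k} = {} \<and>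
     {vertex_of X p, vertex_of X q} \<noteq> {vertex_of X h, vertex_of X k}"
proof (cases "p \<in> halves Y \<and> q \<in> halves Y")
  case True
  then have Y: "p \<in> halves Y" "q \<in> halves Y" and X: "p \<in> halves X" "q \<in> halves X" and d: "{p, q} \<inter> {h, k} = {}"
    by (auto simp: halves_collapse)
  show ?thesis
    unfolding half_pairs_iff[OF wf_collapse Y] half_pairs_iff[OF wf X] vertex_of_collapse_ne_iff[OF Y]
      compl_collapse[OF Y(1)] using d by metis
next
  case False
  then have "p \<in> halves X \<Longrightarrow> q \<in> halves X \<Longrightarrow> {p, q} \<inter> {h, k} \<noteq> {}" by (auto simp: halves_collapse)
  then show ?thesis using half_pairs_halves False by metis
qed

lemma (in collapsible) collapsible_collapse_iff:
  "collapsible Y p q \<longleftrightarrow> collapsible X p q \<and> {p, q} \<noteq> {h, k} \<and>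
     {vertex_of X p, vertex_of X q} \<noteq> {vertex_of X h, vertex_of X k}"
proof (cases "{p, q} \<in> edges Y")
  case True
  then have 1: "{p, q} \<in> edges X" "{p, q} \<noteq> {h, k}" "p \<in> halves Y" "q \<in> halves Y"
    by (auto simp: edges_collapse halves_def)
  show ?thesis
    unfolding collapsible_iff[OF wf 1(1)] collapsible_iff[OF wf_collapse True] vertex_of_collapse_ne_iff[OF 1(3,4)]
    using 1(2) by metis
next
  case False
  then have "{p, q} \<in> edges X \<Longrightarrow> {p, q} = {h, k}" by (auto simp: edges_collapse)
  then show ?thesis using collapsible_edge False by metis
qed

locale contractible = regluable +
  assumes apart: "vertex_of X h \<noteq> vertex_of X k"
begin

sublocale c: collapsible Y h k
  using wf_reglue apart by unfold_locales (auto simp: edges_reglue)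

abbreviation "Z \<equiv> collapse_graph {h, k} Y"

text \<open>The pair \<open>{h', k'}\<close> is excluded because these half-edges have become
  complementary.\<close>

lemma half_pairs_contract_iff:
  "(p, q) \<in> half_pairs Z \<longleftrightarrow> (p, q) \<in> half_pairs X \<and> {p, q} \<inter> {h, k} = {} \<and> {p, q} \<noteq> {h', k'} \<and>
     {vertex_of X p, vertex_of X q} \<noteq> {vertex_of X h, vertex_of X k}"
proof (cases "p \<in> halves X \<and> q \<in> halves X \<and> {p, q} \<inter> {h, k} = {}")
  case True
  then have X: "p \<in> halves X" "q \<in> halves X" and Y: "p \<in> halves Y" "q \<in> halves Y" and d: "{p, q} \<inter> {h, k} = {}"
    by auto
  have n: "p \<noteq> h" "p \<noteq> k" "q \<noteq> h" "q \<noteq> k" using d by auto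
  have "q \<noteq> compl_half Y p \<longleftrightarrow> q \<noteq> compl_half X p \<and> {p, q} \<noteq> {h', k'}" if "p \<noteq> q"
  proof -
    consider "p = h'" | "p = k'" "p \<noteq> h'" | "p \<noteq> h'" "p \<noteq> k'" by blast
    then show ?thesis
      unfolding compl_reglue_if[OF X(1)] doubleton_eq_iff using n distinct4 by cases simp_all
  qed
  then show ?thesis
    unfolding c.half_pairs_collapse_iff half_pairs_iff[OF wf_reglue Y] half_pairs_iff[OF wf X]
      vertex_of_reglue using d by metis
next
  case False
  then show ?thesis
    unfolding c.half_pairs_collapse_iff using half_pairs_halves halves_reglue by metis
qed

text \<open>For an old edge, meeting \<open>{h, k}\<close> means being one of the two cut
  edges.\<close>

lemma collapsible_contract_iff:
  assumes "{p, q} \<in> edges X"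
  shows "collapsible Z p q \<longleftrightarrow> collapsible X p q \<and> {p, q} \<inter> {h, k} = {} \<and>
     {vertex_of X p, vertex_of X q} \<noteq> {vertex_of X h, vertex_of X k}"
proof -
  have "{h, h'} \<in> edges X" "{k, k'} \<in> edges X"
    using compl_half_props(1)[OF wf] halves_hk by auto
  then have 1: "{p, q} \<inter> {h, k} = {} \<longleftrightarrow> {p, q} \<noteq> {h, h'} \<and> {p, q} \<noteq> {k, k'}"
    using wf_edges_eq[OF wf assms] by blast
  have "compl_half X p = q" by (rule compl_half_eq(1)[OF wf assms])
  then have 2: "{p, q} \<noteq> {h, k}" "{p, q} \<noteq> {h', k'}"
    unfolding doubleton_eq_iff using distinct4 distinct_hk by metis+
  then have "{p, q} \<in> edges Y \<longleftrightarrow> {p, q} \<noteq> {h, h'} \<and> {p, q} \<noteq> {k, k'}"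
    unfolding edges_reglue using assms by blast
  then have "collapsible Y p q \<longleftrightarrow> collapsible X p q \<and> {p, q} \<noteq> {h, h'} \<and> {p, q} \<noteq> {k, k'}"
    using assms wf wf_reglue by (simp only: collapsible_def vertex_of_reglue) blast
  then show ?thesis
    unfolding c.collapsible_collapse_iff 1 vertex_of_reglue using 2(1) by metis
qed

text \<open>The case of the one new edge that survives the contraction.\<close>

lemma collapsible_compl_iff:
  "collapsible Z h' k' \<longleftrightarrow> vertex_of X h' \<noteq> vertex_of X k' \<and>
     {vertex_of X h', vertex_of X k'} \<noteq> {vertex_of X h, vertex_of X k}"
proof -
  have "{h', k'} \<in> edges Y" by (simp add: edges_reglue)
  moreover have "{h', k'} \<noteq> {h, k}" unfolding doubleton_eq_iff using distinct4 by metis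
  ultimately show ?thesis
    unfolding c.collapsible_collapse_iff using wf_reglue by (simp only: collapsible_def vertex_of_reglue) metis
qed

end

lemma half_pairs_contractible: "(h, k) \<in> half_pairs X \<longleftrightarrow> contractible X h k"
  by (auto simp: half_pairs_def contractible_def contractible_axioms_def)

lemma ugraph_contract:
  assumes "contractible (ugraph A) h k"
  shows "ugraph (contract h k A) = collapse_graph {h, k} (reglue_graph h k (ugraph A))"
proof -
  interpret contractible "ugraph A" h k by fact
  show ?thesis
    using collapse_ograph(1)[of "reglue h k A" h k] reglue_ograph(1)[OF regluable_axioms apart] c.collapsible_axioms
    by (simp add: contract_def)
qed

section \<open>Interchange of two operations\<close>

lemma contractible_commute: "contractible X h k \<Longrightarrow> contractible X k h"
  using regluable_commute[of X h k] by (auto simp: contractible_def contractible_axioms_def)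

lemma contract_commute:
  assumes "contractible (ugraph A) h k"
  shows "contract h k A = contract k h A"
proof -
  interpret contractible "ugraph A" h k by fact
  show ?thesis
    using reglue_commute[OF regluable_axioms apart] by (simp add: contract_def insert_commute)
qed

text \<open>The one condition that is not visibly symmetric is
  \<open>{p, q} \<noteq> {h', k'}\<close>; applying the complement map to both sides turns it into
  the condition for the exchanged pairs.\<close>

lemma half_pairs_contract_sym:
  assumes g: "contractible X h k" and f: "(p, q) \<in> half_pairs (collapse_graph {h, k} (reglue_graph h k X))"
  shows "contractible X p q" "(h, k) \<in> half_pairs (collapse_graph {p, q} (reglue_graph p q X))"
proof -
  interpret g: contractible X h k by fact
  note f' = f[unfolded g.half_pairs_contract_iff]
  then show c: "contractible X p q" by (simp add: half_pairs_contractible)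
  then interpret f: contractible X p q .
  have "{h, k} \<noteq> {f.h', f.k'}"
  proof
    assume "{h, k} = {f.h', f.k'}"
    then have "compl_half X ` {h, k} = compl_half X ` {f.h', f.k'}" by (rule arg_cong)
    then show False using f' f.distinct4 by simp
  qed
  moreover have "{h, k} \<inter> {p, q} = {}" using f' by auto
  ultimately show "(h, k) \<in> half_pairs f.Z"
    unfolding f.half_pairs_contract_iff using f' g half_pairs_contractible by metis
qed

text \<open>
  The last two assumptions allow a labelling in which \<open>h\<close> and \<open>p\<close> are initial and \<open>k\<close> and \<open>q\<close> are
  terminal; if they fail, they hold after exchanging \<open>p\<close> and \<open>q\<close>.
\<close>

lemma contract_contract_aux:
  assumes g: "contractible (ugraph A) h k" and f: "(p, q) \<in> half_pairs (ugraph (contract h k A))"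
    and d: "compl_half (ugraph A) h \<noteq> p" "compl_half (ugraph A) k \<noteq> q"
  shows "opposed (contract p q (contract h k A)) (contract h k (contract p q A))"
proof -
  interpret g: contractible "ugraph A" h k by fact
  note f' = f[unfolded ugraph_contract[OF g] g.half_pairs_contract_iff]
  then interpret f: contractible "ugraph A" p q by (simp add: half_pairs_contractible)
  have dis: "{h, k} \<inter> {p, q} = {}" using f' by auto
  have f2: "(h, k) \<in> half_pairs f.Z"
    using half_pairs_contract_sym(2)[OF g f[unfolded ugraph_contract[OF g]]] .
  interpret gf: contractible g.Z p q
    using f by (simp add: half_pairs_contractible ugraph_contract[OF g])
  interpret fg: contractible f.Z h k
    using f2 by (simp add: half_pairs_contractible)
  have r1: "contractible g.Y p q" and r2: "contractible f.Y h k"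
    using f f2 unfolding ugraph_contract[OF g] g.c.half_pairs_collapse_iff f.c.half_pairs_collapse_iff
    by (auto simp: half_pairs_contractible)
  interpret r1: contractible g.Y p q by (rule r1)
  interpret r2: contractible f.Y h k by (rule r2)
  have u1: "ugraph (reglue h k A) = g.Y" and u2: "ugraph (reglue p q A) = f.Y"
    using reglue_ograph(1) g.regluable_axioms g.apart f.regluable_axioms f.apart by auto
  \<comment> \<open>Both regluings are moved in front of both collapses. What remains is the
    interchange of the regluings, without a sign, and that of the collapses, with one.\<close>
  have b1: "contract p q (contract h k A) = collapse {p, q} (collapse {h, k} (reglue p q (reglue h k A)))"
    using collapse_reglue[of "reglue h k A" p q h k, unfolded u1, OF r1.regluable_axioms g.c.collapsible_axioms _ gf.apart]
      dis by (auto simp: contract_def)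
  have b2: "contract h k (contract p q A) = collapse {h, k} (collapse {p, q} (reglue h k (reglue p q A)))"
    using collapse_reglue[of "reglue p q A" h k p q, unfolded u2, OF r2.regluable_axioms f.c.collapsible_axioms _ fg.apart]
      dis by (auto simp: contract_def)
  have a: "reglue p q (reglue h k A) = reglue h k (reglue p q A)"
    by (rule reglue_reglue[OF g.regluable_axioms g.apart f.regluable_axioms f.apart dis d
          r1.regluable_axioms r2.regluable_axioms])
  let ?B = "reglue h k (reglue p q A)"
  have uB: "ugraph ?B = reglue_graph h k f.Y" "ugraph ?B = reglue_graph p q g.Y"
    using reglue_ograph(1)[of "reglue p q A" h k] reglue_ograph(1)[of "reglue h k A" p q] u1 u2 a
      r1.regluable_axioms r2.regluable_axioms r1.apart r2.apart by auto
  have "opposed (collapse {p, q} (collapse {h, k} ?B)) (collapse {h, k} (collapse {p, q} ?B))"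
  proof (rule collapse_collapse)
    show "collapsible (ugraph ?B) h k" unfolding uB(1) by (rule r2.c.collapsible_axioms)
    show "collapsible (ugraph ?B) p q" unfolding uB(2) by (rule r1.c.collapsible_axioms)
    show "{p, q} \<noteq> {h, k}" using dis by auto
    show "{vertex_of (ugraph ?B) p, vertex_of (ugraph ?B) q} \<noteq> {vertex_of (ugraph ?B) h, vertex_of (ugraph ?B) k}"
      unfolding uB(1) using f' by simp
  qed
  then show ?thesis unfolding b1 b2 a .
qed

lemma contract_contract:
  assumes g: "contractible (ugraph A) h k" and f: "(p, q) \<in> half_pairs (ugraph (contract h k A))"
  shows "(p, q) \<in> half_pairs (ugraph A)" "(h, k) \<in> half_pairs (ugraph (contract p q A))"
    "opposed (contract p q (contract h k A)) (contract h k (contract p q A))"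
proof -
  interpret g: contractible "ugraph A" h k by fact
  note f' = f[unfolded ugraph_contract[OF g] g.half_pairs_contract_iff]
  then interpret f: contractible "ugraph A" p q by (simp add: half_pairs_contractible)
  show "(p, q) \<in> half_pairs (ugraph A)" using f' by simp
  show "(h, k) \<in> half_pairs (ugraph (contract p q A))"
    unfolding ugraph_contract[OF f.contractible_axioms]
    using half_pairs_contract_sym(2)[OF g f[unfolded ugraph_contract[OF g]]] .
  show "opposed (contract p q (contract h k A)) (contract h k (contract p q A))"
  proof (cases "g.h' \<noteq> p \<and> g.k' \<noteq> q")
    case True
    then show ?thesis using contract_contract_aux[OF g f] by blast
  next
    case False
    have f2: "(q, p) \<in> half_pairs (ugraph (contract h k A))"
      using f contractible_commute by (simp add: half_pairs_contractible)
    have "{p, q} \<noteq> {g.h', g.k'}" "{p, q} \<inter> {h, k} = {}" using f' by auto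
    \<comment> \<open>Since \<open>p\<close> and \<open>q\<close> differ, and so do the complements
      of \<open>h\<close> and \<open>k\<close>, one bad coincidence rules out both coincidences for
      the exchanged pair.\<close>
    then have "g.h' \<noteq> q \<and> g.k' \<noteq> p"
      using False f.distinct4 g.distinct4 f.distinct_hk unfolding doubleton_eq_iff by metis
    then have "opposed (contract q p (contract h k A)) (contract h k (contract q p A))"
      using contract_contract_aux[OF g f2] by blast
    moreover have "contract q p (contract h k A) = contract p q (contract h k A)"
      by (rule contract_commute[symmetric]) (use f in \<open>simp add: half_pairs_contractible\<close>)
    moreover have "contract q p A = contract p q A"
      by (rule contract_commute[symmetric]) (rule f.contractible_axioms)
    ultimately show ?thesis by simp
  qed
qed

text \<open>The regluing passes the collapse of an old edge without a sign; the minus sign comes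
  from exchanging the collapses of \<open>{p, q}\<close> and \<open>{h, k}\<close> in the reglued
  graph.\<close>

lemma collapse_contract:
  assumes g: "contractible (ugraph A) h k" and f: "{p, q} \<in> edges (ugraph A)" "collapsible (ugraph (contract h k A)) p q"
  shows "opposed (collapse {p, q} (contract h k A)) (contract h k (collapse {p, q} A))"
proof -
  interpret g: contractible "ugraph A" h k by fact
  note f' = f(2)[unfolded ugraph_contract[OF g] g.collapsible_contract_iff[OF f(1)]]
  interpret f: collapsible "ugraph A" p q using f' by simp
  have dis: "{h, k} \<inter> {p, q} = {}" using f' by auto
  have "(h, k) \<in> half_pairs (collapse_graph {p, q} (ugraph A))"
    unfolding f.half_pairs_collapse_iff using f' g by (auto simp: half_pairs_contractible)
  then interpret r: contractible "collapse_graph {p, q} (ugraph A)" h k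
    by (simp add: half_pairs_contractible)
  have u1: "ugraph (reglue h k A) = g.Y"
    using reglue_ograph(1)[OF g.regluable_axioms g.apart] .
  have b: "collapse {p, q} (reglue h k A) = reglue h k (collapse {p, q} A)"
    by (rule collapse_reglue[OF g.regluable_axioms f.collapsible_axioms dis r.apart])
  have "opposed (collapse {p, q} (collapse {h, k} (reglue h k A))) (collapse {h, k} (collapse {p, q} (reglue h k A)))"
  proof (rule collapse_collapse)
    show "collapsible (ugraph (reglue h k A)) h k" unfolding u1 by (rule g.c.collapsible_axioms)
    have "collapsible g.Y p q"
      using f(2) unfolding ugraph_contract[OF g] g.c.collapsible_collapse_iff by blast
    then show "collapsible (ugraph (reglue h k A)) p q" unfolding u1 .
    show "{p, q} \<noteq> {h, k}" using dis by auto
    show "{vertex_of (ugraph (reglue h k A)) p, vertex_of (ugraph (reglue h k A)) q} \<noteq>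
        {vertex_of (ugraph (reglue h k A)) h, vertex_of (ugraph (reglue h k A)) k}"
      unfolding u1 using f' by simp
  qed
  then show ?thesis unfolding b contract_def .
qed

text \<open>By \<open>reglue_compl\<close> both pairs lead to the same oriented reglued graph; the
  two terms collapse its two new edges in opposite orders.\<close>

lemma collapse_contract_compl:
  fixes A
  defines "c \<equiv> compl_half (ugraph A)"
  assumes g: "contractible (ugraph A) h k" and f: "collapsible (ugraph (contract h k A)) (c h) (c k)"
  shows "contractible (ugraph A) (c h) (c k)" "collapsible (ugraph (contract (c h) (c k) A)) h k"
    "opposed (collapse {c h, c k} (contract h k A)) (collapse {h, k} (contract (c h) (c k) A))"
proof -
  interpret g: contractible "ugraph A" h k by fact
  note f' = f[unfolded ugraph_contract[OF g] c_def g.collapsible_compl_iff]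
  show ct: "contractible (ugraph A) (c h) (c k)"
    using regluable_compl[OF g.regluable_axioms] f'
    by (simp add: contractible_def contractible_axioms_def c_def)
  then interpret f: contractible "ugraph A" g.h' g.k' by (simp add: c_def)
  have u1: "ugraph (reglue h k A) = g.Y"
    using reglue_ograph(1)[OF g.regluable_axioms g.apart] .
  show "collapsible (ugraph (contract (c h) (c k) A)) h k"
    unfolding ugraph_contract[OF ct] unfolding c_def
    using f.collapsible_compl_iff g.distinct4(5,6) g.apart f' by metis
  have r: "reglue g.h' g.k' A = reglue h k A"
    by (rule reglue_compl[OF g.regluable_axioms g.apart f.apart])
  then have u2: "ugraph (reglue h k A) = f.Y"
    using reglue_ograph(1)[OF f.regluable_axioms f.apart] by simp
  have "opposed (collapse {g.h', g.k'} (collapse {h, k} (reglue h k A)))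
      (collapse {h, k} (collapse {g.h', g.k'} (reglue h k A)))"
  proof (rule collapse_collapse)
    show "collapsible (ugraph (reglue h k A)) h k" unfolding u1 by (rule g.c.collapsible_axioms)
    show "collapsible (ugraph (reglue h k A)) g.h' g.k'" unfolding u2 by (rule f.c.collapsible_axioms)
    show "{g.h', g.k'} \<noteq> {h, k}" using g.distinct4 by auto
    show "{vertex_of (ugraph (reglue h k A)) g.h', vertex_of (ugraph (reglue h k A)) g.k'} \<noteq>
        {vertex_of (ugraph (reglue h k A)) h, vertex_of (ugraph (reglue h k A)) k}"
      unfolding u1 using f' by simp
  qed
  then show "opposed (collapse {c h, c k} (contract h k A)) (collapse {h, k} (contract (c h) (c k) A))"
    unfolding contract_def c_def r .
qed

section \<open>Compatibility with reversal of the orientation\<close>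

lemma opposed_collapse:
  assumes "opposed A B" "collapsible (ugraph A) h k"
  shows "opposed (collapse {h, k} A) (collapse {h, k} B)"
proof -
  interpret collapsible "ugraph A" h k by fact
  obtain L where L: "is_labelling (ugraph A) L" "runs_from_1_to_2 {h, k} L"
    using exists_running[OF refl] orient_nonempty[of A] by (auto simp: orient_iff)
  have u: "ugraph A = ugraph B" using assms by (simp add: opposed_def)
  show ?thesis
    using collapse_ograph(1)[OF assms(2)] collapse_ograph(1)[OF assms(2)[unfolded u]]
      collapse_ograph(2)[OF assms(2) L] collapse_ograph(2)[OF assms(2)[unfolded u] L[unfolded u]] assms(1)
    by (simp add: opposed_def)
qed

lemma opposed_reglue:
  assumes "opposed A B" "contractible (ugraph A) h k"
  shows "opposed (reglue h k A) (reglue h k B)"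
proof -
  interpret contractible "ugraph A" h k by fact
  have u: "ugraph A = ugraph B" using assms by (simp add: opposed_def)
  show ?thesis
    using reglue_ograph(1)[OF regluable_axioms apart] reglue_ograph(1)[OF regluable_axioms[unfolded u] apart[unfolded u]]
      reglue_orient_sign[OF regluable_axioms apart] reglue_orient_sign[OF regluable_axioms[unfolded u] apart[unfolded u]]
      assms(1)
    by (simp add: opposed_def)
qed

lemma opposed_contract:
  assumes "opposed A B" "contractible (ugraph A) h k"
  shows "opposed (contract h k A) (contract h k B)"
proof -
  interpret contractible "ugraph A" h k by fact
  show ?thesis unfolding contract_def
    using opposed_collapse[OF opposed_reglue[OF assms]] reglue_ograph(1)[OF regluable_axioms apart]
      c.collapsible_axioms by simp
qed

section \<open>Isomorphisms\<close>

locale graph_isomorphism =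
  fixes f :: "nat \<Rightarrow> nat" and X X' :: hgraph
  assumes wf: "wf_graph X" and wf': "wf_graph X'" and iso: "graph_iso f X X'"
begin

lemma bij: "bij_betw f (halves X) (halves X')"
  and verts_iso: "verts X' = (image f) ` verts X"
  and edges_iso: "edges X' = (image f) ` edges X"
  using iso by (auto simp: graph_iso_def)

lemma inj: "inj_on f (halves X)" and halves_iso: "halves X' = f ` halves X"
  using bij by (auto simp: bij_betw_def)

lemma f_eq_iff: "a \<in> halves X \<Longrightarrow> b \<in> halves X \<Longrightarrow> f a = f b \<longleftrightarrow> a = b"
  using inj by (auto dest: inj_onD)

lemma image_eq_iff: "A \<subseteq> halves X \<Longrightarrow> B \<subseteq> halves X \<Longrightarrow> f ` A = f ` B \<longleftrightarrow> A = B"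
  by (rule inj_on_image_eq_iff[OF inj])

lemma image_mem_iff: "a \<in> halves X \<Longrightarrow> B \<subseteq> halves X \<Longrightarrow> f a \<in> f ` B \<longleftrightarrow> a \<in> B"
  by (rule inj_on_image_mem_iff[OF inj])

lemma compl_iso: "h \<in> halves X \<Longrightarrow> compl_half X' (f h) = f (compl_half X h)"
proof -
  assume "h \<in> halves X"
  then have "f ` {h, compl_half X h} \<in> edges X'"
    unfolding edges_iso using compl_half_props[OF wf] by blast
  then show ?thesis using compl_half_eq(1)[OF wf', of "f h"] by simp
qed

lemma vertex_of_iso: "h \<in> halves X \<Longrightarrow> vertex_of X' (f h) = f ` vertex_of X h"
  using vertex_of_in[OF wf, of h] verts_iso by (intro vertex_of_eq[OF wf']) auto

lemma vertex_of_iso_eq_iff: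
  "h \<in> halves X \<Longrightarrow> k \<in> halves X \<Longrightarrow> vertex_of X' (f h) = vertex_of X' (f k) \<longleftrightarrow> vertex_of X h = vertex_of X k"
  using vertex_of_in[OF wf] wf_vert_subset[OF wf] by (simp add: vertex_of_iso image_eq_iff)

lemma is_labelling_map: "is_labelling X L \<Longrightarrow> is_labelling X' (map_labelling f L)"
proof -
  assume L: "is_labelling X L"
  then have d: "distinct (numbering L)" "set (numbering L) = verts X" and I: "initial L \<subseteq> halves X"
    by (auto simp: is_labelling_def)
  have "inj_on (image f) (verts X)"
    using image_eq_iff wf_vert_subset[OF wf] by (auto intro!: inj_onI)
  moreover have "compl_half X' y \<in> f ` initial L \<longleftrightarrow> y \<notin> f ` initial L" if y: "y \<in> halves X'" for y
  proof -
    obtain h where h: "h \<in> halves X" "y = f h" using y halves_iso by auto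
    have "compl_half X h \<in> initial L \<longleftrightarrow> h \<notin> initial L"
      using L h(1) by (simp add: is_labelling_iff[OF wf])
    then show ?thesis
      unfolding h(2) compl_iso[OF h(1)]
        image_mem_iff[OF h(1) I] image_mem_iff[OF compl_half_props(2)[OF wf h(1)] I] .
  qed
  ultimately show ?thesis
    unfolding is_labelling_iff[OF wf'] using d I
    by (auto simp: map_labelling_def distinct_map verts_iso halves_iso)
qed

lemma elementary_change_map:
  assumes "(L, L') \<in> elementary_change X"
  shows "(map_labelling f L, map_labelling f L') \<in> elementary_change X'"
proof -
  have L: "is_labelling X L" using assms by (auto simp: elementary_change_def)
  have I: "initial L \<subseteq> halves X" using L by (auto simp: is_labelling_def)
  consider e where "e \<in> edges X" "L' = reverse_arrow e L"
    | i j where "i < j" "j < length (numbering L)" "L' = swap_numbers i j L"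
    using assms by (auto simp: elementary_change_def)
  then show ?thesis
  proof cases
    case (1 e)
    have e: "e \<subseteq> halves X" using wf_edge_subset[OF wf 1(1)] .
    have "f ` (initial L - e \<union> (e - initial L)) = f ` initial L - f ` e \<union> (f ` e - f ` initial L)"
      unfolding image_Un using inj_on_image_set_diff[OF inj, of "initial L" e] inj_on_image_set_diff[OF inj, of e "initial L"] I e
      by auto
    then have "map_labelling f L' = reverse_arrow (f ` e) (map_labelling f L)"
      by (simp add: 1(2) map_labelling_def reverse_arrow_def)
    then show ?thesis
      using is_labelling_map[OF L] 1(1) unfolding elementary_change_def edges_iso by blast
  next
    case (2 i j)
    have "map_labelling f L' = swap_numbers i j (map_labelling f L)"
      using 2 by (simp add: map_labelling_def swap_numbers_def map_update)
    moreover have "length (numbering (map_labelling f L)) = length (numbering L)"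
      by (simp add: map_labelling_def)
    ultimately show ?thesis
      using is_labelling_map[OF L] 2 unfolding elementary_change_def by auto
  qed
qed

text \<open>The signs themselves are not invariant, as \<open>Min\<close> and
  \<open>set_encode\<close> see the names. The product with the transported sign is constant,
  because an elementary change flips both factors.\<close>

lemma label_sign_map:
  assumes "is_labelling X L" "is_labelling X L'"
  shows "label_sign X L * label_sign X' (map_labelling f L) = label_sign X L' * label_sign X' (map_labelling f L')"
  using labellings_connected[OF wf assms]
proof (induction rule: rtrancl_induct)
  case (step M N)
  then show ?case
    using elementary_change_sign[OF wf step(2)] elementary_change_sign[OF wf' elementary_change_map[OF step(2)]]
    by simp
qed simp

lemma inverse: "graph_isomorphism (inv_into (halves X) f) X' X"
proof -
  let ?g = "inv_into (halves X) f"
  have g: "?g ` f ` A = A" if "A \<subseteq> halves X" for A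
    using that inj by (simp add: inv_into_image_cancel)
  have "(image ?g) ` (image f) ` E = E" if "\<And>A. A \<in> E \<Longrightarrow> A \<subseteq> halves X" for E
    unfolding image_image using that by (simp add: g image_image[symmetric] cong: image_cong_simp)
  then have "graph_iso ?g X' X"
    using bij_betw_inv_into[OF bij] wf_edge_subset[OF wf] wf_vert_subset[OF wf]
    unfolding graph_iso_def verts_iso edges_iso by auto
  then show ?thesis using wf wf' by (simp add: graph_isomorphism_def)
qed

end

text \<open>One labelling suffices as a test, since by \<open>label_sign_map\<close> all labellings
  give the same comparison. The map \<open>f\<close> is kept explicit in order to follow individual
  edges and pairs.\<close>

definition oriented_iso_via :: "(nat \<Rightarrow> nat) \<Rightarrow> ograph \<Rightarrow> ograph \<Rightarrow> bool" where
  "oriented_iso_via f A B \<longleftrightarrow> graph_iso f (ugraph A) (ugraph B) \<and>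
     (\<exists>L. is_labelling (ugraph A) L \<and>
       orient_sign A * label_sign (ugraph A) L = orient_sign B * label_sign (ugraph B) (map_labelling f L))"

lemma oriented_iso_via_isomorphism:
  "oriented_iso_via f A B \<Longrightarrow> graph_isomorphism f (ugraph A) (ugraph B)"
  by (simp add: oriented_iso_via_def graph_isomorphism_def wf_ugraph)

lemma oriented_iso_via_sign:
  assumes "oriented_iso_via f A B" "is_labelling (ugraph A) M"
  shows "orient_sign A * label_sign (ugraph A) M = orient_sign B * label_sign (ugraph B) (map_labelling f M)"
proof -
  interpret graph_isomorphism f "ugraph A" "ugraph B"
    by (rule oriented_iso_via_isomorphism[OF assms(1)])
  obtain L where L: "is_labelling (ugraph A) L"
      "orient_sign A * label_sign (ugraph A) L = orient_sign B * label_sign (ugraph B) (map_labelling f L)"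
    using assms(1) by (auto simp: oriented_iso_via_def)
  have pm: "x * y = z * w \<longleftrightarrow> x * z = y * w" if "x \<in> {1, -1}" "y \<in> {1, -1}" "z \<in> {1, -1}" "w \<in> {1, -1 :: int}" for x y z w
    using that by auto
  show ?thesis
    using label_sign_map[OF L(1) assms(2)] L(2)
    by (simp add: pm[OF orient_sign_pm1 label_sign_pm1 orient_sign_pm1 label_sign_pm1])
qed

lemma oriented_iso_iff: "oriented_iso A B \<longleftrightarrow> (\<exists>f. oriented_iso_via f A B)"
proof
  assume "oriented_iso A B"
  then obtain f where f: "graph_iso f (ugraph A) (ugraph B)" "map_labelling f ` orient A = orient B"
    by (auto simp: oriented_iso_def)
  obtain L where L: "L \<in> orient A" using orient_nonempty by blast
  then have "map_labelling f L \<in> orient B" using f by blast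
  have sq: "orient_sign C * orient_sign C = 1" for C
    using orient_sign_pm1[of C] by auto
  show "\<exists>f. oriented_iso_via f A B"
    unfolding oriented_iso_via_def using f L \<open>map_labelling f L \<in> orient B\<close>
    by (auto simp: orient_iff sq intro!: exI[of _ f] exI[of _ L])
next
  assume "\<exists>f. oriented_iso_via f A B"
  then obtain f where f: "oriented_iso_via f A B" by blast
  interpret graph_isomorphism f "ugraph A" "ugraph B"
    by (rule oriented_iso_via_isomorphism[OF f])
  interpret i: graph_isomorphism "inv_into (halves (ugraph A)) f" "ugraph B" "ugraph A"
    by (rule inverse)
  have pm: "x * y = z * w \<Longrightarrow> y = x \<longleftrightarrow> w = z" if "x \<in> {1, -1}" "y \<in> {1, -1}" "z \<in> {1, -1}" "w \<in> {1, -1 :: int}" for x y z w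
    using that by auto
  have mem: "L \<in> orient A \<longleftrightarrow> map_labelling f L \<in> orient B" if "is_labelling (ugraph A) L" for L
    using pm[OF orient_sign_pm1 label_sign_pm1 orient_sign_pm1 label_sign_pm1 oriented_iso_via_sign[OF f that]]
      that is_labelling_map[OF that] by (simp add: orient_iff)
  \<comment> \<open>Surjectivity uses the inverse isomorphism: \<open>M\<close> is the image of its
    own pull-back.\<close>
  have "M \<in> map_labelling f ` orient A" if M: "M \<in> orient B" for M
  proof -
    have labM: "is_labelling (ugraph B) M" using M by (simp add: orient_iff)
    let ?M = "map_labelling (inv_into (halves (ugraph A)) f) M"
    have fg: "f ` inv_into (halves (ugraph A)) f ` S = S" if "S \<subseteq> halves (ugraph B)" for S
      using that unfolding halves_iso by (rule image_inv_into_cancel[OF refl])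
    have "map (image f) (map (image (inv_into (halves (ugraph A)) f)) (numbering M)) = numbering M"
      unfolding map_map using labM wf_vert_subset[OF wf']
      by (intro map_idI) (auto simp: is_labelling_def fg)
    then have "map_labelling f ?M = M"
      using labM by (cases M) (simp add: map_labelling_def is_labelling_def fg)
    then show ?thesis using mem[OF i.is_labelling_map[OF labM]] M by (metis imageI)
  qed
  moreover have "map_labelling f ` orient A \<subseteq> orient B" using mem by (auto simp: orient_iff)
  ultimately have "map_labelling f ` orient A = orient B" by blast
  then show "oriented_iso A B" using iso by (auto simp: oriented_iso_def)
qed

lemma (in graph_isomorphism) collapsible_iso:
  assumes "h \<in> halves X" "k \<in> halves X"
  shows "collapsible X' (f h) (f k) \<longleftrightarrow> collapsible X h k"
proof -
  have "f ` {h, k} \<in> edges X' \<longleftrightarrow> {h, k} \<in> edges X"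
    unfolding edges_iso using assms wf_edge_subset[OF wf]
    by (smt (verit) image_iff image_eq_iff empty_subsetI insert_subset)
  then show ?thesis
    using assms wf wf' by (simp add: collapsible_def vertex_of_iso_eq_iff)
qed

text \<open>The same \<open>f\<close> serves after the collapse, because the surviving half-edges
  keep their names. The comparison is made on one adapted labelling, whose image is adapted to the
  image edge.\<close>

lemma oriented_iso_via_collapse:
  assumes f: "oriented_iso_via f A B" and e: "collapsible (ugraph A) h k"
  shows "oriented_iso_via f (collapse {h, k} A) (collapse {f h, f k} B)"
proof -
  let ?X = "ugraph A" and ?X' = "ugraph B"
  interpret graph_isomorphism f ?X ?X' by (rule oriented_iso_via_isomorphism[OF f])
  interpret e: collapsible ?X h k by fact
  have e': "collapsible ?X' (f h) (f k)" using collapsible_iso[OF e.halves_hk] e by simp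
  interpret e': collapsible ?X' "f h" "f k" by (rule e')
  note V = vertex_of_iso[OF e.halves_hk(1)] vertex_of_iso[OF e.halves_hk(2)]
  have sub: "vertex_of ?X h \<subseteq> halves ?X" "vertex_of ?X k \<subseteq> halves ?X" "{h, k} \<subseteq> halves ?X"
    using e.verts_hk e.halves_hk wf_vert_subset[OF wf] by auto
  have u: "f ` e.u = e'.u"
    unfolding V using inj_on_image_set_diff[OF inj, of "vertex_of ?X h \<union> vertex_of ?X k" "{h, k}"] sub
    by (auto simp: image_Un)
  have injP: "inj_on (image f) (Pow (halves ?X))" by (rule inj_on_image_Pow[OF inj])
  have D: "(image f) ` (S - T) = (image f) ` S - (image f) ` T" if "S \<subseteq> Pow (halves ?X)" "T \<subseteq> Pow (halves ?X)" for S T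
    by (rule inj_on_image_set_diff[OF injP]) (use that in blast)+
  have gi: "graph_iso f (collapse_graph {h, k} ?X) (collapse_graph {f h, f k} ?X')"
    unfolding graph_iso_def
  proof (intro conjI)
    show "bij_betw f (halves (collapse_graph {h, k} ?X)) (halves (collapse_graph {f h, f k} ?X'))"
      unfolding e.halves_collapse e'.halves_collapse
      using inj_on_image_set_diff[OF inj, of "halves ?X" "{h, k}"] sub inj
      by (auto simp: bij_betw_def halves_iso inj_on_diff)
    have "verts ?X \<subseteq> Pow (halves ?X)" using wf_vert_subset[OF wf] by auto
    then show "(`) f ` verts (collapse_graph {h, k} ?X) = verts (collapse_graph {f h, f k} ?X')"
      unfolding e.verts_collapse e'.verts_collapse image_insert u verts_iso V
      using D[of "verts ?X" "{vertex_of ?X h, vertex_of ?X k}"] sub by simp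
    have "edges ?X \<subseteq> Pow (halves ?X)" using wf_edge_subset[OF wf] by auto
    then show "(`) f ` edges (collapse_graph {h, k} ?X) = edges (collapse_graph {f h, f k} ?X')"
      unfolding e.edges_collapse e'.edges_collapse edges_iso
      using D[of "edges ?X" "{{h, k}}"] sub by simp
  qed
  obtain L xs where L: "is_labelling ?X L" "{h} \<subseteq> initial L" "numbering L = [vertex_of ?X h, vertex_of ?X k] @ xs"
    by (rule labelling_exists[OF wf, of "{h}" "[vertex_of ?X h, vertex_of ?X k]"])
      (use e.halves_hk e.hk e.verts_hk e.nonloop in auto)
  define I where "I = initial L"
  have Leq: "L = \<lparr>numbering = vertex_of ?X h # vertex_of ?X k # xs, initial = I\<rparr>"
    using L(3) by (simp add: I_def)
  have I: "h \<in> I" "k \<notin> I" "I \<subseteq> halves ?X"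
    using L(1,2) e.hk e.halves_hk by (auto simp: is_labelling_iff[OF wf] I_def)
  note 1 = collapse_step[OF e refl L(1)[unfolded Leq] I(1,2)]
  have mL: "map_labelling f L = \<lparr>numbering = vertex_of ?X' (f h) # vertex_of ?X' (f k) # map (image f) xs, initial = f ` I\<rparr>"
    unfolding Leq map_labelling_def by (simp add: V)
  have fI: "f h \<in> f ` I" "f k \<notin> f ` I" using I e.halves_hk by (auto simp: image_mem_iff)
  note 2 = collapse_step[OF e' refl is_labelling_map[OF L(1), unfolded mL] fI]
  let ?M = "\<lparr>numbering = e.u # xs, initial = I - {h, k}\<rparr>"
  have "f ` (I - {h, k}) = f ` I - {f h, f k}"
    using inj_on_image_set_diff[OF inj, of I "{h, k}"] I(3) sub by auto
  then have mM: "map_labelling f ?M = \<lparr>numbering = e'.u # map (image f) xs, initial = f ` I - {f h, f k}\<rparr>"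
    by (simp add: map_labelling_def u)
  have s: "orient_sign A * label_sign ?X L = orient_sign B * label_sign ?X' (map_labelling f L)"
    by (rule oriented_iso_via_sign[OF f L(1)])
  have "orient_sign (collapse {h, k} A) * label_sign (collapse_graph {h, k} ?X) ?M =
     orient_sign (collapse {f h, f k} B) * label_sign (collapse_graph {f h, f k} ?X') (map_labelling f ?M)"
    unfolding mM 1(1) 2(1) using s[unfolded mL] unfolding Leq by (simp add: mult.assoc)
  then show ?thesis
    unfolding oriented_iso_via_def collapse_ograph(1)[OF e] collapse_ograph(1)[OF e']
    using gi 1(2) by blast
qed

lemma (in graph_isomorphism) contractible_iso:
  assumes "h \<in> halves X" "k \<in> halves X"
  shows "contractible X' (f h) (f k) \<longleftrightarrow> contractible X h k"
  using assms wf wf' compl_half_props(2)[OF wf]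
  by (auto simp: contractible_def contractible_axioms_def regluable_def vertex_of_iso_eq_iff f_eq_iff compl_iso halves_iso)

lemma oriented_iso_via_reglue:
  assumes f: "oriented_iso_via f A B" and g: "contractible (ugraph A) h k"
  shows "oriented_iso_via f (reglue h k A) (reglue (f h) (f k) B)"
proof -
  let ?X = "ugraph A" and ?X' = "ugraph B"
  interpret graph_isomorphism f ?X ?X' by (rule oriented_iso_via_isomorphism[OF f])
  interpret g: contractible ?X h k by fact
  have g': "contractible ?X' (f h) (f k)" using contractible_iso[OF g.halves_hk] g by simp
  interpret g': contractible ?X' "f h" "f k" by (rule g')
  note c = compl_iso[OF g.halves_hk(1)] compl_iso[OF g.halves_hk(2)]
  have injP: "inj_on (image f) (Pow (halves ?X))" by (rule inj_on_image_Pow[OF inj])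
  have gi: "graph_iso f g.Y g'.Y"
    unfolding graph_iso_def
  proof (intro conjI)
    show "bij_betw f (halves g.Y) (halves g'.Y)" using bij by simp
    show "(`) f ` verts g.Y = verts g'.Y" using verts_iso by simp
    have "edges ?X \<subseteq> Pow (halves ?X)" "{{h, g.h'}, {k, g.k'}} \<subseteq> Pow (halves ?X)"
      using wf_edge_subset[OF wf] g.halves_hk g.distinct4 by auto
    then have "(`) f ` (edges ?X - {{h, g.h'}, {k, g.k'}}) = (`) f ` edges ?X - (`) f ` {{h, g.h'}, {k, g.k'}}"
      by (intro inj_on_image_set_diff[OF injP]) blast+
    then show "(`) f ` edges g.Y = edges g'.Y"
      unfolding g.edges_reglue g'.edges_reglue edges_iso c image_Un by simp
  qed
  obtain L where L: "is_labelling ?X L" "h \<in> initial L" "k \<notin> initial L"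
    using g.exists_reglue_labelling[OF g.apart refl] by blast
  have I: "initial L \<subseteq> halves ?X" using L by (simp add: is_labelling_def)
  have mL: "f h \<in> initial (map_labelling f L)" "f k \<notin> initial (map_labelling f L)"
    using L I g.halves_hk by (auto simp: map_labelling_def image_mem_iff)
  have s: "orient_sign A * label_sign ?X L = orient_sign B * label_sign ?X' (map_labelling f L)"
    by (rule oriented_iso_via_sign[OF f L(1)])
  have "orient_sign (reglue h k A) * label_sign g.Y L =
     orient_sign (reglue (f h) (f k) B) * label_sign g'.Y (map_labelling f L)"
    unfolding reglue_ograph(2)[OF g.regluable_axioms g.apart L]
      reglue_ograph(2)[OF g'.regluable_axioms g'.apart is_labelling_map[OF L(1)] mL]
    using s by (simp add: mult.assoc)
  then show ?thesis
    unfolding oriented_iso_via_def reglue_ograph(1)[OF g.regluable_axioms g.apart]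
      reglue_ograph(1)[OF g'.regluable_axioms g'.apart]
    using gi g.is_labelling_reglue[OF L] by blast
qed

lemma oriented_iso_via_contract:
  assumes f: "oriented_iso_via f A B" and g: "contractible (ugraph A) h k"
  shows "oriented_iso_via f (contract h k A) (contract (f h) (f k) B)"
proof -
  interpret contractible "ugraph A" h k by fact
  show ?thesis
    unfolding contract_def
    by (rule oriented_iso_via_collapse[OF oriented_iso_via_reglue[OF assms]])
      (use reglue_ograph(1)[OF regluable_axioms apart] c.collapsible_axioms in simp)
qed

section \<open>Linear maps on the graph complex\<close>

lemma gc_class_iso: "oriented_iso A B \<Longrightarrow> gc_class A = (gc_class B :: 'k::field_char_0 graph_complex)"
  by transfer (auto simp: graph_equiv_def graph_relations_def intro!: free_space.span_base)

text \<open>Identifies sign reversal with the second kind of relation in the complex. The empty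
  graph is covered: it has no labelling of sign -1, so both sides fail.\<close>

lemma opposed_iff: "opposed A B \<longleftrightarrow> ugraph B = ugraph A \<and> orient B = opposite (ugraph A) (orient A)"
proof -
  obtain L where L: "L \<in> orient A" using orient_nonempty by blast
  then have lab: "is_labelling (ugraph A) L" and s: "label_sign (ugraph A) L = orient_sign A"
    by (auto simp: orient_iff)
  have "orient A = orientation_of (ugraph A) L"
    unfolding orientation_of_eq[OF wf_ugraph lab] s by (auto simp: orient_iff)
  then have o: "opposite (ugraph A) (orient A) = {M. is_labelling (ugraph A) M \<and> label_sign (ugraph A) M = - orient_sign A}"
    using opposite_eq[OF wf_ugraph lab] s by simp
  obtain M where M: "M \<in> orient B" using orient_nonempty by blast
  show ?thesis
  proof
    assume "opposed A B"
    then show "ugraph B = ugraph A \<and> orient B = opposite (ugraph A) (orient A)"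
      unfolding o by (auto simp: opposed_def orient_iff)
  next
    assume a: "ugraph B = ugraph A \<and> orient B = opposite (ugraph A) (orient A)"
    then have "label_sign (ugraph A) M = - orient_sign A" using M o by simp
    moreover have "orient_sign B = label_sign (ugraph A) M"
      using M conjunct1[OF a] orient_iff[of M B] by simp
    ultimately show "opposed A B" using conjunct1[OF a] by (simp add: opposed_def)
  qed
qed

lemma gc_class_opposed:
  assumes "opposed A B"
  shows "gc_class B = - (gc_class A :: 'k::field_char_0 graph_complex)"
proof -
  have "Poly_Mapping.single B 1 - - Poly_Mapping.single A 1 \<in> free_span (graph_relations :: (ograph \<Rightarrow>\<^sub>0 'k) set)"
    using assms unfolding opposed_iff graph_relations_def
    by (intro free_space.span_base) (auto simp: add.commute)
  then show ?thesis by transfer (simp add: graph_equiv_def)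
qed

section \<open>Linear extension from oriented graphs to the complex\<close>

definition extend :: "(ograph \<Rightarrow> 'k graph_complex) \<Rightarrow> (ograph \<Rightarrow>\<^sub>0 'k::field_char_0) \<Rightarrow> 'k graph_complex" where
  "extend g p = (\<Sum>A\<in>Poly_Mapping.keys p. gc_scale (Poly_Mapping.lookup p A) (g A))"

lemma extend_superset:
  "finite S \<Longrightarrow> Poly_Mapping.keys p \<subseteq> S \<Longrightarrow> extend g p = (\<Sum>A\<in>S. gc_scale (Poly_Mapping.lookup p A) (g A))"
  unfolding extend_def by (rule sum.mono_neutral_left) (auto simp: in_keys_iff)

lemma extend_add: "extend g (p + q) = extend g p + extend g q"
proof -
  let ?S = "Poly_Mapping.keys p \<union> Poly_Mapping.keys q"
  have "Poly_Mapping.keys (p + q) \<subseteq> ?S" by (rule Poly_Mapping.keys_add)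
  then show ?thesis
    using extend_superset[of ?S "p + q" g] extend_superset[of ?S p g] extend_superset[of ?S q g]
    by (simp add: lookup_add gc.scale_left_distrib sum.distrib)
qed

lemma extend_scale: "extend g (free_scale c p) = gc_scale c (extend g p)"
proof -
  have "Poly_Mapping.keys (free_scale c p) \<subseteq> Poly_Mapping.keys p"
    by (auto simp: in_keys_iff free_scale.rep_eq)
  then show ?thesis
    using extend_superset[of "Poly_Mapping.keys p" "free_scale c p" g]
    by (simp add: extend_def free_scale.rep_eq gc.scale_sum_right)
qed

lemma extend_single [simp]: "extend g (Poly_Mapping.single A 1) = g A"
  by (simp add: extend_def)

lemma extend_diff: "extend g (p - q) = extend g p - extend g q"
  using extend_add[of g "p - q" q] by (simp add: algebra_simps)

text \<open>It is enough that the extension vanishes on the two kinds of generators of the relation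
  space.\<close>

lemma extend_graph_equiv:
  assumes iso: "\<And>A B. oriented_iso A B \<Longrightarrow> g A = g B" and opp: "\<And>A B. opposed A B \<Longrightarrow> g B = - g A"
    and "graph_equiv p q"
  shows "extend g p = extend g q"
proof -
  have "p - q \<in> free_span graph_relations" using assms(3) by (simp add: graph_equiv_def)
  then have "extend g (p - q) = 0"
  proof (induction rule: free_space.span_induct_alt)
    case base
    show ?case by (simp add: extend_def)
  next
    case (step c x y)
    from step(1) have "extend g x = 0"
      using iso opp by (auto simp: graph_relations_def extend_add extend_diff opposed_iff)
    then show ?case using step(2) by (simp add: extend_add extend_scale)
  qed
  then show ?thesis by (simp add: extend_diff)
qed

text \<open>Hence the classes of oriented graphs span the complex, which gives uniqueness in
  \<open>linear_extension\<close>.\<close>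

lemma abs_graph_complex_eq_extend: "abs_graph_complex p = extend gc_class p"
proof (induction p rule: update_induct)
  case const
  show ?case by (simp add: extend_def zero_graph_complex.abs_eq[symmetric])
next
  case (update p A c)
  have u: "Poly_Mapping.update A c p = p + free_scale c (Poly_Mapping.single A 1)"
    using update by (intro poly_mapping_eqI) (auto simp: lookup_update lookup_add free_scale.rep_eq lookup_single in_keys_iff when_def)
  show ?case
    unfolding u extend_add extend_scale extend_single update(3)[symmetric]
    by (simp add: plus_graph_complex.abs_eq gc_scale.abs_eq gc_class.abs_eq)
qed

lemma abs_graph_complexE: obtains p where "x = abs_graph_complex p"
  using Quotient3_abs_rep[OF Quotient3_graph_complex] by metis

lemma graph_complex_eq_sum: "\<exists>p. x = (\<Sum>A\<in>Poly_Mapping.keys p. gc_scale (Poly_Mapping.lookup p A) (gc_class A))"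
  by (cases x rule: abs_graph_complexE) (auto simp: abs_graph_complex_eq_extend extend_def)

lemma linear_gc_sum:
  assumes "Vector_Spaces.linear gc_scale gc_scale D"
  shows "D (\<Sum>a\<in>S. g a) = (\<Sum>a\<in>S. D (g a))"
proof -
  interpret Vector_Spaces.linear gc_scale gc_scale D by fact
  show ?thesis by (rule sum)
qed

lemma linear_gc_eqI:
  assumes "Vector_Spaces.linear gc_scale gc_scale D" "Vector_Spaces.linear gc_scale gc_scale D'"
    and "\<And>A. D (gc_class A) = D' (gc_class A)"
  shows "D x = D' x"
proof -
  interpret D: Vector_Spaces.linear gc_scale gc_scale D by fact
  interpret D': Vector_Spaces.linear gc_scale gc_scale D' by fact
  obtain p where "x = (\<Sum>A\<in>Poly_Mapping.keys p. gc_scale (Poly_Mapping.lookup p A) (gc_class A))"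
    using graph_complex_eq_sum by blast
  then show ?thesis by (simp add: D.sum D'.sum D.scale D'.scale assms(3))
qed

text \<open>The unique existence behind the definite descriptions that define the two
  operators.\<close>

lemma linear_extension:
  fixes g :: "ograph \<Rightarrow> 'k::field_char_0 graph_complex"
  assumes iso: "\<And>A B. oriented_iso A B \<Longrightarrow> g A = g B" and opp: "\<And>A B. opposed A B \<Longrightarrow> g B = - g A"
  shows "\<exists>!D. Vector_Spaces.linear gc_scale gc_scale D \<and> (\<forall>A. D (gc_class A) = g A)"
proof (rule ex_ex1I)
  let ?D = "\<lambda>x. extend g (rep_graph_complex x)"
  have D: "?D (abs_graph_complex p) = extend g p" for p
  proof (rule extend_graph_equiv[OF iso opp])
    show "graph_equiv (rep_graph_complex (abs_graph_complex p)) p"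
      by (rule rep_abs_rsp_left[OF Quotient3_graph_complex graph_equiv_refl])
  qed
  have "Vector_Spaces.linear gc_scale gc_scale ?D"
  proof (unfold_locales, goal_cases)
    case (1 x y)
    show ?case
      by (cases x rule: abs_graph_complexE; cases y rule: abs_graph_complexE)
        (simp add: plus_graph_complex.abs_eq D extend_add)
  next
    case (2 c x)
    show ?case
      by (cases x rule: abs_graph_complexE) (simp add: gc_scale.abs_eq D extend_scale)
  qed
  then show "\<exists>D. Vector_Spaces.linear gc_scale gc_scale D \<and> (\<forall>A. D (gc_class A) = g A)"
    by (intro exI[of _ ?D]) (simp add: gc_class.abs_eq D)
  show "D = D'" if "Vector_Spaces.linear gc_scale gc_scale D \<and> (\<forall>A. D (gc_class A) = g A)"
    "Vector_Spaces.linear gc_scale gc_scale D' \<and> (\<forall>A. D' (gc_class A) = g A)" for D D'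
    using that linear_gc_eqI[of D D'] by auto
qed

lemma graph_complex_double_eq_0: "x + x = 0 \<Longrightarrow> x = (0 :: 'k::field_char_0 graph_complex)"
proof -
  assume "x + x = 0"
  then have "gc_scale 2 x = 0"
    using gc.scale_left_distrib[of 1 1 x] by simp
  then show "x = 0" by simp
qed

lemma graph_complex_double_inj: "x + x = y + y \<Longrightarrow> x = (y :: 'k::field_char_0 graph_complex)"
  using graph_complex_double_eq_0[of "x - y"] by (simp add: algebra_simps)

text \<open>Reindexing along \<phi> shows that the sum equals its own negative, and 2 is invertible.
  A fixed point of \<phi> is covered as well, since its term is its own negative.\<close>

lemma sum_involution:
  fixes g :: "'a \<Rightarrow> 'k::field_char_0 graph_complex"
  assumes "\<And>a. a \<in> S \<Longrightarrow> \<phi> a \<in> S" "\<And>a. a \<in> S \<Longrightarrow> \<phi> (\<phi> a) = a" "\<And>a. a \<in> S \<Longrightarrow> g (\<phi> a) = - g a"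
  shows "sum g S = 0"
proof -
  have "sum g S = (\<Sum>a\<in>S. - g a)"
    by (rule sum.reindex_bij_witness[of _ \<phi> \<phi>]) (use assms in \<open>auto\<close>)
  then have "sum g S + sum g S = 0"
    by (simp only: sum_negf eq_neg_iff_add_eq_0)
  then show ?thesis by (rule graph_complex_double_eq_0)
qed

section \<open>The values of the operators\<close>

definition value_E :: "ograph \<Rightarrow> 'k::field_char_0 graph_complex" where
  "value_E A = (\<Sum>e\<in>nonloops (ugraph A). gc_class (collapse e A))"

text \<open>Twice the value of \<open>boundary_H\<close>, written without reference to the order of
  the names.\<close>

definition value_H :: "ograph \<Rightarrow> 'k::field_char_0 graph_complex" where
  "value_H A = (\<Sum>(h, k)\<in>half_pairs (ugraph A). gc_class (contract h k A))"

definition value_H_half :: "ograph \<Rightarrow> 'k::field_char_0 graph_complex" where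
  "value_H_half A = (\<Sum>(h, k) | h \<in> halves (ugraph A) \<and> k \<in> halves (ugraph A) \<and> h < k \<and>
                   k \<noteq> compl_half (ugraph A) h. contract_pair h k A)"

lemma finite_nonloops: "wf_graph X \<Longrightarrow> finite (nonloops X)"
  by (simp add: nonloops_def wf_finite_edges)

lemma finite_half_pairs: "wf_graph X \<Longrightarrow> finite (half_pairs X)"
  by (rule finite_subset[of _ "halves X \<times> halves X"]) (auto dest: half_pairs_halves wf_finite_halves)

lemma contract_pair_half_pairs: "(h, k) \<in> half_pairs (ugraph A) \<Longrightarrow> contract_pair h k A = gc_class (contract h k A)"
  by (simp add: half_pairs_def contract_pair_def contract_def)

text \<open>The two orders of a pair contribute equally by \<open>contract_commute\<close>, and
  pairs at a common vertex contribute zero.\<close>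

lemma value_H_half: "value_H_half A + value_H_half A = (value_H A :: 'k::field_char_0 graph_complex)"
proof -
  let ?X = "ugraph A"
  let ?S = "{(h, k). h \<in> halves ?X \<and> k \<in> halves ?X \<and> h < k \<and> k \<noteq> compl_half ?X h}"
  let ?T = "{(h, k) \<in> half_pairs ?X. h < k}"
  let ?g = "\<lambda>(h, k). gc_class (contract h k A) :: 'k graph_complex"
  have wf: "wf_graph ?X" by (rule wf_ugraph)
  have "value_H_half A = (\<Sum>(h, k)\<in>?S. contract_pair h k A)"
    by (simp add: value_H_half_def)
  also have "\<dots> = (\<Sum>(h, k)\<in>?T. contract_pair h k A)"
  proof (rule sum.mono_neutral_right)
    show "finite ?S"
      by (rule finite_subset[of _ "halves ?X \<times> halves ?X"]) (use wf_finite_halves[OF wf] in auto)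
    show "?T \<subseteq> ?S" "\<forall>i\<in>?S - ?T. (case i of (h, k) \<Rightarrow> contract_pair h k A) = 0"
      using wf by (auto simp: half_pairs_def regluable_def contract_pair_def)
  qed
  also have "\<dots> = sum ?g ?T"
    by (rule sum.cong) (auto simp: contract_pair_half_pairs)
  finally have 1: "value_H_half A = sum ?g ?T" .
  have 2: "sum ?g {(h, k) \<in> half_pairs ?X. k < h} = sum ?g ?T"
    by (rule sum.reindex_bij_witness[of _ prod.swap prod.swap])
      (auto simp: half_pairs_contractible contractible_commute contract_commute[symmetric])
  have "half_pairs ?X = ?T \<union> {(h, k) \<in> half_pairs ?X. k < h}"
    by (auto simp: half_pairs_def regluable_def)
  then have "value_H A = sum ?g (?T \<union> {(h, k) \<in> half_pairs ?X. k < h})"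
    by (simp add: value_H_def)
  also have "\<dots> = sum ?g ?T + sum ?g {(h, k) \<in> half_pairs ?X. k < h}"
    by (rule sum.union_disjoint) (auto intro: finite_subset[OF _ finite_half_pairs[OF wf]])
  finally show ?thesis using 1 2 by simp
qed

section \<open>Invariance of the values under isomorphism and orientation reversal\<close>

lemma value_E_iso: "oriented_iso A B \<Longrightarrow> value_E A = (value_E B :: 'k::field_char_0 graph_complex)"
proof -
  assume "oriented_iso A B"
  then obtain f where f: "oriented_iso_via f A B" by (auto simp: oriented_iso_iff)
  interpret graph_isomorphism f "ugraph A" "ugraph B" by (rule oriented_iso_via_isomorphism[OF f])
  have "bij_betw (image f) (nonloops (ugraph A)) (nonloops (ugraph B))"
    unfolding bij_betw_def
  proof (intro conjI equalityI subsetI)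
    show "inj_on (image f) (nonloops (ugraph A))"
      using image_eq_iff wf_edge_subset[OF wf] by (auto simp: nonloops_def intro!: inj_onI)
  next
    fix e assume "e \<in> image f ` nonloops (ugraph A)"
    then obtain p q where "e = f ` {p, q}" "collapsible (ugraph A) p q" using nonloopsE[OF wf] by (metis imageE)
    then show "e \<in> nonloops (ugraph B)"
      using collapsible_iso collapsible.halves_hk nonloops_iff[OF wf'] by (metis image_empty image_insert)
  next
    fix e assume "e \<in> nonloops (ugraph B)"
    then obtain p q where e: "e = {p, q}" "collapsible (ugraph B) p q" using nonloopsE[OF wf'] by metis
    have "p \<in> f ` halves (ugraph A)" "q \<in> f ` halves (ugraph A)"
      using collapsible.halves_hk[OF e(2)] unfolding halves_iso .
    then obtain a b where ab: "p = f a" "q = f b" "a \<in> halves (ugraph A)" "b \<in> halves (ugraph A)"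
      by blast
    then have "{a, b} \<in> nonloops (ugraph A)"
      using e collapsible_iso nonloops_iff[OF wf] by simp
    then show "e \<in> image f ` nonloops (ugraph A)" using e ab by (intro image_eqI[of _ _ "{a, b}"]) auto
  qed
  then have "value_E B = (\<Sum>e\<in>nonloops (ugraph A). gc_class (collapse (f ` e) B) :: 'k graph_complex)"
    unfolding value_E_def by (rule sum.reindex_bij_betw[symmetric])
  also have "\<dots> = value_E A"
    unfolding value_E_def
  proof (rule sum.cong)
    fix e assume "e \<in> nonloops (ugraph A)"
    then obtain p q where e: "e = {p, q}" "collapsible (ugraph A) p q" using nonloopsE[OF wf] by metis
    have "oriented_iso (collapse e A) (collapse (f ` e) B)"
      unfolding oriented_iso_iff e(1) using oriented_iso_via_collapse[OF f e(2)] by auto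
    then show "gc_class (collapse (f ` e) B) = (gc_class (collapse e A) :: 'k graph_complex)"
      by (rule gc_class_iso[symmetric])
  qed simp
  finally show ?thesis by simp
qed

text \<open>On ordered pairs the isomorphism acts directly on the index set, by
  \<open>map_prod f f\<close>.\<close>

lemma value_H_iso: "oriented_iso A B \<Longrightarrow> value_H A = (value_H B :: 'k::field_char_0 graph_complex)"
proof -
  assume "oriented_iso A B"
  then obtain f where f: "oriented_iso_via f A B" by (auto simp: oriented_iso_iff)
  interpret graph_isomorphism f "ugraph A" "ugraph B" by (rule oriented_iso_via_isomorphism[OF f])
  have "bij_betw (map_prod f f) (half_pairs (ugraph A)) (half_pairs (ugraph B))"
    unfolding bij_betw_def
  proof (intro conjI equalityI subsetI)
    show "inj_on (map_prod f f) (half_pairs (ugraph A))"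
      by (auto simp: f_eq_iff dest!: half_pairs_halves intro!: inj_onI)
  next
    fix x assume "x \<in> map_prod f f ` half_pairs (ugraph A)"
    then show "x \<in> half_pairs (ugraph B)"
      using contractible_iso half_pairs_halves by (force simp: half_pairs_contractible)
  next
    fix x assume x: "x \<in> half_pairs (ugraph B)"
    obtain p q where pq: "x = (p, q)" by (cases x)
    have "p \<in> f ` halves (ugraph A)" "q \<in> f ` halves (ugraph A)"
      using half_pairs_halves[OF x[unfolded pq]] unfolding halves_iso by simp_all
    then obtain a b where ab: "p = f a" "q = f b" "a \<in> halves (ugraph A)" "b \<in> halves (ugraph A)"
      by blast
    then have "(a, b) \<in> half_pairs (ugraph A)"
      using x pq contractible_iso by (simp add: half_pairs_contractible)
    then show "x \<in> map_prod f f ` half_pairs (ugraph A)" using pq ab by (intro image_eqI[of _ _ "(a, b)"]) auto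
  qed
  then have "value_H B = (\<Sum>x\<in>half_pairs (ugraph A). (case map_prod f f x of (h, k) \<Rightarrow> gc_class (contract h k B)) :: 'k graph_complex)"
    unfolding value_H_def by (rule sum.reindex_bij_betw[symmetric])
  also have "\<dots> = value_H A"
    unfolding value_H_def
  proof (rule sum.cong, simp, clarsimp)
    fix h k assume "(h, k) \<in> half_pairs (ugraph A)"
    then have "oriented_iso (contract h k A) (contract (f h) (f k) B)"
      unfolding oriented_iso_iff half_pairs_contractible using oriented_iso_via_contract[OF f] by blast
    then show "gc_class (contract (f h) (f k) B) = (gc_class (contract h k A) :: 'k graph_complex)"
      by (rule gc_class_iso[symmetric])
  qed
  finally show ?thesis by simp
qed

lemma value_E_opposed:
  assumes "opposed A B" shows "value_E B = - value_E A"
proof -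
  have u: "ugraph B = ugraph A" using assms by (simp add: opposed_def)
  show ?thesis
    unfolding value_E_def u sum_negf[symmetric]
    by (rule sum.cong) (auto intro!: gc_class_opposed opposed_collapse[OF assms] elim!: nonloopsE[OF wf_ugraph])
qed

lemma value_H_opposed:
  assumes "opposed A B" shows "value_H B = - value_H A"
proof -
  have u: "ugraph B = ugraph A" using assms by (simp add: opposed_def)
  show ?thesis
    unfolding value_H_def u sum_negf[symmetric]
    by (rule sum.cong) (auto intro!: gc_class_opposed opposed_contract[OF assms] simp: half_pairs_contractible)
qed

lemma boundary_E:
  "Vector_Spaces.linear gc_scale gc_scale (boundary_E :: 'k::field_char_0 graph_complex \<Rightarrow> _)"
  "boundary_E (gc_class A :: 'k graph_complex) = value_E A"
proof -
  have "\<exists>!D :: 'k graph_complex \<Rightarrow> _. Vector_Spaces.linear gc_scale gc_scale D \<and> (\<forall>A. D (gc_class A) = value_E A)"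
    by (rule linear_extension[OF value_E_iso value_E_opposed])
  from theI'[OF this]
  show "Vector_Spaces.linear gc_scale gc_scale (boundary_E :: 'k graph_complex \<Rightarrow> _)"
    "boundary_E (gc_class A :: 'k graph_complex) = value_E A"
    unfolding boundary_E_def value_E_def nonloops_def by auto
qed

text \<open>An isomorphism need not preserve \<open>h < k\<close>, so invariance is obtained for the
  doubled sum and then halved.\<close>

lemma value_H_half_iso: "oriented_iso A B \<Longrightarrow> value_H_half A = (value_H_half B :: 'k::field_char_0 graph_complex)"
  by (rule graph_complex_double_inj) (simp only: value_H_half value_H_iso)

lemma value_H_half_opposed:
  assumes "opposed A B" shows "value_H_half B = - (value_H_half A :: 'k::field_char_0 graph_complex)"
proof (rule graph_complex_double_inj)
  show "value_H_half B + value_H_half B = - value_H_half A + - (value_H_half A :: 'k graph_complex)"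
    unfolding minus_add_distrib[symmetric] value_H_half by (rule value_H_opposed[OF assms])
qed

lemma boundary_H:
  "Vector_Spaces.linear gc_scale gc_scale (boundary_H :: 'k::field_char_0 graph_complex \<Rightarrow> _)"
  "boundary_H (gc_class A :: 'k graph_complex) + boundary_H (gc_class A) = value_H A"
proof -
  have "\<exists>!D :: 'k graph_complex \<Rightarrow> _. Vector_Spaces.linear gc_scale gc_scale D \<and> (\<forall>A. D (gc_class A) = value_H_half A)"
    by (rule linear_extension[OF value_H_half_iso value_H_half_opposed])
  from theI'[OF this]
  have *: "Vector_Spaces.linear gc_scale gc_scale (boundary_H :: 'k graph_complex \<Rightarrow> _)"
    "boundary_H (gc_class A :: 'k graph_complex) = value_H_half A"
    unfolding boundary_H_def value_H_half_def by auto
  then show "Vector_Spaces.linear gc_scale gc_scale (boundary_H :: 'k graph_complex \<Rightarrow> _)"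
    "boundary_H (gc_class A :: 'k graph_complex) + boundary_H (gc_class A) = value_H A"
    by (auto simp: value_H_half)
qed

section \<open>The squares\<close>

text \<open>A pair (e, f) occurs if the two edges are distinct, neither is a loop and they are not
  parallel. These conditions are symmetric, so exchanging \<open>e\<close> and \<open>f\<close> is a
  sign-reversing involution of the index set.\<close>

lemma boundary_E_value_E: "boundary_E (value_E A) = (0 :: 'k::field_char_0 graph_complex)"
proof -
  let ?P = "SIGMA e:nonloops (ugraph A). nonloops (ugraph (collapse e A))"
  let ?g = "\<lambda>(e, f). gc_class (collapse f (collapse e A)) :: 'k graph_complex"
  have "boundary_E (value_E A) = (\<Sum>e\<in>nonloops (ugraph A). value_E (collapse e A) :: 'k graph_complex)"
    unfolding value_E_def[of A] linear_gc_sum[OF boundary_E(1)] boundary_E(2) ..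
  also have "\<dots> = sum ?g ?P"
    unfolding value_E_def by (rule sum.Sigma) (auto intro: finite_nonloops wf_ugraph)
  also have "\<dots> = 0"
  proof (rule sum_involution[where \<phi> = prod.swap])
    fix a assume "a \<in> ?P"
    then obtain e f where a: "a = (e, f)" "e \<in> nonloops (ugraph A)" "f \<in> nonloops (ugraph (collapse e A))" by auto
    obtain h k where e: "e = {h, k}" "collapsible (ugraph A) h k" using nonloopsE[OF wf_ugraph a(2)] .
    obtain p q where f: "f = {p, q}" "collapsible (ugraph (collapse e A)) p q" using nonloopsE[OF wf_ugraph a(3)] .
    interpret e: collapsible "ugraph A" h k by (rule e)
    have f': "collapsible (ugraph A) p q" "{p, q} \<noteq> {h, k}"
      "{vertex_of (ugraph A) p, vertex_of (ugraph A) q} \<noteq> {vertex_of (ugraph A) h, vertex_of (ugraph A) k}"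
      using f(2) unfolding e(1) collapse_ograph(1)[OF e(2)] e.collapsible_collapse_iff by auto
    interpret f: collapsible "ugraph A" p q by (rule f')
    have "collapsible (ugraph (collapse f A)) h k"
      unfolding f(1) collapse_ograph(1)[OF f'(1)] f.collapsible_collapse_iff using e(2) f' by metis
    then show "prod.swap a \<in> ?P"
      using a e f f' nonloops_iff[OF wf_ugraph] by simp
    show "prod.swap (prod.swap a) = a" by simp
    show "?g (prod.swap a) = - ?g a"
      using gc_class_opposed[where 'k = 'k, OF collapse_collapse[OF e(2) f']] a e f by simp
  qed
  finally show ?thesis .
qed

text \<open>The left-hand side is four times the square of \<open>boundary_H\<close> at the class of
  \<open>A\<close>: each of the two applications is doubled once.\<close>

lemma boundary_H_value_H: "boundary_H (value_H A) + boundary_H (value_H A) = (0 :: 'k::field_char_0 graph_complex)"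
proof -
  let ?P = "SIGMA a:half_pairs (ugraph A). half_pairs (ugraph (contract (fst a) (snd a) A))"
  let ?g = "\<lambda>(a, b). gc_class (contract (fst b) (snd b) (contract (fst a) (snd a) A)) :: 'k graph_complex"
  have "boundary_H (value_H A) + boundary_H (value_H A) =
      (\<Sum>a\<in>half_pairs (ugraph A). value_H (contract (fst a) (snd a) A) :: 'k graph_complex)"
    unfolding value_H_def[of A] linear_gc_sum[OF boundary_H(1)] sum.distrib[symmetric] case_prod_beta boundary_H(2) ..
  also have "\<dots> = sum ?g ?P"
    unfolding value_H_def case_prod_beta
    by (subst sum.Sigma) (auto intro: finite_half_pairs wf_ugraph simp: case_prod_beta)
  also have "\<dots> = 0"
  proof (rule sum_involution[where \<phi> = prod.swap])
    fix x assume "x \<in> ?P"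
    then obtain h k p q where x: "x = ((h, k), (p, q))" "(h, k) \<in> half_pairs (ugraph A)"
      "(p, q) \<in> half_pairs (ugraph (contract h k A))" by auto
    note cc = contract_contract[OF x(2)[unfolded half_pairs_contractible] x(3)]
    show "prod.swap x \<in> ?P" using cc x by simp
    show "prod.swap (prod.swap x) = x" by simp
    show "?g (prod.swap x) = - ?g x" using gc_class_opposed[where 'k = 'k, OF cc(3)] x by simp
  qed
  finally show ?thesis .
qed

text \<open>This is twice the anticommutator at the class of \<open>A\<close>: the first summand is
  doubled inside \<open>value_H\<close>, the second one explicitly.\<close>

lemma boundary_E_value_H:
  "boundary_E (value_H A) + (boundary_H (value_E A) + boundary_H (value_E A)) = (0 :: 'k::field_char_0 graph_complex)"
proof -
  let ?X = "ugraph A"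
  let ?c = "compl_half ?X"
  let ?P = "SIGMA a:half_pairs ?X. nonloops (ugraph (contract (fst a) (snd a) A))"
  let ?Q = "SIGMA e:nonloops ?X. half_pairs (ugraph (collapse e A))"
  let ?g = "\<lambda>(a, e). gc_class (collapse e (contract (fst a) (snd a) A)) :: 'k graph_complex"
  let ?h = "\<lambda>(e, a). gc_class (contract (fst a) (snd a) (collapse e A)) :: 'k graph_complex"
  \<comment> \<open>Exchanges the roles of the two new edges of one regluing: the edge contracted
    first and the edge collapsed afterwards.\<close>
  let ?\<phi> = "\<lambda>((h, k), e). ((?c h, ?c k), {h, k})"
  \<comment> \<open>In \<open>?P1\<close> an old edge is collapsed, and these terms match
    \<open>?Q\<close>; in \<open>?P2\<close> it is the new edge formed by the complements.\<close>
  let ?P1 = "{x \<in> ?P. snd x \<in> edges ?X}" and ?P2 = "{x \<in> ?P. snd x \<notin> edges ?X}"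
  have fin: "finite ?P"
    by (intro finite_SigmaI finite_half_pairs finite_nonloops wf_ugraph)
  have "boundary_E (value_H A) = (\<Sum>a\<in>half_pairs ?X. value_E (contract (fst a) (snd a) A) :: 'k graph_complex)"
    unfolding value_H_def[of A] linear_gc_sum[OF boundary_E(1)] case_prod_beta boundary_E(2) ..
  also have "\<dots> = sum ?g ?P"
    unfolding value_E_def
    by (subst sum.Sigma) (auto intro: finite_half_pairs finite_nonloops wf_ugraph simp: case_prod_beta)
  also have "\<dots> = sum ?g (?P1 \<union> ?P2)" by (rule sum.cong) auto
  also have "\<dots> = sum ?g ?P1 + sum ?g ?P2"
    by (rule sum.union_disjoint) (use fin in auto)
  also have "sum ?g ?P2 = 0"
  proof (rule sum_involution[where \<phi> = ?\<phi>])
    fix x assume "x \<in> ?P2"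
    then obtain h k e where x: "x = ((h, k), e)" "contractible ?X h k" "e \<in> nonloops (ugraph (contract h k A))"
        "e \<notin> edges ?X" by (auto simp: half_pairs_contractible)
    interpret contractible ?X h k by (rule x)
    have "e \<in> edges Z" using x(3) unfolding ugraph_contract[OF x(2)] by (simp add: nonloops_def)
    then have e: "e = {?c h, ?c k}" using x(4) unfolding c.edges_collapse edges_reglue by auto
    have "collapsible (ugraph (contract h k A)) (?c h) (?c k)"
      using x(3) unfolding e nonloops_iff[OF wf_ugraph] .
    note cc = collapse_contract_compl[OF x(2) this]
    \<comment> \<open>This keeps the image inside \<open>?P2\<close>: after contracting the
      complements, \<open>{h, k}\<close> is again a new edge.\<close>
    have "{h, k} \<notin> edges ?X"
      using compl_half_eq(1)[OF wf, of h k] distinct_hk by auto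
    then show "?\<phi> x \<in> ?P2"
      using x cc by (simp add: half_pairs_contractible nonloops_iff[OF wf_ugraph])
    show "?\<phi> (?\<phi> x) = x"
      using x(1) e distinct4 by simp
    show "?g (?\<phi> x) = - ?g x"
      using gc_class_opposed[where 'k = 'k, OF cc(3)] x(1) e by simp
  qed
  \<comment> \<open>A pair and an old edge that are admissible in one order are admissible in the
    other, so \<open>prod.swap\<close> is a bijection between the index sets.\<close>
  also have "sum ?g ?P1 = (\<Sum>x\<in>?Q. - ?h x)"
  proof (rule sum.reindex_bij_witness[of _ prod.swap prod.swap])
    fix x assume "x \<in> ?P1"
    then obtain h k e where x: "x = ((h, k), e)" "contractible ?X h k" "e \<in> nonloops (ugraph (contract h k A))"
        "e \<in> edges ?X" by (auto simp: half_pairs_contractible)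
    interpret contractible ?X h k by (rule x)
    obtain p q where e: "e = {p, q}" "collapsible (ugraph (contract h k A)) p q"
      using nonloopsE[OF wf_ugraph x(3)] .
    have pq: "{p, q} \<in> edges ?X" using x e by simp
    note f = e(2)[unfolded ugraph_contract[OF x(2)] collapsible_contract_iff[OF pq]]
    interpret f: collapsible ?X p q using f by simp
    have "(h, k) \<in> half_pairs (ugraph (collapse {p, q} A))"
      unfolding collapse_ograph(1)[OF f.collapsible_axioms] f.half_pairs_collapse_iff
      using f x(2) half_pairs_contractible by (metis Int_commute)
    then show "prod.swap x \<in> ?Q"
      using x e f by (simp add: nonloops_iff[OF wf_ugraph])
    show "prod.swap (prod.swap x) = x" by simp
    show "- ?h (prod.swap x) = ?g x"
      using gc_class_opposed[where 'k = 'k, OF collapse_contract[OF x(2) pq e(2)]] x(1) e(1) by simp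
  next
    fix x assume "x \<in> ?Q"
    then obtain h k e where x: "x = (e, (h, k))" "(h, k) \<in> half_pairs (ugraph (collapse e A))" "e \<in> nonloops ?X"
      by auto
    obtain p q where e: "e = {p, q}" "collapsible ?X p q"
      using nonloopsE[OF wf_ugraph x(3)] .
    interpret f: collapsible ?X p q by (rule e)
    note hk = x(2)[unfolded e(1) collapse_ograph(1)[OF e(2)] f.half_pairs_collapse_iff]
    interpret contractible ?X h k using hk by (simp add: half_pairs_contractible)
    have "collapsible (ugraph (contract h k A)) p q"
      unfolding ugraph_contract[OF contractible_axioms] collapsible_contract_iff[OF f.edge]
      using hk e(2) by (metis Int_commute)
    then show "prod.swap x \<in> ?P1"
      using x e hk f.edge by (simp add: nonloops_iff[OF wf_ugraph])
    show "prod.swap (prod.swap x) = x" by simp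
  qed
  also have "(\<Sum>x\<in>?Q. - ?h x) = - (boundary_H (value_E A) + boundary_H (value_E A))"
  proof -
    have "boundary_H (value_E A) + boundary_H (value_E A) = (\<Sum>e\<in>nonloops ?X. value_H (collapse e A) :: 'k graph_complex)"
      unfolding value_E_def[of A] linear_gc_sum[OF boundary_H(1)] sum.distrib[symmetric] boundary_H(2) ..
    also have "\<dots> = sum ?h ?Q"
      unfolding value_H_def
      by (subst sum.Sigma) (auto intro: finite_half_pairs finite_nonloops wf_ugraph simp: case_prod_beta)
    finally show ?thesis by (simp add: sum_negf)
  qed
  finally show ?thesis by simp
qed

lemma linear_gc_eq_0:
  fixes x :: "'k::field_char_0 graph_complex"
  assumes "Vector_Spaces.linear gc_scale gc_scale D" "\<And>A. D (gc_class A) = 0"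
  shows "D x = 0"
proof -
  have "Vector_Spaces.linear gc_scale gc_scale (\<lambda>x. 0 :: 'k graph_complex)"
    by unfold_locales auto
  from linear_gc_eqI[OF assms(1) this assms(2)] show ?thesis .
qed

theorem proposition2p5:
  fixes x :: "'k::field_char_0 graph_complex"
  shows "boundary_E (boundary_E x) = 0 \<and>
         boundary_H (boundary_H x) = 0 \<and>
         ((\<lambda>y. boundary_E y + boundary_H y) ^^ 2) x = 0"
proof -
  let ?E = "boundary_E :: 'k graph_complex \<Rightarrow> _" and ?H = "boundary_H :: 'k graph_complex \<Rightarrow> _"
  interpret E: Vector_Spaces.linear gc_scale gc_scale ?E by (rule boundary_E(1))
  interpret H: Vector_Spaces.linear gc_scale gc_scale ?H by (rule boundary_H(1))
  have EE: "?E (?E y) = 0" for y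
  proof (rule linear_gc_eq_0[where D = "\<lambda>y. ?E (?E y)"])
    show "Vector_Spaces.linear gc_scale gc_scale (\<lambda>y. ?E (?E y))"
      by unfold_locales (simp_all add: E.add E.scale)
  qed (simp add: boundary_E boundary_E_value_E)
  have HH: "?H (?H y) = 0" for y
  proof (rule linear_gc_eq_0[where D = "\<lambda>y. ?H (?H y)"])
    show "Vector_Spaces.linear gc_scale gc_scale (\<lambda>y. ?H (?H y))"
      by unfold_locales (simp_all add: H.add H.scale)
    \<comment> \<open>Four equal terms add up to zero, so the halving is applied twice.\<close>
    show "?H (?H (gc_class A)) = 0" for A
      using boundary_H_value_H[of A, where 'k = 'k]
      unfolding boundary_H(2)[symmetric] H.add by (blast dest: graph_complex_double_eq_0)
  qed
  have EH: "?E (?H y) + ?H (?E y) = 0" for y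
  proof (rule linear_gc_eq_0[where D = "\<lambda>y. ?E (?H y) + ?H (?E y)"])
    show "Vector_Spaces.linear gc_scale gc_scale (\<lambda>y. ?E (?H y) + ?H (?E y))"
      by unfold_locales (simp_all add: E.add E.scale H.add H.scale gc.scale_right_distrib)
    show "?E (?H (gc_class A)) + ?H (?E (gc_class A)) = 0" for A
    proof (rule graph_complex_double_eq_0)
      show "?E (?H (gc_class A)) + ?H (?E (gc_class A)) + (?E (?H (gc_class A)) + ?H (?E (gc_class A))) = 0"
        using boundary_E_value_H[of A, where 'k = 'k]
        unfolding boundary_H(2)[symmetric] boundary_E(2)[symmetric] E.add by (simp only: ac_simps)
    qed
  qed
  have "?E (?E x + ?H x) + ?H (?E x + ?H x) = 0"
    using EH[of x] unfolding E.add H.add EE HH by (simp add: add.commute)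
  then show ?thesis using EE HH by (simp add: numeral_2_eq_2)
qed

end
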